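(* For every integer $n\geq 12$ and every integer $r$ with $3\leq r\leq \lfloor (n-1)/2\rfloor$, the alternating group $A_n$ has at least one string C-group representation of rank $r$; that is, there exist involutions $\rho_0,\dots,\rho_{r-1}\in A_n$ generating $A_n$ such that $(A_n,(\rho_0,\dots,\rho_{r-1}))$ is a string C-group.
   Context: A string group generated by involutions (sggi) of rank $r$ is a pair $(G,(\rho_0,\dots,\rho_{r-1}))$ where $\rho_0,\dots,\rho_{r-1}$ are involutions generating the group $G$ such that $(\rho_i\rho_j)^2=1$ whenever $|i-j|\geq 2$. It is a string C-group (a string C-group representation of $G$ of rank $r$) if in addition it satisfies the intersection property: for all $J,K\subseteq\{0,\dots,r-1\}$, $\langle \rho_j : j\in J\rangle\cap\langle\rho_k : k\in K\rangle=\langle \rho_j : j\in J\cap K\rangle$. *)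

theory Defs
  imports "HOL-Algebra.Sym_Groups" "HOL-Algebra.Generated_Groups"
begin

definition involution :: "('a, 'b) monoid_scheme \<Rightarrow> 'a \<Rightarrow> bool" where
  "involution G x \<longleftrightarrow> x \<in> carrier G \<and> x \<noteq> \<one>\<^bsub>G\<^esub> \<and> x \<otimes>\<^bsub>G\<^esub> x = \<one>\<^bsub>G\<^esub>"

definition sggi :: "('a, 'b) monoid_scheme \<Rightarrow> nat \<Rightarrow> (nat \<Rightarrow> 'a) \<Rightarrow> bool" where
  "sggi G r rho \<longleftrightarrow>
     (\<forall>i<r. involution G (rho i)) \<and>
     generate G (rho ` {..<r}) = carrier G \<and>
     (\<forall>i<r. \<forall>j<r. (i \<ge> j + 2 \<or> j \<ge> i + 2) \<longrightarrow>
        (rho i \<otimes>\<^bsub>G\<^esub> rho j) \<otimes>\<^bsub>G\<^esub> (rho i \<otimes>\<^bsub>G\<^esub> rho j) = \<one>\<^bsub>G\<^esub>)"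

definition string_C_group :: "('a, 'b) monoid_scheme \<Rightarrow> nat \<Rightarrow> (nat \<Rightarrow> 'a) \<Rightarrow> bool" where
  "string_C_group G r rho \<longleftrightarrow>
     sggi G r rho \<and>
     (\<forall>J K. J \<subseteq> {..<r} \<longrightarrow> K \<subseteq> {..<r} \<longrightarrow>
        generate G (rho ` J) \<inter> generate G (rho ` K) = generate G (rho ` (J \<inter> K)))"

end

theory Submission
  imports Defs
begin

text \<open>Let \<open>b_0, \<dots>, b_(k-1)\<close> be a string C-group of even permutations of \<open>N\<close> points, transitive, in
  which only \<open>b_0\<close> moves the point \<open>x\<close>. Attach a path with \<open>m\<close> vertices (\<open>m\<close> divisible by 4) to \<open>x\<close> and
  label its edges alternately by two new generators, the edge at \<open>x\<close> by the second one. The new group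
  of rank \<open>k + 2\<close> contains a three-cycle near \<open>x\<close>, hence is alternating of degree \<open>N + m\<close>. For the
  intersection property it is enough to intersect groups generated by intervals of generators, and
  this follows as soon as, for every \<open>j\<close>, the group generated by \<open>b_0, \<dots>, b_j\<close> contains no even
  permutation of the orbit of \<open>x\<close> under \<open>b_0, \<dots>, b_(j-1)\<close> beyond those generated by
  \<open>b_0, \<dots>, b_(j-1)\<close>.

  For large rank the base is the string group of a path on \<open>K\<close> points, doubled to \<open>2 K\<close> points and
  joined by one more involution: every element commutes with the swap of the two copies, so one
  supported on a single copy is trivial. This settles even degree with \<open>m = 4\<close>, and odd degree after
  adding one further point and one further generator. Ranks 3, 4, 5 come from bases of degree 5, 6,
  9, 11, 12 by letting \<open>m\<close> grow. If \<open>rho_2 rho_3\<close> has odd order, \<open>rho_1, rho_0 rho_2, rho_3, \<dots>\<close> is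
  again a string C-group for the same group, of rank one less. Degree 12 in ranks 3 and 4 is done
  separately.\<close>

section \<open>Permutation groups generated by involutions\<close>

text \<open>What shapes the construction is the intersection property. Attaching a path at
  \<open>x\<close> makes it tractable: in the glued group every element generated by
  \<open>alpha\<close>, \<open>beta\<close> and \<open>b_0, \<dots>, b_(j-1)\<close> is an even
  permutation of the path and the orbit of \<open>x\<close> times an old element. The old element
  fixes the path, so intersections can be read off from the action on path points.

  A path group alone will not serve as base: its generators of small index are single
  transpositions, hence odd. Two copies make them even, and the swap of the copies yields the
  condition on orbits for every \<open>j\<close> at once.

  The labels on that path need \<open>q \<ge> 2\<close>. Counting the joining involution and the
  generators glued on, the doubled family starts at rank 5 for even and at rank 6 for odd degree,
  which leaves ranks 3 to 5 to single bases, one for each residue of the degree modulo 4. Rank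
  reduction needs products of odd order. In the base of degree 9 the first two generators have a
  product of order 12, so degrees 1 mod 4 get ranks 3 and 4 from degree 5 instead. Degree 12 stands
  apart because a positive multiple of 4 must be added to the base of degree 12.\<close>

inductive_set gen :: "('a \<Rightarrow> 'a) set \<Rightarrow> ('a \<Rightarrow> 'a) set" for S where
  gen_id: "id \<in> gen S"
| gen_step: "s \<in> S \<Longrightarrow> g \<in> gen S \<Longrightarrow> s \<circ> g \<in> gen S"

lemma gen_base: "s \<in> S \<Longrightarrow> s \<in> gen S"
  using gen_step[OF _ gen_id] by fastforce

lemma gen_comp: "g \<in> gen S \<Longrightarrow> h \<in> gen S \<Longrightarrow> g \<circ> h \<in> gen S"
  by (induction rule: gen.induct) (auto simp: comp_assoc intro: gen_step)

lemma gen_least: "S \<subseteq> gen T \<Longrightarrow> gen S \<subseteq> gen T"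
proof
  fix g assume "S \<subseteq> gen T" "g \<in> gen S"
  from this(2,1) show "g \<in> gen T"
    by (induction rule: gen.induct) (auto intro: gen_id gen_comp)
qed

lemma gen_mono: "S \<subseteq> T \<Longrightarrow> gen S \<subseteq> gen T"
  by (rule gen_least) (auto intro: gen_base)

lemma gen_bij:
  assumes "\<And>s. s \<in> S \<Longrightarrow> s \<circ> s = id" and "g \<in> gen S"
  shows "bij g"
  using assms(2)
proof (induction rule: gen.induct)
  case (gen_step s g)
  have "bij s" using assms(1)[OF gen_step.hyps(1)] o_bij by blast
  then show ?case using gen_step.IH bij_comp by blast
qed (rule bij_id)

lemma gen_inv:
  assumes "\<And>s. s \<in> S \<Longrightarrow> s \<circ> s = id" and "g \<in> gen S"
  shows "inv' g \<in> gen S"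
  using assms(2)
proof (induction rule: gen.induct)
  case (gen_step s g)
  have s: "bij s" "inv' s = s"
    using assms(1)[OF gen_step.hyps(1)] o_bij inv_unique_comp by blast+
  have "inv' (s \<circ> g) = inv' g \<circ> s"
    using s gen_bij[OF assms(1) gen_step.hyps(2)] o_inv_distrib by metis
  then show ?case using gen_step gen_comp gen_base by metis
qed (unfold inv_id, rule gen_id)

lemma gen_empty [simp]: "gen {} = {id}"
  by (auto intro: gen_id elim: gen.induct)

lemma gen_singleton:
  assumes "s \<circ> s = id" shows "gen {s} = {id, s}"
proof
  show "gen {s} \<subseteq> {id, s}"
  proof
    fix g assume "g \<in> gen {s}"
    then show "g \<in> {id, s}" by (induction rule: gen.induct) (use assms comp_id in \<open>metis insert_iff singletonD\<close>)+
  qed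
qed (use gen_id[of "{s}"] gen_base[of s "{s}"] in blast)

lemma gen_commute:
  assumes "\<And>s. s \<in> S \<Longrightarrow> s \<circ> t = t \<circ> s" and "g \<in> gen S"
  shows "g \<circ> t = t \<circ> g"
  using assms(2)
proof (induction rule: gen.induct)
  case (gen_step s g)
  then show ?case using assms(1)[OF gen_step.hyps(1)] by (metis comp_assoc)
qed (simp only: id_comp comp_id)

lemma gen_Un_commute:
  assumes "\<And>s t. s \<in> S \<Longrightarrow> t \<in> T \<Longrightarrow> s \<circ> t = t \<circ> s" and "g \<in> gen (S \<union> T)"
  obtains x y where "x \<in> gen S" "y \<in> gen T" "g = x \<circ> y"
proof -
  have "\<exists>x\<in>gen S. \<exists>y\<in>gen T. g = x \<circ> y"
    using assms(2)
  proof (induction rule: gen.induct)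
    case gen_id
    show ?case by (intro bexI[of _ id]) (simp_all only: id_comp gen.gen_id)
  next
    case (gen_step s g)
    then obtain x y where xy: "x \<in> gen S" "y \<in> gen T" "g = x \<circ> y" by blast
    show ?case
    proof (cases "s \<in> S")
      case True
      then show ?thesis using xy gen.gen_step by (metis comp_assoc)
    next
      case False
      then have sT: "s \<in> T" using gen_step by blast
      then have "x \<circ> s = s \<circ> x" using gen_commute[OF _ xy(1)] assms(1) by blast
      then show ?thesis using xy gen.gen_step[OF sT xy(2)] by (metis comp_assoc)
    qed
  qed
  then show ?thesis using that by blast
qed

lemma gen_induct_left:
  assumes "g \<in> gen S" "P id" "\<And>s g. s \<in> S \<Longrightarrow> P g \<Longrightarrow> P (s \<circ> g)"
  shows "P g"
  using assms by (induction rule: gen.induct) auto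

section \<open>The intersection property\<close>

text \<open>Only the two maximal proper subintervals of each \<open>{i..j}\<close> are compared.
  This is far less than all pairs of index sets, yet enough for generators that commute at distance
  two.\<close>

definition interval_ip :: "nat \<Rightarrow> (nat \<Rightarrow> 'a \<Rightarrow> 'a) \<Rightarrow> bool" where
  "interval_ip r rho \<longleftrightarrow> (\<forall>i j. i < j \<longrightarrow> j < r \<longrightarrow>
     gen (rho ` {i..<j}) \<inter> gen (rho ` {i<..j}) \<subseteq> gen (rho ` {i<..<j}))"

locale string_involutions =
  fixes r :: nat and rho :: "nat \<Rightarrow> 'a \<Rightarrow> 'a"
  assumes invol: "i < r \<Longrightarrow> rho i \<circ> rho i = id"
    and far_commute: "i + 2 \<le> j \<Longrightarrow> j < r \<Longrightarrow> rho i \<circ> rho j = rho j \<circ> rho i"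
begin

abbreviation H :: "nat set \<Rightarrow> ('a \<Rightarrow> 'a) set" where "H A \<equiv> gen (rho ` A)"

lemma H_mono: "A \<subseteq> B \<Longrightarrow> H A \<subseteq> H B"
  by (intro gen_mono image_mono)

lemma H_bij: "A \<subseteq> {..<r} \<Longrightarrow> g \<in> H A \<Longrightarrow> bij g"
  using gen_bij[of "rho ` A"] invol by blast

lemma H_inv: "A \<subseteq> {..<r} \<Longrightarrow> g \<in> H A \<Longrightarrow> inv' g \<in> H A"
  using gen_inv[of "rho ` A"] invol by blast

text \<open>Once \<open>c\<close> is missing, indices below and above it differ by at least 2, so
  the two halves commute.\<close>

lemma H_split:
  assumes "A \<subseteq> {..<r}" "g \<in> H A" "c \<notin> A"
  obtains x y where "x \<in> H (A \<inter> {..<c})" "y \<in> H (A \<inter> {c<..})" "g = x \<circ> y"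
proof (rule gen_Un_commute[of "rho ` (A \<inter> {..<c})" "rho ` (A \<inter> {c<..})" g])
  fix s t assume "s \<in> rho ` (A \<inter> {..<c})" "t \<in> rho ` (A \<inter> {c<..})"
  then obtain i j where "s = rho i" "t = rho j" "i < c" "c < j" "j \<in> A" by blast
  then show "s \<circ> t = t \<circ> s" using far_commute[of i j] assms(1) by fastforce
next
  have "A = (A \<inter> {..<c}) \<union> (A \<inter> {c<..})"
    using assms(3) by (auto simp: not_less le_less)
  then show "g \<in> gen (rho ` (A \<inter> {..<c}) \<union> rho ` (A \<inter> {c<..}))"
    using assms(2) by (metis image_Un)
qed (use that in blast)

text \<open>Induction on the length of an interval containing \<open>A\<close> and \<open>B\<close>.
  A missing end of the interval can be stripped from both sets. If both sets contain both ends, each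
  still lacks some inner index, and splitting there leads back to shorter intervals.\<close>

theorem intersection_property_interval:
  assumes ip: "interval_ip r rho"
  shows "a + l \<le> r \<Longrightarrow> A \<subseteq> {a..<a + l} \<Longrightarrow> B \<subseteq> {a..<a + l} \<Longrightarrow> H A \<inter> H B \<subseteq> H (A \<inter> B)"
proof (induction l arbitrary: a A B)
  case 0
  then show ?case by simp
next
  case (Suc l)
  define e where "e = a + l"
  define I where "I = {a..e}"
  have er: "e < r" using Suc.prems(1) by (simp add: e_def)
  have se: "{a..<e} \<subseteq> {..<r}" "{a<..e} \<subseteq> {..<r}" using er by auto
  have I: "A \<subseteq> I" "B \<subseteq> I" using Suc.prems by (auto simp: I_def e_def)
  have IH1: "g \<in> H (X \<inter> Y)" if "X \<subseteq> {a..<e}" "Y \<subseteq> {a..<e}" "g \<in> H X" "g \<in> H Y" for X Y g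
    using Suc.IH[of a X Y] that er by (auto simp: e_def)
  have IH2: "g \<in> H (X \<inter> Y)" if "X \<subseteq> {a<..e}" "Y \<subseteq> {a<..e}" "g \<in> H X" "g \<in> H Y" for X Y g
  proof -
    have "{a<..e} = {Suc a..<Suc a + l}" by (auto simp: e_def)
    then show ?thesis using Suc.IH[of "Suc a" X Y] that er by (auto simp: e_def)
  qed
  have sub: "X \<subseteq> {..<r}" if "X \<subseteq> I" for X using that er by (auto simp: I_def)
  \<comment> \<open>A missing index \<open>c\<close> splits \<open>g\<close> as
    \<open>x \<circ> y\<close>. Here \<open>x\<close> never involves \<open>e\<close>, and
    \<open>y\<close> lies in both maximal subintervals, so \<open>interval_ip\<close> removes
    \<open>e\<close> from \<open>y\<close>.\<close>
  have top: "g \<in> H (X - {e})" if X: "X \<subseteq> I" "g \<in> H X" "g \<in> H {a..<e}" for X g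
  proof (cases "e \<in> X \<and> X \<noteq> I")
    case False
    moreover have "I - {e} = {a..<e}" by (auto simp: I_def)
    ultimately show ?thesis using X by (cases "e \<in> X") auto
  next
    case True
    then obtain c where c: "c \<in> I" "c \<notin> X" using X by blast
    then have ce: "a \<le> c" "c < e" using True by (auto simp: I_def le_less)
    obtain x y where xy: "x \<in> H (X \<inter> {..<c})" "y \<in> H (X \<inter> {c<..})" "g = x \<circ> y"
      using H_split[OF sub[OF X(1)] X(2) c(2)] by blast
    have "X \<inter> {..<c} \<subseteq> {a..<e}" using X(1) ce by (auto simp: I_def)
    then have x: "x \<in> H {a..<e}" using xy(1) H_mono by blast
    have "bij x" using H_bij[OF se(1) x] .
    then have y: "y = inv' x \<circ> g" using xy(3) by (simp add: comp_assoc[symmetric] bij_is_inj)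
    have y1: "y \<in> H {a..<e}" unfolding y using x X(3) er by (intro gen_comp H_inv) auto
    have c1: "X \<inter> {c<..} \<subseteq> {a<..e}" using X(1) ce by (auto simp: I_def)
    then have "y \<in> H {a<..e}" using xy(2) H_mono by blast
    then have "y \<in> H {a<..<e}" using y1 ip ce er unfolding interval_ip_def by (meson IntI le_less_trans subsetD)
    then have "y \<in> H ((X \<inter> {c<..}) \<inter> {a<..<e})"
      using c1 xy by - (rule IH2; auto)
    then have "y \<in> H (X - {e})" by (rule subsetD[OF H_mono, rotated]) auto
    moreover have "x \<in> H (X - {e})" using xy(1) by (rule subsetD[OF H_mono, rotated]) (use ce in auto)
    ultimately show ?thesis unfolding xy(3) by (rule gen_comp[rotated])
  qed
  have bot: "g \<in> H (X - {a})" if X: "X \<subseteq> I" "g \<in> H X" "g \<in> H {a<..e}" for X g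
  proof (cases "a \<in> X \<and> X \<noteq> I")
    case False
    moreover have "I - {a} = {a<..e}" by (auto simp: I_def)
    ultimately show ?thesis using X by (cases "a \<in> X") auto
  next
    case True
    then obtain c where c: "c \<in> I" "c \<notin> X" using X by blast
    then have ce: "a < c" "c \<le> e" using True by (auto simp: I_def le_less)
    obtain x y where xy: "x \<in> H (X \<inter> {..<c})" "y \<in> H (X \<inter> {c<..})" "g = x \<circ> y"
      using H_split[OF sub[OF X(1)] X(2) c(2)] by blast
    have "X \<inter> {c<..} \<subseteq> {a<..e}" using X(1) ce by (auto simp: I_def)
    then have y: "y \<in> H {a<..e}" using xy(2) H_mono by blast
    have "bij y" using H_bij[OF se(2) y] .
    then have x: "x = g \<circ> inv' y" using xy(3) by (simp add: comp_assoc bij_is_surj surj_iff[THEN iffD1])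
    have x1: "x \<in> H {a<..e}" unfolding x using y X(3) er by (intro gen_comp H_inv) auto
    have c1: "X \<inter> {..<c} \<subseteq> {a..<e}" using X(1) ce by (auto simp: I_def)
    then have "x \<in> H {a..<e}" using xy(1) H_mono by blast
    then have "x \<in> H {a<..<e}" using x1 ip ce er unfolding interval_ip_def by (meson IntI less_le_trans subsetD)
    then have "x \<in> H ((X \<inter> {..<c}) \<inter> {a<..<e})"
      using c1 xy by - (rule IH1; auto)
    then have "x \<in> H (X - {a})" by (rule subsetD[OF H_mono, rotated]) auto
    moreover have "y \<in> H (X - {a})" using xy(2) by (rule subsetD[OF H_mono, rotated]) (use ce in auto)
    ultimately show ?thesis unfolding xy(3) by (rule gen_comp)
  qed
  have main: "g \<in> H (X \<inter> Y)"
    if X: "X \<subseteq> I" "a \<in> X" "e \<in> X" "c \<in> I" "c \<notin> X" and Y: "Y \<subseteq> I" "a \<in> Y" "e \<in> Y" "d \<in> I" "d \<notin> Y"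
      and cd: "c \<le> d" and g: "g \<in> H X" "g \<in> H Y" for X Y c d g
  proof -
    have ac: "a < c" "c \<le> d" "d < e" using X Y cd by (auto simp: I_def le_less)
    obtain x y where xy: "x \<in> H (X \<inter> {..<c})" "y \<in> H (X \<inter> {c<..})" "g = x \<circ> y"
      using H_split[OF sub[OF X(1)] g(1) X(5)] by blast
    obtain u v where uv: "u \<in> H (Y \<inter> {..<d})" "v \<in> H (Y \<inter> {d<..})" "g = u \<circ> v"
      using H_split[OF sub[OF Y(1)] g(2) Y(5)] by blast
    have bij: "bij x" "bij y" "bij u" "bij v"
      using xy uv H_bij sub X(1) Y(1) by (meson inf.coboundedI1)+
    \<comment> \<open>The discrepancy between the two factorisations. As
      \<open>inv' u \<circ> x\<close> it avoids the indices from \<open>d\<close> on, as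
      \<open>v \<circ> inv' y\<close> those up to \<open>c\<close>, so it lives strictly between
      \<open>c\<close> and \<open>d\<close>.\<close>
    define w where "w = inv' u \<circ> x"
    have uw: "u \<circ> w = x" unfolding w_def using bij by (simp add: comp_assoc[symmetric] bij_is_surj surj_iff[THEN iffD1])
    have "inv' u \<circ> (x \<circ> y) = (inv' u \<circ> u) \<circ> v" using xy(3) uv(3) by (simp only: comp_assoc)
    then have wy: "w \<circ> y = v" unfolding w_def using bij by (simp add: comp_assoc bij_is_inj)
    have vy: "w = v \<circ> inv' y" unfolding wy[symmetric] using bij
      by (simp add: comp_assoc bij_is_surj surj_iff[THEN iffD1])
    have s1: "X \<inter> {..<c} \<subseteq> {a..<c}" "Y \<inter> {..<d} \<subseteq> {a..<d}" "X \<inter> {c<..} \<subseteq> {c<..e}" "Y \<inter> {d<..} \<subseteq> {d<..e}"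
      using X(1) Y(1) by (auto simp: I_def)
    have xI: "x \<in> H {a..<c}" "u \<in> H {a..<d}" "y \<in> H {c<..e}" "v \<in> H {d<..e}"
      using xy uv s1 H_mono by blast+
    have "x \<in> H {a..<d}" using xI(1) by (rule subsetD[OF H_mono, rotated]) (use ac in auto)
    then have w1: "w \<in> H {a..<d}" unfolding w_def using xI(2) ac er by (intro gen_comp H_inv) auto
    have "v \<in> H {c<..e}" using xI(4) by (rule subsetD[OF H_mono, rotated]) (use ac in auto)
    then have w2: "w \<in> H {c<..e}" unfolding vy using xI(3) ac er by (intro gen_comp H_inv) auto
    have w3: "w \<in> H {a..<e}" using w1 by (rule subsetD[OF H_mono, rotated]) (use ac in auto)
    have "w \<in> H ({c<..e} - {e})" by (rule top) (use w2 w3 ac in \<open>auto simp: I_def\<close>)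
    then have "w \<in> H (({c<..e} - {e}) \<inter> {a..<d})" using w1 ac by - (rule IH1; auto)
    then have w: "w \<in> H {c<..<d}" by (rule subsetD[OF H_mono, rotated]) (use ac in auto)
    have bw: "bij w" by (rule H_bij[OF _ w]) (use ac er in auto)
    have iw: "inv' w \<in> H {c<..<d}" using w ac er by (intro H_inv) auto
    have ux: "u = x \<circ> inv' w" unfolding uw[symmetric] using bw
      by (simp add: comp_assoc bij_is_surj surj_iff[THEN iffD1])
    let ?D = "X \<inter> {..<c} \<union> {c<..<d}"
    have "x \<in> H ?D" "inv' w \<in> H ?D" using xy(1) iw H_mono[of _ ?D] by blast+
    then have "u \<in> H ?D" unfolding ux by (rule gen_comp)
    then have u: "u \<in> H (?D \<inter> (Y \<inter> {..<d}))"
      using uv s1 ac by - (rule IH1; auto)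
    have "?D \<inter> (Y \<inter> {..<d}) \<subseteq> {..<r}" "c \<notin> ?D \<inter> (Y \<inter> {..<d})" using ac er by auto
    then obtain u1 u2 where u12: "u1 \<in> H (?D \<inter> (Y \<inter> {..<d}) \<inter> {..<c})"
        "u2 \<in> H (?D \<inter> (Y \<inter> {..<d}) \<inter> {c<..})" "u = u1 \<circ> u2"
      using H_split[OF _ u] by blast
    have u1: "u1 \<in> H (X \<inter> Y \<inter> {..<c})" using u12(1) by (rule subsetD[OF H_mono, rotated]) auto
    have u2: "u2 \<in> H ({c<..<d} \<inter> Y)" using u12(2) by (rule subsetD[OF H_mono, rotated]) auto
    have bu1: "bij u1" by (rule H_bij[OF _ u1]) (use ac er in auto)
    \<comment> \<open>The left side uses indices below \<open>c\<close> only, the right side indices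
      strictly between \<open>c\<close> and \<open>d\<close> only. Nothing is common, so both sides
      are the identity and \<open>x = u1\<close>.\<close>
    have xu: "inv' u1 \<circ> x = u2 \<circ> w"
      unfolding uw[symmetric] u12(3) comp_assoc using bu1 by (simp add: comp_assoc[symmetric] bij_is_inj)
    have "u1 \<in> H {a..<c}" using u1 by (rule subsetD[OF H_mono, rotated]) (use X(1) in \<open>auto simp: I_def\<close>)
    then have 1: "u2 \<circ> w \<in> H {a..<c}" unfolding xu[symmetric] using xI(1) ac er by (intro gen_comp H_inv) auto
    have "u2 \<in> H {c<..<d}" using u2 by (rule subsetD[OF H_mono, rotated]) auto
    then have 2: "u2 \<circ> w \<in> H {c<..<d}" using w by (rule gen_comp)
    have "u2 \<circ> w \<in> H ({a..<c} \<inter> {c<..<d})" using 1 2 ac by - (rule IH1; auto)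
    moreover have "{a..<c} \<inter> {c<..<d} = {}" by auto
    ultimately have uw2: "u2 \<circ> w = id" by simp
    have xu1: "x = u1" using uw u12(3) uw2 by (metis comp_assoc comp_id)
    have "u2 \<circ> v = y" unfolding wy[symmetric] comp_assoc[symmetric] uw2 by simp
    moreover have "u2 \<circ> v \<in> H (({c<..<d} \<inter> Y) \<union> (Y \<inter> {d<..}))"
      using u2 uv(2) by (intro gen_comp) (meson H_mono subsetD sup_ge1 sup_ge2)+
    ultimately have "y \<in> H ((X \<inter> {c<..}) \<inter> (({c<..<d} \<inter> Y) \<union> (Y \<inter> {d<..})))"
      using xy(2) s1 ac by - (rule IH2; auto)
    then have "y \<in> H (X \<inter> Y)" by (rule subsetD[OF H_mono, rotated]) auto
    moreover have "x \<in> H (X \<inter> Y)" unfolding xu1 using u1 by (rule subsetD[OF H_mono, rotated]) auto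
    ultimately show ?thesis unfolding xy(3) by (rule gen_comp[rotated])
  qed
  show ?case
  proof
    fix g assume g: "g \<in> H A \<inter> H B"
    have sym: "g \<in> H (A \<inter> B)" if "g \<in> H (B \<inter> A)" using that by (simp add: Int_commute)
    have noe: "g \<in> H (X \<inter> Y)" if "X \<subseteq> I" "Y \<subseteq> I" "e \<notin> Y" "g \<in> H X" "g \<in> H Y" for X Y
    proof -
      have Y: "Y \<subseteq> {a..<e}" using that by (auto simp: I_def le_less)
      then have "g \<in> H (X - {e})" using top[OF that(1,4)] that(5) H_mono by blast
      then have "g \<in> H ((X - {e}) \<inter> Y)" using Y that by - (rule IH1; auto simp: I_def le_less)
      then show ?thesis by (rule subsetD[OF H_mono, rotated]) auto
    qed
    have noa: "g \<in> H (X \<inter> Y)" if "X \<subseteq> I" "Y \<subseteq> I" "a \<notin> Y" "g \<in> H X" "g \<in> H Y" for X Y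
    proof -
      have Y: "Y \<subseteq> {a<..e}" using that by (auto simp: I_def le_less)
      then have "g \<in> H (X - {a})" using bot[OF that(1,4)] that(5) H_mono by blast
      then have "g \<in> H ((X - {a}) \<inter> Y)" using Y that by - (rule IH2; auto simp: I_def le_less)
      then show ?thesis by (rule subsetD[OF H_mono, rotated]) auto
    qed
    have gA: "g \<in> H A" and gB: "g \<in> H B" using g by blast+
    consider "A = I" | "B = I" | "e \<notin> A" | "e \<notin> B" | "a \<notin> A" | "a \<notin> B"
      | c d where "a \<in> A" "e \<in> A" "a \<in> B" "e \<in> B" "c \<in> I" "c \<notin> A" "d \<in> I" "d \<notin> B"
      using I by (metis subsetI subset_antisym)
    then show "g \<in> H (A \<inter> B)"
    proof cases
      case 1
      then show ?thesis using gB I(2) by (simp only: Int_absorb1)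
    next
      case 2
      then show ?thesis using gA I(1) by (simp only: Int_absorb2)
    next
      case 3
      show ?thesis by (rule sym, rule noe) (fact I 3 gA gB)+
    next
      case 4
      show ?thesis by (rule noe) (fact I 4 gA gB)+
    next
      case 5
      show ?thesis by (rule sym, rule noa) (fact I 5 gA gB)+
    next
      case 6
      show ?thesis by (rule noa) (fact I 6 gA gB)+
    next
      case 7
      show ?thesis
      proof (cases "c \<le> d")
        case True
        show ?thesis by (rule main[of A c B d]) (fact I 7 gA gB True)+
      next
        case False
        then have "d \<le> c" by simp
        show ?thesis by (rule sym, rule main[of B d A c]) (fact I 7 gA gB \<open>d \<le> c\<close>)+
      qed
    qed
  qed
qed

lemma intersection_property:
  assumes "interval_ip r rho" "A \<subseteq> {..<r}" "B \<subseteq> {..<r}"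
  shows "H A \<inter> H B \<subseteq> H (A \<inter> B)"
  using intersection_property_interval[of 0 r A B] assms by (simp add: atLeast0LessThan)

end

section \<open>String C-groups on alternating groups\<close>

definition Alt :: "nat set \<Rightarrow> (nat \<Rightarrow> nat) set" where
  "Alt C = {p. p permutes C \<and> evenperm p}"

lemma Alt_comp: "finite C \<Longrightarrow> p \<in> Alt C \<Longrightarrow> q \<in> Alt C \<Longrightarrow> p \<circ> q \<in> Alt C"
  unfolding Alt_def
  by (auto simp only: mem_Collect_eq intro: permutes_compose)
    (metis evenperm_comp permutation_permutes)

lemma Alt_mono: "C \<subseteq> D \<Longrightarrow> Alt C \<subseteq> Alt D"
  unfolding Alt_def using permutes_subset by blast

lemma gen_subset_Alt:
  assumes "finite C" "S \<subseteq> Alt C" shows "gen S \<subseteq> Alt C"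
proof
  fix g assume "g \<in> gen S"
  then show "g \<in> Alt C"
  proof (induction rule: gen.induct)
    case gen_id
    then show ?case by (simp only: Alt_def mem_Collect_eq permutes_id evenperm_id)
  next
    case (gen_step s g)
    then show ?case using Alt_comp assms by blast
  qed
qed

lemma Alt_carrier: "Alt {1..n} = carrier (alt_group n)"
  by (auto simp: Alt_def alt_group_carrier)

text \<open>The link to the library notion. For involutions words without inverses already form a
  group, so \<open>gen\<close> needs neither a carrier nor an inverse rule.\<close>

lemma generate_alt_group:
  assumes "S \<subseteq> Alt {1..n}" "\<And>s. s \<in> S \<Longrightarrow> s \<circ> s = id"
  shows "generate (alt_group n) S = gen S"
proof
  have carr: "gen S \<subseteq> carrier (alt_group n)"
    using gen_subset_Alt[OF _ assms(1)] by (simp only: Alt_carrier finite_atLeastAtMost)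
  show "generate (alt_group n) S \<subseteq> gen S"
  proof
    fix g assume "g \<in> generate (alt_group n) S"
    then show "g \<in> gen S"
    proof (induction rule: generate.induct)
      case (inv h)
      then have h: "h \<in> gen S" by (rule gen_base)
      have "inv\<^bsub>alt_group n\<^esub> h = inv' h" using h carr alt_group_inv_equality by blast
      then show ?case using gen_inv[OF assms(2) h] by simp
    qed (use alt_group_one alt_group_mult gen_id gen_base gen_comp in metis)+
  qed
  show "gen S \<subseteq> generate (alt_group n) S"
  proof
    fix g assume "g \<in> gen S"
    then show "g \<in> generate (alt_group n) S"
    proof (induction rule: gen.induct)
      case gen_id
      then show ?case using generate.one[of "alt_group n" S] alt_group_one by metis
    next
      case (gen_step s g)
      then show ?case using generate.eng generate.incl alt_group_mult by metis
    qed
  qed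
qed

definition alt_string :: "nat \<Rightarrow> nat \<Rightarrow> (nat \<Rightarrow> nat \<Rightarrow> nat) \<Rightarrow> bool" where
  "alt_string n r rho \<longleftrightarrow> string_involutions r rho \<and> (\<forall>i<r. rho i \<in> Alt {1..n} \<and> rho i \<noteq> id)
     \<and> interval_ip r rho \<and> Alt {1..n} \<subseteq> gen (rho ` {..<r})"

lemma alt_string_imp_string_C_group:
  assumes "alt_string n r rho" shows "string_C_group (alt_group n) r rho"
proof -
  interpret string_involutions r rho using assms by (simp add: alt_string_def)
  have alt: "rho i \<in> Alt {1..n}" "rho i \<noteq> id" if "i < r" for i
    using assms that by (auto simp: alt_string_def)
  have gen: "generate (alt_group n) (rho ` A) = H A" if "A \<subseteq> {..<r}" for A
    using that alt invol by (intro generate_alt_group) auto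
  have "rho ` {..<r} \<subseteq> Alt {1..n}" using alt by blast
  then have "H {..<r} \<subseteq> Alt {1..n}" by (intro gen_subset_Alt) auto
  then have carr: "H {..<r} = carrier (alt_group n)"
    using assms unfolding alt_string_def Alt_carrier by blast
  have "involution (alt_group n) (rho i)" if "i < r" for i
    using alt[OF that] invol[OF that]
    unfolding involution_def alt_group_mult alt_group_one by (simp add: Alt_def alt_group_carrier)
  moreover have "(rho i \<circ> rho j) \<circ> (rho i \<circ> rho j) = id" if "i < r" "j < r" "i \<ge> j + 2 \<or> j \<ge> i + 2" for i j
  proof -
    have "rho i \<circ> rho j = rho j \<circ> rho i" using that far_commute by metis
    then have "(rho i \<circ> rho j) \<circ> (rho i \<circ> rho j) = rho i \<circ> (rho j \<circ> rho j) \<circ> rho i"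
      by (metis comp_assoc)
    then show ?thesis using invol that by (metis comp_id)
  qed
  ultimately have "sggi (alt_group n) r rho"
    unfolding sggi_def alt_group_mult alt_group_one using gen[of "{..<r}"] carr by simp
  moreover have "generate (alt_group n) (rho ` A) \<inter> generate (alt_group n) (rho ` B)
      = generate (alt_group n) (rho ` (A \<inter> B))" if AB: "A \<subseteq> {..<r}" "B \<subseteq> {..<r}" for A B
  proof -
    have AB': "A \<inter> B \<subseteq> {..<r}" using AB by blast
    have "interval_ip r rho" using assms by (simp add: alt_string_def)
    then show ?thesis unfolding gen[OF AB(1)] gen[OF AB(2)] gen[OF AB']
      using intersection_property[OF _ AB] H_mono[of "A \<inter> B" A] H_mono[of "A \<inter> B" B] by blast
  qed
  ultimately show ?thesis by (simp add: string_C_group_def)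
qed

section \<open>Rank reduction\<close>

text \<open>In the dihedral group of \<open>x\<close> and \<open>y = u \<circ> v\<close>, each
  element is a rotation or becomes one after multiplication by \<open>y\<close>. Rotations commute
  with \<open>c = x \<circ> y\<close>; thus \<open>u\<close> or \<open>u \<circ> y = v\<close>
  commutes with \<open>c\<close>, and since it also commutes with \<open>y\<close>, it commutes with
  \<open>x\<close>. The contrapositive keeps \<open>u\<close> out of the group.\<close>

lemma dihedral_commute:
  fixes u v x :: "'a \<Rightarrow> 'a"
  assumes "x \<circ> x = id" "u \<circ> u = id" "v \<circ> v = id" "u \<circ> v = v \<circ> u" and "u \<in> gen {x, u \<circ> v}"
  shows "u \<circ> x = x \<circ> u \<or> v \<circ> x = x \<circ> v"
proof -
  define y where "y = u \<circ> v"
  define c where "c = x \<circ> y"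
  have yy: "y \<circ> y = id" unfolding y_def using assms(2-4) by (metis comp_assoc comp_id)
  have xy: "x = c \<circ> y" unfolding c_def using yy by (simp only: comp_assoc comp_id)
  have uy: "u \<circ> y = y \<circ> u" unfolding y_def using assms(4) by (metis comp_assoc)
  have vy: "v \<circ> y = y \<circ> v" unfolding y_def using assms(4) by (metis comp_assoc)
  have yx: "y \<circ> x \<circ> c = id" unfolding c_def using yy assms(1) by (metis comp_assoc comp_id)
  have cyx: "c \<circ> (y \<circ> x) = id" unfolding c_def using yy assms(1) by (metis comp_assoc comp_id)
  \<comment> \<open>The centraliser of the rotation. Both \<open>x\<close> and \<open>y\<close>
    conjugate \<open>c\<close> to its inverse \<open>y \<circ> x\<close>, hence normalise
    \<open>Cs\<close>.\<close>
  define Cs where "Cs = {g. g \<circ> c = c \<circ> g}"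
  have Cs_comp: "g \<circ> h \<in> Cs" if "g \<in> Cs" "h \<in> Cs" for g h
    using that unfolding Cs_def mem_Collect_eq by (metis comp_assoc)
  have c1: "c \<in> Cs" by (simp add: Cs_def)
  have c2: "y \<circ> x \<in> Cs" using yx cyx by (simp add: Cs_def)
  have norm: "x \<circ> g \<circ> x \<in> Cs" "y \<circ> g \<circ> y \<in> Cs" if "g \<in> Cs" for g
  proof -
    have gc: "g \<circ> c = c \<circ> g" using that by (simp add: Cs_def)
    have "g \<circ> (y \<circ> x) = ((y \<circ> x \<circ> c) \<circ> g) \<circ> (y \<circ> x)" unfolding yx by (simp only: id_comp)
    also have "\<dots> = (y \<circ> x) \<circ> (c \<circ> g) \<circ> (y \<circ> x)" by (simp only: comp_assoc)
    also have "\<dots> = (y \<circ> x) \<circ> g \<circ> (c \<circ> (y \<circ> x))" unfolding gc[symmetric] by (simp only: comp_assoc)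
    also have "\<dots> = (y \<circ> x) \<circ> g" unfolding cyx by (simp only: comp_id)
    finally have gc': "g \<circ> (y \<circ> x) = (y \<circ> x) \<circ> g" .
    have "t \<circ> g \<circ> t \<in> Cs" if t: "t \<circ> c = (y \<circ> x) \<circ> t" "c \<circ> t = t \<circ> (y \<circ> x)" for t
    proof -
      have "t \<circ> g \<circ> t \<circ> c = t \<circ> g \<circ> (t \<circ> c)" by (simp only: comp_assoc)
      also have "\<dots> = t \<circ> (g \<circ> (y \<circ> x)) \<circ> t" unfolding t(1) by (simp only: comp_assoc)
      also have "\<dots> = (t \<circ> (y \<circ> x)) \<circ> g \<circ> t" unfolding gc' by (simp only: comp_assoc)
      also have "\<dots> = c \<circ> (t \<circ> g \<circ> t)" unfolding t(2)[symmetric] by (simp only: comp_assoc)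
      finally show ?thesis by (simp only: Cs_def mem_Collect_eq)
    qed
    moreover have "x \<circ> c = (y \<circ> x) \<circ> x"
      unfolding c_def comp_assoc[symmetric] assms(1) unfolding comp_assoc assms(1) by (simp only: id_comp comp_id)
    moreover have "c \<circ> x = x \<circ> (y \<circ> x)" unfolding c_def by (simp only: comp_assoc)
    moreover have "y \<circ> c = (y \<circ> x) \<circ> y" unfolding c_def by (simp only: comp_assoc)
    moreover have "c \<circ> y = y \<circ> (y \<circ> x)"
      unfolding c_def comp_assoc yy unfolding comp_assoc[symmetric] yy by (simp only: id_comp comp_id)
    ultimately show "x \<circ> g \<circ> x \<in> Cs" "y \<circ> g \<circ> y \<in> Cs" by blast+
  qed
  have "g \<in> Cs \<or> g \<circ> y \<in> Cs" if "g \<in> gen {x, y}" for g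
    using that
  proof (induction rule: gen.induct)
    case gen_id
    then show ?case by (simp only: Cs_def mem_Collect_eq id_comp comp_id simp_thms)
  next
    case (gen_step s g)
    have sx: "s = x \<or> s = y" using gen_step by blast
    have ysx: "s \<circ> y \<in> Cs"
    proof (cases "s = y")
      case True
      then show ?thesis using yy by (simp only: Cs_def mem_Collect_eq id_comp comp_id)
    qed (use sx c1 c_def in auto)
    from gen_step.IH show ?case
    proof
      assume g: "g \<in> Cs"
      have "(s \<circ> y) \<circ> (y \<circ> g \<circ> y) = s \<circ> (y \<circ> y) \<circ> g \<circ> y" by (simp only: comp_assoc)
      then have "s \<circ> g \<circ> y = (s \<circ> y) \<circ> (y \<circ> g \<circ> y)" unfolding yy by (simp only: comp_id)
      then show ?thesis using Cs_comp[OF ysx norm(2)[OF g]] by argo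
    next
      assume g: "g \<circ> y \<in> Cs"
      have "(s \<circ> y) \<circ> (y \<circ> (g \<circ> y) \<circ> y) = s \<circ> (y \<circ> y) \<circ> g \<circ> (y \<circ> y)" by (simp only: comp_assoc)
      then have "s \<circ> g = (s \<circ> y) \<circ> (y \<circ> (g \<circ> y) \<circ> y)" unfolding yy by (simp only: comp_id)
      then show ?thesis using Cs_comp[OF ysx norm(2)[OF g]] by argo
    qed
  qed
  then consider "u \<in> Cs" | "u \<circ> y \<in> Cs" using assms(5) unfolding y_def by blast
  then show ?thesis
  proof cases
    case 1
    then have "u \<circ> x = x \<circ> u" unfolding xy Cs_def mem_Collect_eq using uy by (metis comp_assoc)
    then show ?thesis ..
  next
    case 2
    have "u \<circ> y = v" unfolding y_def comp_assoc[symmetric] assms(2) by (simp only: id_comp)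
    then have "v \<circ> c = c \<circ> v" using 2 by (simp add: Cs_def)
    then have "v \<circ> x = x \<circ> v" unfolding xy using vy by (metis comp_assoc)
    then show ?thesis ..
  qed
qed

text \<open>Since \<open>u\<close> commutes with \<open>v \<circ> w\<close>, the power of
  \<open>(u \<circ> v) \<circ> w\<close> with exponent \<open>2 * l + 1\<close> is \<open>u\<close>
  to an odd power times the identity, that is \<open>u\<close>.\<close>

lemma mem_gen_of_odd_order:
  fixes u v w :: "'a \<Rightarrow> 'a"
  assumes "u \<circ> u = id" "u \<circ> v = v \<circ> u" "u \<circ> w = w \<circ> u" "(v \<circ> w) ^^ (2 * l + 1) = id"
  shows "u \<in> gen {u \<circ> v, w}"
proof -
  define d where "d = (u \<circ> v) \<circ> w"
  have uvw: "u \<circ> (v \<circ> w) = (v \<circ> w) \<circ> u" using assms by (metis comp_assoc)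
  have d: "d = u \<circ> (v \<circ> w)" by (simp only: d_def comp_assoc)
  have "d \<circ> d = u \<circ> ((v \<circ> w) \<circ> u) \<circ> (v \<circ> w)" unfolding d by (simp only: comp_assoc)
  also have "\<dots> = (u \<circ> u) \<circ> ((v \<circ> w) \<circ> (v \<circ> w))" unfolding uvw[symmetric] by (simp only: comp_assoc)
  finally have dd: "d \<circ> d = (v \<circ> w) \<circ> (v \<circ> w)" unfolding assms(1) by (simp only: id_comp)
  have sq: "f ^^ (2 * l) = (f \<circ> f) ^^ l" for f :: "'a \<Rightarrow> 'a"
    unfolding funpow_mult[symmetric] by (simp only: numeral_2_eq_2 funpow.simps comp_id)
  have "d ^^ (2 * l + 1) = d \<circ> d ^^ (2 * l)" by (simp only: Suc_eq_plus1[symmetric] funpow.simps)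
  also have "\<dots> = u \<circ> ((v \<circ> w) \<circ> (v \<circ> w) ^^ (2 * l))" unfolding sq dd unfolding d by (simp only: comp_assoc)
  finally have "d ^^ (2 * l + 1) = u \<circ> (v \<circ> w) ^^ (2 * l + 1)"
    by (simp only: Suc_eq_plus1[symmetric] funpow.simps)
  then have "d ^^ (2 * l + 1) = u" unfolding assms(4) by (simp only: comp_id)
  moreover have "d ^^ m \<in> gen {u \<circ> v, w}" for m
  proof (induction m)
    case 0
    show ?case unfolding funpow.simps by (rule gen_id)
  next
    case (Suc m)
    have "d \<in> gen {u \<circ> v, w}" unfolding d_def by (intro gen_comp gen_base) auto
    then show ?case using Suc gen_comp by (simp only: funpow.simps)
  qed
  ultimately show ?thesis by metis
qed

definition reduce :: "(nat \<Rightarrow> 'a \<Rightarrow> 'a) \<Rightarrow> nat \<Rightarrow> 'a \<Rightarrow> 'a" where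
  "reduce rho i = (if i = 0 then rho 1 else if i = 1 then rho 0 \<circ> rho 2 else rho (Suc i))"

text \<open>By \<open>mem\<close>, indices 1 and 2 of the new sequence together recover both
  \<open>rho 0\<close> and \<open>rho 2\<close>; for longer intervals the intersections are then
  inherited. The delicate pair is \<open>{0, 1}\<close> against \<open>{1, 2}\<close>, whose overlap
  \<open>{1}\<close> does not recover them; \<open>nc\<close> is needed there.\<close>

lemma alt_string_reduce:
  assumes "alt_string n (Suc r) rho" "3 \<le> r" and mem: "rho 0 \<in> gen {rho 0 \<circ> rho 2, rho 3}"
    and nc: "rho 0 \<circ> rho 1 \<noteq> rho 1 \<circ> rho 0" "rho 2 \<circ> rho 1 \<noteq> rho 1 \<circ> rho 2"
  shows "alt_string n r (reduce rho)"
proof -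
  interpret R: string_involutions "Suc r" rho using assms by (simp add: alt_string_def)
  have alt: "rho i \<in> Alt {1..n}" "rho i \<noteq> id" if "i < Suc r" for i
    using assms that by (auto simp: alt_string_def)
  have ip: "R.H A \<inter> R.H B \<subseteq> R.H (A \<inter> B)" if "A \<subseteq> {..<Suc r}" "B \<subseteq> {..<Suc r}" for A B
    using R.intersection_property that assms by (simp add: alt_string_def)
  let ?s = "reduce rho"
  have s: "?s 0 = rho 1" "?s (Suc 0) = rho 0 \<circ> rho 2" "?s 2 = rho 3" "\<And>i. 2 \<le> i \<Longrightarrow> ?s i = rho (Suc i)"
    by (auto simp: reduce_def numeral_3_eq_3)
  have c02: "rho 0 \<circ> rho 2 = rho 2 \<circ> rho 0" using R.far_commute[of 0 2] assms by simp
  have i2: "rho 0 \<circ> rho 0 = id" "rho 1 \<circ> rho 1 = id" "rho 2 \<circ> rho 2 = id"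
    using R.invol assms(2) by auto
  have "(rho 0 \<circ> rho 2) \<circ> (rho 0 \<circ> rho 2) = (rho 0 \<circ> rho 2) \<circ> (rho 2 \<circ> rho 0)" by (simp only: c02)
  also have "\<dots> = rho 0 \<circ> (rho 2 \<circ> rho 2) \<circ> rho 0" by (simp only: comp_assoc)
  finally have inv02: "(rho 0 \<circ> rho 2) \<circ> (rho 0 \<circ> rho 2) = id" unfolding i2 by (simp only: comp_id i2)
  have up_eq: "gen (?s ` A) = R.H (Suc ` A)" if "A \<subseteq> {2..}" for A
  proof -
    have "?s ` A = rho ` Suc ` A" unfolding image_image by (rule image_cong) (use s(4) that in auto)
    then show ?thesis by simp
  qed
  then have up: "gen (?s ` A) \<subseteq> R.H (Suc ` A)" if "A \<subseteq> {2..}" for A using that by blast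
  have u1: "gen (?s ` A) \<subseteq> R.H (insert 0 (Suc ` A))" if "A \<subseteq> {1..}" for A
  proof (rule gen_least, rule subsetI)
    fix t assume "t \<in> ?s ` A"
    then obtain i where i: "i \<in> A" "t = ?s i" by blast
    show "t \<in> R.H (insert 0 (Suc ` A))"
    proof (cases "i = 1")
      case True
      then have "t = rho 0 \<circ> rho 2" using i s by simp
      moreover have "rho 0 \<in> R.H (insert 0 (Suc ` A))" by (intro gen_base) auto
      moreover have "rho 2 \<in> R.H (insert 0 (Suc ` A))"
        using i True by (intro gen_base imageI) (auto simp: numeral_2_eq_2 image_iff)
      ultimately show ?thesis using gen_comp by blast
    next
      case False
      then have "i \<ge> 2" using i that by (auto dest!: subsetD)
      then show ?thesis using i s(4) by (auto intro!: gen_base)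
    qed
  qed
  have u0: "gen (?s ` A) \<subseteq> R.H (insert 0 (insert 1 (Suc ` A)))" for A
  proof (rule gen_least, rule subsetI)
    fix t assume "t \<in> ?s ` A"
    then obtain i where i: "i \<in> A" "t = ?s i" by blast
    have b: "rho j \<in> R.H (insert 0 (insert 1 (Suc ` A)))" if "j = 0 \<or> j = 1 \<or> j \<in> Suc ` A" for j
      using that by (intro gen_base imageI) blast
    consider "i = 0" | "i = 1" | "2 \<le> i" by linarith
    then show "t \<in> R.H (insert 0 (insert 1 (Suc ` A)))"
    proof cases
      case 1
      then show ?thesis using i(2) s(1) b[of 1] by simp
    next
      case 2
      then have "2 \<in> Suc ` A" using i(1) by (auto simp: image_iff)
      then have "rho 0 \<circ> rho 2 \<in> R.H (insert 0 (insert 1 (Suc ` A)))" using b by (intro gen_comp) blast+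
      then show ?thesis using i(2) s(2) 2 by simp
    next
      case 3
      then show ?thesis using i s(4) b[of "Suc i"] by simp
    qed
  qed
  have l1: "R.H (insert 0 (Suc ` A)) \<subseteq> gen (?s ` A)" if "1 \<in> A" "2 \<in> A" "A \<subseteq> {1..}" for A
  proof (rule gen_least, rule subsetI)
    have b: "rho 0 \<circ> rho 2 \<in> gen (?s ` A)" "rho 3 \<in> gen (?s ` A)"
      using that s(2,3) by (metis One_nat_def gen_base imageI)+
    then have 0: "rho 0 \<in> gen (?s ` A)" using mem gen_least[of "{rho 0 \<circ> rho 2, rho 3}" "?s ` A"] by blast
    have "rho 2 = rho 0 \<circ> (rho 0 \<circ> rho 2)" unfolding comp_assoc[symmetric] i2 by (simp only: id_comp)
    then have 2: "rho 2 \<in> gen (?s ` A)" using gen_comp[OF 0 b(1)] by simp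
    fix t assume "t \<in> rho ` insert 0 (Suc ` A)"
    then consider "t = rho 0" | i where "i \<in> A" "t = rho (Suc i)" by blast
    then show "t \<in> gen (?s ` A)"
    proof cases
      case (2 i)
      show ?thesis
      proof (cases "i = 1")
        case True
        then show ?thesis using 2 \<open>rho 2 \<in> gen (?s ` A)\<close> by (simp add: numeral_2_eq_2)
      next
        case False
        then have "i \<ge> 2" using 2 that by (auto dest!: subsetD)
        then have "t = ?s i" using 2 s(4) by simp
        then show ?thesis using 2 gen_base by blast
      qed
    qed (use 0 in simp)
  qed
  have l0: "R.H (insert 0 (insert 1 (Suc ` A))) \<subseteq> gen (?s ` A)" if "0 \<in> A" "1 \<in> A" "2 \<in> A" for A
  proof (rule gen_least, rule subsetI)
    fix t assume t: "t \<in> rho ` insert 0 (insert 1 (Suc ` A))"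
    show "t \<in> gen (?s ` A)"
    proof (cases "t = rho 1")
      case True
      then have "t = ?s 0" using s by simp
      then show ?thesis using that gen_base by blast
    next
      case False
      then have "t \<in> rho ` insert 0 (Suc ` (A - {0}))" using t by auto
      then have "t \<in> R.H (insert 0 (Suc ` (A - {0})))" by (rule gen_base)
      also have "\<dots> \<subseteq> gen (?s ` (A - {0}))" using that by (intro l1) auto
      also have "\<dots> \<subseteq> gen (?s ` A)" by (intro gen_mono) auto
      finally show ?thesis .
    qed
  qed
  have "string_involutions r ?s"
  proof
    show "?s i \<circ> ?s i = id" if "i < r" for i
      using that assms(2) inv02 R.invol[of 1] R.invol[of "Suc i"] by (cases "i = 0"; cases "i = 1") (auto simp only: reduce_def split: if_splits)
    show "?s i \<circ> ?s j = ?s j \<circ> ?s i" if "i + 2 \<le> j" "j < r" for i j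
    proof -
      have j: "?s j = rho (Suc j)" using that s by simp
      have 0: "rho k \<circ> rho (Suc j) = rho (Suc j) \<circ> rho k" if "k + 2 \<le> Suc j" for k
        using R.far_commute[OF that] \<open>j < r\<close> by simp
      show ?thesis
      proof (cases "i = 1")
        case True
        then show ?thesis unfolding j using s 0[of 0] 0[of 2] that
          by (simp add: comp_assoc) (metis comp_assoc)
      next
        case False
        then show ?thesis unfolding j using s(1) s(4)[of i] 0[of 1] 0[of "Suc i"] that by (cases "i = 0") auto
      qed
    qed
  qed
  moreover have "?s i \<in> Alt {1..n} \<and> ?s i \<noteq> id" if "i < r" for i
  proof -
    have "rho 0 \<circ> rho 2 \<noteq> id"
    proof
      assume "rho 0 \<circ> rho 2 = id"
      then have "rho 0 = rho 2" using i2 by (metis comp_assoc comp_id id_comp)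
      then have "R.H {0} \<inter> R.H {2} \<subseteq> {id}" "rho 0 \<in> R.H {0}" "rho 0 \<in> R.H {2}"
        using ip[of "{0}" "{2}"] assms(2) by (auto intro: gen_base)
      then show False using alt(2)[of 0] by auto
    qed
    moreover have "rho 0 \<circ> rho 2 \<in> Alt {1..n}" using alt(1)[of 0] alt(1)[of 2] assms(2) by (intro Alt_comp) auto
    moreover have "?s i = rho 1 \<or> ?s i = rho 0 \<circ> rho 2 \<or> ?s i = rho (Suc i)" by (simp only: reduce_def) metis
    ultimately show ?thesis using that alt[of 1] alt[of "Suc i"] assms(2) by (metis Suc_less_eq less_SucI less_le_trans numeral_3_eq_3 zero_less_Suc One_nat_def)
  qed
  moreover have "interval_ip r ?s"
    unfolding interval_ip_def
  proof (intro allI impI)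
    fix i j :: nat assume ij: "i < j" "j < r"
    consider "i \<ge> 2" | "i = 1" | "i = 0" "j = 1" | "i = 0" "j = 2" | "i = 0" "j \<ge> 3" using ij by linarith
    then show "gen (?s ` {i..<j}) \<inter> gen (?s ` {i<..j}) \<subseteq> gen (?s ` {i<..<j})"
    proof cases
      case 1
      have "R.H (Suc ` {i..<j}) \<inter> R.H (Suc ` {i<..j}) \<subseteq> R.H (Suc ` {i..<j} \<inter> Suc ` {i<..j})"
        using ij by (intro ip) auto
      also have "Suc ` {i..<j} \<inter> Suc ` {i<..j} = Suc ` {i<..<j}" by auto
      finally have *: "R.H (Suc ` {i..<j}) \<inter> R.H (Suc ` {i<..j}) \<subseteq> R.H (Suc ` {i<..<j})" .
      have "{i..<j} \<subseteq> {2..}" "{i<..j} \<subseteq> {2..}" "{i<..<j} \<subseteq> {2..}" using 1 by auto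
      note this[THEN up_eq]
      then show ?thesis using * by (simp only:)
    next
      case 2
      have "gen (?s ` {i..<j}) \<inter> gen (?s ` {i<..j}) \<subseteq> R.H (insert 0 (Suc ` {i..<j})) \<inter> R.H (Suc ` {i<..j})"
        using 2 by (intro Int_mono u1 up) auto
      also have "\<dots> \<subseteq> R.H (insert 0 (Suc ` {i..<j}) \<inter> Suc ` {i<..j})"
        using ij by (intro ip) auto
      also have "insert 0 (Suc ` {i..<j}) \<inter> Suc ` {i<..j} = Suc ` {i<..<j}" by auto
      also have "R.H \<dots> = gen (?s ` {i<..<j})" using 2 by (intro up_eq[symmetric]) auto
      finally show ?thesis .
    next
      case 3
      have "{i..<j} = {0}" "{i<..j} = {1}" "{i<..<j} = {}" using 3 by auto
      moreover have "gen (?s ` {0}) \<subseteq> R.H {1}" using s(1) by simp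
      moreover have "gen (?s ` {1}) \<subseteq> R.H (insert 0 (Suc ` {1}))" by (rule u1) simp
      moreover have "R.H {1} \<inter> R.H (insert 0 (Suc ` {1})) \<subseteq> R.H ({1} \<inter> insert 0 (Suc ` {1}))"
        using assms(2) by (intro ip) auto
      moreover have "{1} \<inter> insert 0 (Suc ` {1}) = {}" by auto
      ultimately show ?thesis by (simp only: image_empty) blast
    next
      case 4
      have e: "{i..<j} = {0,1}" "{i<..j} = {1,2}" "{i<..<j} = {1}" using 4 by auto
      have "gen (?s ` {0,1}) \<inter> gen (?s ` {1,2}) \<subseteq> gen (?s ` {1})"
      proof
        fix g assume g: "g \<in> gen (?s ` {0,1}) \<inter> gen (?s ` {1,2})"
        have "insert 0 (insert 1 (Suc ` {0,1})) = {0,1,2}" "insert 0 (Suc ` {1,2}) = {0,2,3}" by auto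
        moreover have "g \<in> R.H (insert 0 (insert 1 (Suc ` {0,1})))" using g u0 by blast
        moreover have "g \<in> R.H (insert 0 (Suc ` {1,2}))" using g u1[of "{1,2}"] by auto
        ultimately have "g \<in> R.H {0,1,2} \<inter> R.H {0,2,3}" by simp
        moreover have "R.H {0,1,2} \<inter> R.H {0,2,3} \<subseteq> R.H ({0,1,2} \<inter> {0,2,3})"
          using assms(2) by (intro ip) auto
        moreover have "rho ` ({0,1,2} \<inter> {0,2,3}) = {rho 0} \<union> {rho 2}" by auto
        ultimately have "g \<in> gen ({rho 0} \<union> {rho 2})" by auto
        then obtain x y where xy: "x \<in> gen {rho 0}" "y \<in> gen {rho 2}" "g = x \<circ> y"
          using gen_Un_commute[of "{rho 0}" "{rho 2}" g] c02 by blast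
        have D: "gen (?s ` {0,1}) = gen {rho 1, rho 0 \<circ> rho 2}" using s by simp
        have yD: "rho 0 \<circ> rho 2 \<in> gen {rho 1, rho 0 \<circ> rho 2}" by (intro gen_base) simp
        \<comment> \<open>Membership would force \<open>rho 0\<close> or \<open>rho 2\<close> to
          commute with \<open>rho 1\<close>, against \<open>nc\<close>. Of the four elements
          generated by \<open>rho 0\<close> and \<open>rho 2\<close>, only the identity and the
          product survive.\<close>
        have n0: "rho 0 \<notin> gen {rho 1, rho 0 \<circ> rho 2}"
          using dihedral_commute[of "rho 1" "rho 0" "rho 2"] i2 c02 nc assms(2) by auto
        have n2: "rho 2 \<notin> gen {rho 1, rho 0 \<circ> rho 2}"
        proof
          assume "rho 2 \<in> gen {rho 1, rho 0 \<circ> rho 2}"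
          from gen_comp[OF yD this] have "rho 0 \<in> gen {rho 1, rho 0 \<circ> rho 2}"
            unfolding comp_assoc i2 by (simp only: comp_id)
          then show False using n0 by simp
        qed
        have "x \<in> {id, rho 0}" "y \<in> {id, rho 2}"
          using xy(1,2) gen_singleton[of "rho 0"] gen_singleton[of "rho 2"] i2 by auto
        then consider "g = id" | "g = rho 0" | "g = rho 2" | "g = rho 0 \<circ> rho 2"
          unfolding xy(3) by (metis comp_id id_comp insertE singletonD)
        then show "g \<in> gen (?s ` {1})"
          using n0 n2 g D s gen_id gen_base by cases (auto simp only: image_insert image_empty One_nat_def intro: gen_id gen_base)
      qed
      then show ?thesis unfolding e .
    next
      case 5
      have "gen (?s ` {i..<j}) \<inter> gen (?s ` {i<..j}) \<subseteq>
          R.H (insert 0 (insert 1 (Suc ` {i..<j}))) \<inter> R.H (insert 0 (Suc ` {i<..j}))"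
        using 5 by (intro Int_mono u0 u1) auto
      also have "\<dots> \<subseteq> R.H (insert 0 (insert 1 (Suc ` {i..<j})) \<inter> insert 0 (Suc ` {i<..j}))"
        using ij by (intro ip) auto
      also have "insert 0 (insert 1 (Suc ` {i..<j})) \<inter> insert 0 (Suc ` {i<..j}) = insert 0 (Suc ` {i<..<j})"
        using 5 by auto
      also have "R.H \<dots> \<subseteq> gen (?s ` {i<..<j})" using 5 by (intro l1) auto
      finally show ?thesis .
    qed
  qed
  moreover have "Alt {1..n} \<subseteq> gen (?s ` {..<r})"
  proof -
    have "{..<Suc r} \<subseteq> insert 0 (insert 1 (Suc ` {..<r}))" by (auto simp: image_iff less_Suc_eq_0_disj)
    then have "gen (rho ` {..<Suc r}) \<subseteq> R.H (insert 0 (insert 1 (Suc ` {..<r})))" by (rule R.H_mono)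
    also have "\<dots> \<subseteq> gen (?s ` {..<r})" using assms(2) by (intro l0) auto
    finally show ?thesis using assms(1) by (auto simp: alt_string_def)
  qed
  ultimately show ?thesis unfolding alt_string_def by blast
qed

section \<open>Three-cycles\<close>

definition cyc3 :: "'a \<Rightarrow> 'a \<Rightarrow> 'a \<Rightarrow> 'a \<Rightarrow> 'a" where
  "cyc3 a b c = transpose a b \<circ> transpose b c"

lemma cyc3_apply:
  assumes "distinct [a, b, c]"
  shows "cyc3 a b c v = (if v = a then b else if v = b then c else if v = c then a else v)"
  using assms by (auto simp: cyc3_def transpose_def)

lemma cyc3_rotate: "distinct [a, b, c] \<Longrightarrow> cyc3 b c a = cyc3 a b c"
  by (rule ext) (auto simp: cyc3_apply)

lemma cyc3_square: "distinct [a, b, c] \<Longrightarrow> cyc3 a b c \<circ> cyc3 a b c = cyc3 a c b"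
  by (rule ext) (auto simp: cyc3_apply)

lemma cyc3_conj:
  assumes "bij g" "distinct [a, b, c]"
  shows "g \<circ> cyc3 a b c \<circ> inv' g = cyc3 (g a) (g b) (g c)"
proof (rule ext)
  fix v
  have inj: "g u = g w \<longleftrightarrow> u = w" for u w using assms(1) by (simp add: bij_is_inj inj_eq)
  obtain u where v: "v = g u" using assms(1) by (metis bij_pointE)
  have "inv' g v = u" unfolding v using assms(1) by (simp add: bij_is_inj)
  moreover have "distinct [g a, g b, g c]" using assms(2) inj by simp
  ultimately show "(g \<circ> cyc3 a b c \<circ> inv' g) v = cyc3 (g a) (g b) (g c) v"
    unfolding o_apply using assms(2) by (simp add: cyc3_apply v inj)
qed

text \<open>A class of points linked to \<open>a\<close> by three-cycles. It replaces a primitivity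
  argument: once this class is everything, the group contains the alternating group. The point
  \<open>a\<close> belongs to it by convention.\<close>

definition reach :: "('a \<Rightarrow> 'a) set \<Rightarrow> 'a \<Rightarrow> 'a set" where
  "reach G a = {b. b = a \<or> (\<exists>c. distinct [a, b, c] \<and> cyc3 a b c \<in> G)}"

context
  fixes S :: "('a \<Rightarrow> 'a) set"
  assumes S: "\<And>s. s \<in> S \<Longrightarrow> s \<circ> s = id"
begin

lemma cyc3_conj_mem:
  assumes "g \<in> gen S" "distinct [a, b, c]" "cyc3 a b c \<in> gen S"
  shows "cyc3 (g a) (g b) (g c) \<in> gen S"
proof -
  have "g \<circ> cyc3 a b c \<circ> inv' g \<in> gen S" using assms gen_inv[OF S] by (intro gen_comp) auto
  then show ?thesis using cyc3_conj[OF gen_bij[OF S assms(1)] assms(2)] by simp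
qed

lemma cyc3_reverse_mem: "distinct [a, b, c] \<Longrightarrow> cyc3 a b c \<in> gen S \<Longrightarrow> cyc3 a c b \<in> gen S"
  using cyc3_square gen_comp by metis

text \<open>Of the two given three-cycles through \<open>a\<close>, one through \<open>b\<close> and
  one through \<open>c\<close>, one is conjugated by the other until only \<open>a\<close>,
  \<open>b\<close>, \<open>c\<close> remain. The cases record which of the further points
  \<open>d\<close>, \<open>e\<close> coincide with others.\<close>

lemma cyc3_mem_of_reach:
  assumes "b \<in> reach (gen S) a" "c \<in> reach (gen S) a" "distinct [a, b, c]"
  shows "cyc3 a b c \<in> gen S"
proof -
  obtain d where d: "distinct [a, b, d]" "cyc3 a b d \<in> gen S" using assms by (auto simp: reach_def)
  obtain e where e: "distinct [a, c, e]" "cyc3 a c e \<in> gen S" using assms by (auto simp: reach_def)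
  consider "d = c" | "e = b" | "d = e" "d \<noteq> c" | "distinct [a, b, c, d, e]" using d e assms(3) by auto
  then show ?thesis
  proof cases
    case 2
    then show ?thesis using cyc3_reverse_mem e by simp
  next
    case 3
    have "cyc3 (cyc3 a b d a) (cyc3 a b d c) (cyc3 a b d e) \<in> gen S"
      by (rule cyc3_conj_mem) (use d e in auto)
    then have "cyc3 b c a \<in> gen S" using 3 d assms(3) by (auto simp: cyc3_apply split: if_splits)
    then show ?thesis using cyc3_rotate[OF assms(3)] by simp
  next
    case 4
    have "cyc3 (cyc3 a b d a) (cyc3 a b d c) (cyc3 a b d e) \<in> gen S"
      by (rule cyc3_conj_mem) (use d e in auto)
    then have "cyc3 b c e \<in> gen S" using 4 by (auto simp: cyc3_apply split: if_splits)
    then have *: "cyc3 b e c \<in> gen S" using 4 by - (rule cyc3_reverse_mem; auto)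
    have "cyc3 (cyc3 b e c a) (cyc3 b e c c) (cyc3 b e c e) \<in> gen S"
      by (rule cyc3_conj_mem) (use * e in auto)
    then show ?thesis using 4 by (auto simp: cyc3_apply split: if_splits)
  qed (use d in simp)
qed

lemma reach_subset:
  assumes "b \<in> reach (gen S) a" shows "reach (gen S) b \<subseteq> reach (gen S) a"
proof (cases "b = a")
  case False
  then obtain c where c: "distinct [a, b, c]" "cyc3 a b c \<in> gen S" using assms by (auto simp: reach_def)
  then have "cyc3 a c b \<in> gen S" by (rule cyc3_reverse_mem)
  moreover have "cyc3 a c b = cyc3 b a c" using c(1) by (intro cyc3_rotate) auto
  moreover have "distinct [b, a, c]" using c(1) by auto
  ultimately have ab: "a \<in> reach (gen S) b" unfolding reach_def by auto
  show ?thesis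
  proof
    fix y assume y: "y \<in> reach (gen S) b"
    show "y \<in> reach (gen S) a"
    proof (cases "y = a \<or> y = b")
      case False
      then have dist: "distinct [b, a, y]" using \<open>b \<noteq> a\<close> by auto
      then have "cyc3 b a y \<in> gen S" using ab y by (intro cyc3_mem_of_reach)
      then have "cyc3 a y b \<in> gen S" using cyc3_rotate[OF dist] by simp
      then show ?thesis using dist by (auto simp: reach_def)
    qed (use assms in \<open>auto simp: reach_def\<close>)
  qed
qed simp

text \<open>Conjugation by \<open>g\<close> carries the class of \<open>a\<close> into that of
  \<open>g a\<close>, which by \<open>reach_subset\<close> lies in the class of \<open>a\<close> as
  soon as \<open>g a\<close> does.\<close>

lemma reach_closed:
  assumes "g \<in> gen S" "g a \<in> reach (gen S) a" "y \<in> reach (gen S) a"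
  shows "g y \<in> reach (gen S) a"
proof (cases "y = a")
  case False
  then obtain c where c: "distinct [a, y, c]" "cyc3 a y c \<in> gen S" using assms by (auto simp: reach_def)
  have "cyc3 (g a) (g y) (g c) \<in> gen S" by (rule cyc3_conj_mem) (use assms c in auto)
  moreover have "distinct [g a, g y, g c]"
    using c(1) gen_bij[OF S assms(1)] by (auto simp: bij_def inj_eq)
  ultimately have "g y \<in> reach (gen S) (g a)" by (auto simp: reach_def)
  then show ?thesis using reach_subset[OF assms(2)] by blast
qed (use assms in blast)

end

text \<open>Points are removed one at a time: a three-cycle through \<open>a\<close> moves
  \<open>p y\<close> back to \<open>y\<close>, and the product is an even permutation of fewer
  points.\<close>

lemma Alt_subset_gen:
  assumes S: "\<And>s. s \<in> S \<Longrightarrow> s \<circ> s = id" and "finite C" "a \<in> C" "C \<subseteq> reach (gen S) a"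
  shows "Alt C \<subseteq> gen S"
proof -
  have main: "p \<in> gen S" if "finite F" "insert a F \<subseteq> reach (gen S) a" "a \<notin> F" "p permutes insert a F" "evenperm p" for F p
    using that
  proof (induction F arbitrary: p rule: finite_induct)
    case empty
    then have "p = id" by (simp only: permutes_sing)
    then show ?case by (simp only: gen_id)
  next
    case (insert y F)
    note dist = insert.hyps insert.prems
    have fin: "finite (insert a F)" using insert by simp
    have perm: "permutation p" using insert.prems insert.hyps by (meson finite.insertI permutation_permutes)
    have reduce: "p \<in> gen S" if c: "cyc3 u v w \<in> gen S" "distinct [u, v, w]" "{u, v, w} \<subseteq> insert a (insert y F)"
      "cyc3 u v w (p y) = y" for u v w
    proof -
      define q where "q = cyc3 u v w"
      have qp: "q permutes insert a (insert y F)" "evenperm q"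
      proof -
        show "q permutes insert a (insert y F)"
          unfolding q_def cyc3_def using c(3) by (intro permutes_compose permutes_swap_id) auto
        show "evenperm q" unfolding q_def cyc3_def using c(2)
          by (subst evenperm_comp) (auto simp: evenperm_swap permutation_swap_id)
      qed
      have "permutation q" using qp(1) fin by (meson finite.insertI permutation_permutes insert.hyps)
      have "(q \<circ> p) y = y" using c(4) by (simp add: q_def)
      moreover have "q \<circ> p permutes insert a (insert y F)"
        using qp(1) insert.prems(3) by (intro permutes_compose)
      ultimately have "q \<circ> p permutes insert a F"
        using permutes_superset[of "q \<circ> p" "insert a (insert y F)" "insert a F"] by auto
      moreover have "evenperm (q \<circ> p)"
        using evenperm_comp[OF \<open>permutation q\<close> perm] qp(2) insert.prems(4) by simp
      ultimately have qpG: "q \<circ> p \<in> gen S" using insert.IH insert.prems by auto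
      have qG: "q \<in> gen S" using c(1) q_def by simp
      have "p = inv' q \<circ> (q \<circ> p)" using gen_bij[OF S qG] by (simp add: comp_assoc[symmetric] bij_is_inj)
      then show ?thesis using gen_comp[OF gen_inv[OF S qG] qpG] by simp
    qed
    have reach_y: "y \<in> reach (gen S) a" "y \<noteq> a" using insert.prems by auto
    have pin: "p y \<in> insert a (insert y F)" using permutes_in_image[OF insert.prems(3), of y] by simp
    consider "p y = y" | "p y \<noteq> y" "p y \<noteq> a" | "p y = a" by blast
    then show ?case
    proof cases
      case 1
      then have "p permutes insert a F"
        using permutes_superset[OF insert.prems(3), of "insert a F"] by auto
      then show ?thesis using insert.IH insert.prems by auto
    next
      case 2
      then have d: "distinct [a, p y, y]" using reach_y by auto
      then have "cyc3 a (p y) y \<in> gen S"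
        using pin insert.prems(1) by (intro cyc3_mem_of_reach[OF S]) auto
      then show ?thesis using d pin by (intro reduce[of a "p y" y]) (auto simp: cyc3_apply)
    next
      case 3
      show ?thesis
      \<comment> \<open>A three-cycle sending \<open>a\<close> to \<open>y\<close> needs a third
        point. If none is left, \<open>p\<close> is the transposition of \<open>a\<close> and
        \<open>y\<close>, which is odd.\<close>
      proof (cases "F = {}")
        case True
        then have "p permutes {a, y}" using insert.prems by simp
        then have "p a = y" using 3 reach_y(2) by (metis insert_iff permutes_in_image permutes_inj injD singletonD)
        then have "p = transpose a y"
          using 3 \<open>p permutes {a, y}\<close> by (intro ext) (auto simp: transpose_def permutes_def)
        then show ?thesis using insert.prems(4) reach_y(2) evenperm_swap by metis
      next
        case False
        then obtain w where w: "w \<in> F" by blast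
        then have d: "distinct [a, y, w]" using insert.hyps insert.prems by auto
        then have "cyc3 a y w \<in> gen S"
          using w insert.prems(1) by (intro cyc3_mem_of_reach[OF S]) auto
        then show ?thesis using d w 3 by (intro reduce[of a y w]) (auto simp: cyc3_apply)
      qed
    qed
  qed
  show ?thesis
  proof
    fix p assume "p \<in> Alt C"
    then show "p \<in> gen S"
      using main[of "C - {a}" p] assms(2-4) by (auto simp: Alt_def insert_absorb)
  qed
qed

section \<open>Products of adjacent transpositions\<close>

primrec swaps :: "nat \<Rightarrow> nat \<Rightarrow> nat \<Rightarrow> nat" where
  "swaps a 0 = id"
| "swaps a (Suc t) = transpose (a + 2 * t) (a + 2 * t + 1) \<circ> swaps a t"

lemma swaps_apply:
  "swaps a t y = (if a \<le> y \<and> y < a + 2 * t then if even (y - a) then y + 1 else y - 1 else y)"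
proof (induction t)
  case (Suc t)
  have "y = a + 2 * t \<or> y = a + 2 * t + 1 \<or> y < a + 2 * t \<or> a + 2 * Suc t \<le> y" by presburger
  moreover have "y - 1 < a + 2 * t" "y - 1 \<ge> a" if "a \<le> y" "odd (y - a)" "y < a + 2 * t"
    using that by presburger+
  moreover have "y + 1 < a + 2 * t" if "a \<le> y" "even (y - a)" "y < a + 2 * t"
    using that by presburger+
  ultimately show ?case using Suc
    by (elim disjE) (auto simp: transpose_def)
qed auto

lemma swaps_invol: "swaps a t \<circ> swaps a t = id"
proof
  fix y
  have "y - 1 < a + 2 * t" "y - 1 \<ge> a" "even (y - 1 - a)" if "a \<le> y" "odd (y - a)" "y < a + 2 * t"
    using that by presburger+
  moreover have "y + 1 < a + 2 * t" if "a \<le> y" "even (y - a)" "y < a + 2 * t"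
    using that by presburger+
  moreover have "y - 1 + 1 = y" if "a \<le> y" "odd (y - a)" using that by presburger+
  ultimately show "(swaps a t \<circ> swaps a t) y = id y"
    by (auto simp: swaps_apply Suc_diff_le)
qed

lemma permutes_of_bij: "bij p \<Longrightarrow> (\<And>y. y \<notin> C \<Longrightarrow> p y = y) \<Longrightarrow> p permutes C"
  unfolding permutes_def bij_iff by blast

lemma swaps_permutes: "swaps a t permutes {a..<a + 2 * t}"
proof -
  have "bij (swaps a t)" using swaps_invol o_bij by blast
  then show ?thesis by (rule permutes_of_bij) (auto simp: swaps_apply)
qed

lemma evenperm_swaps: "evenperm (swaps a t) \<longleftrightarrow> even t"
proof (induction t)
  case (Suc t)
  have "permutation (swaps a t)" using swaps_permutes finite_atLeastLessThan permutation_permutes by blast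
  then have "evenperm (swaps a (Suc t)) \<longleftrightarrow> evenperm (transpose (a + 2 * t) (a + 2 * t + 1)) = evenperm (swaps a t)"
    unfolding swaps.simps by (intro evenperm_comp permutation_swap_id)
  then show ?case using Suc by (simp add: evenperm_swap del: swaps.simps)
qed simp

section \<open>Gluing a path\<close>

definition orbit_of :: "('a \<Rightarrow> 'a) set \<Rightarrow> 'a \<Rightarrow> 'a set" where
  "orbit_of G x = (\<lambda>g. g x) ` G"

text \<open>The condition \<open>star\<close> is what the intersection property of the glued group asks of the base:
  the group generated by the first \<open>j\<close> generators and \<open>glue 1\<close> contains the alternating group on the
  orbit of \<open>x\<close>.\<close>

locale glue_base = string_involutions k b
  for N k :: nat and b :: "nat \<Rightarrow> nat \<Rightarrow> nat" +
  fixes x :: nat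
  assumes b_Alt: "i < k \<Longrightarrow> b i \<in> Alt {1..N}"
    and b_ip: "interval_ip k b"
    and x_mem: "x \<in> {1..N}"
    and k_pos: "0 < k"
    and b0_x: "b 0 x \<noteq> x"
    and b_x: "1 \<le> i \<Longrightarrow> i < k \<Longrightarrow> b i x = x"
    and b_ne: "i < k \<Longrightarrow> b i \<noteq> id"
    and transitive: "{1..N} \<subseteq> orbit_of (gen (b ` {..<k})) x"
    and star: "1 \<le> j \<Longrightarrow> j < k \<Longrightarrow>
      gen (b ` {..<Suc j}) \<inter> Alt (orbit_of (gen (b ` {..<j})) x) \<subseteq> gen (b ` {..<j})"
begin

abbreviation H' :: "nat \<Rightarrow> (nat \<Rightarrow> nat) set" where "H' j \<equiv> gen (b ` {..<j})"

definition Orb :: "nat \<Rightarrow> nat set" where "Orb j = orbit_of (H' j) x"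

lemma b_permutes: "i < k \<Longrightarrow> b i permutes {1..N}"
  using b_Alt by (simp add: Alt_def)

lemma H'_permutes: "j \<le> k \<Longrightarrow> h \<in> H' j \<Longrightarrow> h permutes {1..N}"
  using gen_subset_Alt[of "{1..N}" "b ` {..<j}"] b_Alt by (force simp: Alt_def)

lemma H'_mono: "i \<le> j \<Longrightarrow> H' i \<subseteq> H' j"
  by (intro H_mono) auto

lemma H'_inv: "j \<le> k \<Longrightarrow> h \<in> H' j \<Longrightarrow> inv' h \<in> H' j"
  by (intro H_inv) auto

lemma x_Orb: "x \<in> Orb j"
  unfolding Orb_def orbit_of_def using image_eqI[OF _ gen_id, of x "\<lambda>g. g x"] by simp

lemma Orb_subset:
  assumes "j \<le> k" shows "Orb j \<subseteq> {1..N}"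
proof
  fix y assume "y \<in> Orb j"
  then obtain h where "h \<in> H' j" "y = h x" by (auto simp: Orb_def orbit_of_def)
  then show "y \<in> {1..N}" using permutes_in_image[OF H'_permutes[OF assms]] x_mem by blast
qed

lemma Orb_closed:
  assumes "h \<in> H' j" "y \<in> Orb j" shows "h y \<in> Orb j"
proof -
  obtain g where g: "g \<in> H' j" "y = g x" using assms(2) by (auto simp: Orb_def orbit_of_def)
  then have "h y = (h \<circ> g) x" by simp
  then show ?thesis unfolding Orb_def orbit_of_def using gen_comp[OF assms(1) g(1)] by blast
qed

lemma Orb_0: "Orb 0 = {x}"
  by (simp add: Orb_def orbit_of_def)

lemma Orb_k: "Orb k = {1..N}"
  using transitive Orb_subset[of k] by (auto simp: Orb_def)

text \<open>For \<open>j = 0\<close> the orbit is the single point \<open>x\<close>, so the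
  condition is automatic.\<close>

lemma star0: "j < k \<Longrightarrow> H' (Suc j) \<inter> Alt (Orb j) \<subseteq> H' j"
proof (cases j)
  case 0
  then show ?thesis unfolding 0 Orb_0 by (auto simp only: Alt_def permutes_sing mem_Collect_eq gen_id)
qed (use star in \<open>auto simp: Orb_def\<close>)

end

locale gluing = glue_base +
  fixes m :: nat
  assumes m: "4 dvd m" "0 < m"
begin

abbreviation p :: nat where "p \<equiv> N + 1"
definition P :: "nat set" where "P = {N + 1..N + m}"
text \<open>The part of \<open>beta\<close> inside the path. Together with the edge from
  \<open>x\<close> to \<open>p\<close> it makes \<open>m div 2\<close> transpositions, as many as in
  \<open>alpha\<close>; this number is even because 4 divides \<open>m\<close>.\<close>

definition zeta :: "nat \<Rightarrow> nat" where "zeta = swaps (N + 2) (m div 2 - 1)"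
definition alpha :: "nat \<Rightarrow> nat" where "alpha = swaps (N + 1) (m div 2)"
definition beta :: "nat \<Rightarrow> nat" where "beta = transpose x p \<circ> zeta"

definition glue :: "nat \<Rightarrow> nat \<Rightarrow> nat" where
  "glue i = (if i = 0 then alpha else if i = 1 then beta else b (i - 2))"

abbreviation A0 :: "nat \<Rightarrow> (nat \<Rightarrow> nat) set" where "A0 j \<equiv> gen (insert alpha (insert beta (b ` {..<j})))"
abbreviation A1 :: "nat \<Rightarrow> (nat \<Rightarrow> nat) set" where "A1 j \<equiv> gen (insert beta (b ` {..<j}))"

lemma m_div: "m = 2 * (m div 2)" "even (m div 2)" "4 \<le> m"
  using m by (auto elim!: dvdE)

lemma alpha_apply: "alpha y = (if y \<in> P then if even (y - (N + 1)) then y + 1 else y - 1 else y)"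
  unfolding alpha_def swaps_apply P_def using m_div by auto

lemma zeta_apply: "zeta y = (if N + 2 \<le> y \<and> y < N + m then if even (y - (N + 2)) then y + 1 else y - 1 else y)"
proof -
  have "N + 2 + 2 * (m div 2 - 1) = N + m" using m_div by auto
  then show ?thesis unfolding zeta_def swaps_apply by simp
qed

lemma zeta_invol: "zeta \<circ> zeta = id" "zeta (zeta y) = y"
  unfolding zeta_def using swaps_invol by (auto dest: pointfree_idE)

lemma zeta_permutes: "zeta permutes {N + 2..<N + m}"
proof -
  have "N + 2 + 2 * (m div 2 - 1) = N + m" using m_div by auto
  then show ?thesis unfolding zeta_def using swaps_permutes[of "N + 2" "m div 2 - 1"] by (simp only:)
qed

lemma x_p: "x \<noteq> p" "x \<notin> P" "zeta x = x" "zeta p = p"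
  using x_mem by (auto simp: P_def zeta_apply)

lemma zeta_outside:
  assumes "v \<notin> {1..N}" shows "zeta v \<notin> {1..N}" and "v \<noteq> p \<Longrightarrow> zeta v \<noteq> p"
proof -
  have "zeta u = u" if "u \<in> {1..N}" for u using that by (simp add: zeta_apply)
  then show "zeta v \<notin> {1..N}" using zeta_invol(2)[of v] assms by metis
  show "zeta v \<noteq> p" if "v \<noteq> p" using that zeta_invol(2)[of v] x_p(4) by metis
qed

lemma beta_apply: "beta y = (if y = x then p else if y = p then x else zeta y)"
proof -
  have "zeta y \<noteq> x \<and> zeta y \<noteq> p" if "y \<noteq> x" "y \<noteq> p" using that x_p zeta_invol(2) by metis
  then show ?thesis unfolding beta_def using x_p by (auto simp: transpose_def)
qed

lemma alpha_Alt: "alpha \<in> Alt P"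
proof -
  have "alpha permutes P" unfolding alpha_def P_def
    using swaps_permutes[of "N + 1" "m div 2"] m_div(1) by (simp add: atLeastLessThanSuc_atLeastAtMost)
  then show ?thesis using m_div(2) by (simp add: Alt_def alpha_def evenperm_swaps)
qed

lemma beta_Alt: "beta \<in> Alt (insert x P)"
proof -
  have z: "zeta permutes insert x P" by (rule permutes_subset[OF zeta_permutes]) (auto simp: P_def)
  have "beta permutes insert x P" unfolding beta_def
    by (intro permutes_compose z permutes_swap_id) (use m_div in \<open>auto simp: P_def\<close>)
  moreover have "odd (m div 2 - 1)" using m_div by auto
  then have "\<not> evenperm zeta" by (simp add: zeta_def evenperm_swaps)
  then have "evenperm beta" unfolding beta_def
    using evenperm_comp[OF permutation_swap_id, of zeta x p] z x_p(1) evenperm_swap[of x p]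
    by (metis P_def finite_atLeastAtMost finite_insert permutation_permutes)
  ultimately show ?thesis by (simp add: Alt_def)
qed

lemma alpha_invol: "alpha \<circ> alpha = id"
  unfolding alpha_def by (rule swaps_invol)

lemma beta_invol: "beta \<circ> beta = id"
proof
  fix y
  have "zeta y \<noteq> x \<and> zeta y \<noteq> p" if "y \<noteq> x" "y \<noteq> p" using that x_p zeta_invol(2) by metis
  then show "(beta \<circ> beta) y = id y" unfolding o_apply beta_apply id_apply using zeta_invol(2) x_p by auto
qed

lemma b_fix: "i < k \<Longrightarrow> y \<notin> {1..N} \<Longrightarrow> b i y = y"
  using b_permutes by (simp add: permutes_def)

lemma gens_invol: "j \<le> k \<Longrightarrow> s \<in> insert alpha (insert beta (b ` {..<j})) \<Longrightarrow> s \<circ> s = id"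
  using alpha_invol beta_invol invol by auto

lemma H'_fix: "j \<le> k \<Longrightarrow> h \<in> H' j \<Longrightarrow> y \<notin> {1..N} \<Longrightarrow> h y = y"
  using H'_permutes by (simp add: permutes_def)

section \<open>Factorisations of the groups \<open>A0 j\<close> and \<open>A1 j\<close>\<close>

definition C :: "nat \<Rightarrow> nat set" where "C j = P \<union> Orb j"
text \<open>Away from \<open>p\<close> the path is touched only by \<open>zeta\<close>, and
  \<open>e\<close> records whether it acts. The remaining freedom is an even or odd permutation of
  \<open>p\<close> and the orbit, the parity being fixed by \<open>e\<close>.\<close>

definition U :: "nat \<Rightarrow> (nat \<Rightarrow> nat) set" where
  "U j = {a \<in> Alt (C j). \<exists>e. \<forall>y\<in>P - {p}. a y = (if e then zeta y else y)}"

lemma C_finite: "j \<le> k \<Longrightarrow> finite (C j)"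
  using Orb_subset finite_subset by (fastforce simp: C_def P_def)

lemma alpha_C: "alpha \<in> Alt (C j)"
  using Alt_mono[of P "C j"] alpha_Alt by (auto simp: C_def)

lemma beta_C: "beta \<in> Alt (C j)"
  using Alt_mono[of "insert x P" "C j"] beta_Alt x_Orb by (auto simp: C_def)

lemma Alt_conj:
  assumes "finite D" "a \<in> Alt D" "s \<circ> s = id" "permutation s" "\<And>y. y \<in> D \<Longrightarrow> s y \<in> D"
  shows "s \<circ> a \<circ> s \<in> Alt D"
proof -
  have s2: "s (s y) = y" for y using assms(3) pointfree_idE by metis
  have "a permutes D" "evenperm a" using assms(2) by (auto simp: Alt_def)
  then have pa: "permutation a" using assms(1) permutation_permutes by blast
  have "bij (s \<circ> a \<circ> s)" using pa assms(4) by (intro bij_comp permutation_bijective)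
  moreover have "(s \<circ> a \<circ> s) y = y" if "y \<notin> D" for y
    using that assms(5) s2 \<open>a permutes D\<close> unfolding o_apply permutes_def by metis
  ultimately have "s \<circ> a \<circ> s permutes D" by (rule permutes_of_bij)
  moreover have "evenperm (s \<circ> a \<circ> s)"
    using \<open>evenperm a\<close> evenperm_comp[OF permutation_compose[OF assms(4) pa] assms(4)] evenperm_comp[OF assms(4) pa] by simp
  ultimately show ?thesis by (simp only: Alt_def mem_Collect_eq)
qed

lemma b_conj_C:
  assumes "i < j" "j \<le> k" "a \<in> Alt (C j)" shows "b i \<circ> a \<circ> b i \<in> Alt (C j)"
proof (rule Alt_conj[OF C_finite assms(3)])
  have "b i \<in> H' j" using assms(1) by (intro gen_base) auto
  then show "b i y \<in> C j" if "y \<in> C j" for y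
    using that Orb_closed b_fix[of i y] assms by (auto simp: C_def P_def)
  show "permutation (b i)" using b_permutes[of i] assms permutation_permutes by (metis finite_atLeastAtMost less_le_trans)
qed (use assms invol in auto)

text \<open>Conjugation by an old generator preserves \<open>Alt (C j)\<close>, so in every word the
  old generators can be collected on the right.\<close>

lemma A0_factor:
  assumes "j \<le> k" "g \<in> A0 j"
  obtains a h where "a \<in> Alt (C j)" "h \<in> H' j" "g = a \<circ> h"
proof -
  have "\<exists>a\<in>Alt (C j). \<exists>h\<in>H' j. g = a \<circ> h"
    using assms(2)
  proof (induction rule: gen.induct)
    case gen_id
    have "id \<in> Alt (C j)" by (simp only: Alt_def mem_Collect_eq permutes_id evenperm_id)
    then show ?case using gen.gen_id[of "b ` {..<j}"] by (metis comp_id)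
  next
    case (gen_step s g)
    then obtain a h where ah: "a \<in> Alt (C j)" "h \<in> H' j" "g = a \<circ> h" by blast
    show ?case
    proof (cases "s \<in> {alpha, beta}")
      case True
      then have "s \<circ> a \<in> Alt (C j)" using ah(1) alpha_C beta_C Alt_comp[OF C_finite[OF assms(1)]] by blast
      then show ?thesis using ah by (metis comp_assoc)
    next
      case False
      then obtain i where i: "i < j" "s = b i" using gen_step by auto
      have "s \<circ> g = (s \<circ> a \<circ> s) \<circ> (s \<circ> h)"
      proof -
        have "s \<circ> s = id" using i assms(1) invol by auto
        moreover have "(s \<circ> a \<circ> s) \<circ> (s \<circ> h) = s \<circ> a \<circ> (s \<circ> s) \<circ> h" by (simp only: comp_assoc)
        ultimately show ?thesis unfolding ah(3) by (simp only: comp_id comp_assoc)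
      qed
      moreover have "s \<circ> h \<in> H' j" using ah(2) i by (intro gen.gen_step) auto
      ultimately show ?thesis using b_conj_C[OF i(1) assms(1) ah(1)] i(2) by blast
    qed
  qed
  then show ?thesis using that by blast
qed

lemma U_comp_beta: "j \<le> k \<Longrightarrow> a \<in> U j \<Longrightarrow> beta \<circ> a \<in> U j"
proof -
  assume j: "j \<le> k" and "a \<in> U j"
  then obtain e where a: "a \<in> Alt (C j)" "\<And>y. y \<in> P - {p} \<Longrightarrow> a y = (if e then zeta y else y)"
    by (auto simp: U_def)
  have "(beta \<circ> a) y = (if \<not> e then zeta y else y)" if "y \<in> P - {p}" for y
  proof -
    have "y \<noteq> x" "y \<noteq> p" using that x_p by auto
    moreover have "zeta y \<noteq> x" "zeta y \<noteq> p" using calculation x_p zeta_invol(2) by metis+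
    ultimately show ?thesis unfolding o_apply a(2)[OF that] by (simp add: beta_apply zeta_invol(2))
  qed
  moreover have "beta \<circ> a \<in> Alt (C j)" using Alt_comp[OF C_finite[OF j] beta_C a(1)] .
  ultimately show ?thesis unfolding U_def by blast
qed

lemma A1_factor:
  assumes "j \<le> k" "g \<in> A1 j"
  obtains a h where "a \<in> U j" "h \<in> H' j" "g = a \<circ> h"
proof -
  have "\<exists>a\<in>U j. \<exists>h\<in>H' j. g = a \<circ> h"
    using assms(2)
  proof (induction rule: gen.induct)
    case gen_id
    have "id \<in> Alt (C j)" by (simp only: Alt_def mem_Collect_eq permutes_id evenperm_id)
    then have "id \<in> U j" unfolding U_def by (auto intro!: exI[of _ False])
    then show ?case using gen.gen_id[of "b ` {..<j}"] by (metis comp_id)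
  next
    case (gen_step s g)
    then obtain a h where ah: "a \<in> U j" "h \<in> H' j" "g = a \<circ> h" by blast
    show ?case
    proof (cases "s = beta")
      case True
      then show ?thesis using ah U_comp_beta[OF assms(1)] by (metis comp_assoc)
    next
      case False
      then obtain i where i: "i < j" "s = b i" using gen_step by auto
      obtain e where e: "a \<in> Alt (C j)" "\<And>y. y \<in> P - {p} \<Longrightarrow> a y = (if e then zeta y else y)"
        using ah(1) by (auto simp: U_def)
      have zP: "zeta y \<in> P" if "y \<in> P" for y
        using that permutes_in_image[OF zeta_permutes, of y] by (auto simp: P_def zeta_apply)
      have bP: "b i y = y" if "y \<in> P" for y using that b_fix[of i y] i assms(1) by (auto simp: P_def)
      have "(s \<circ> a \<circ> s) y = (if e then zeta y else y)" if "y \<in> P - {p}" for y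
        unfolding o_apply i(2) using that e(2)[OF that] bP zP by auto
      then have "s \<circ> a \<circ> s \<in> U j" using b_conj_C[OF i(1) assms(1) e(1)] i(2) unfolding U_def by blast
      moreover have "s \<circ> g = (s \<circ> a \<circ> s) \<circ> (s \<circ> h)"
      proof -
        have "s \<circ> s = id" using i assms(1) invol by auto
        moreover have "(s \<circ> a \<circ> s) \<circ> (s \<circ> h) = s \<circ> a \<circ> (s \<circ> s) \<circ> h" by (simp only: comp_assoc)
        ultimately show ?thesis unfolding ah(3) by (simp only: comp_id comp_assoc)
      qed
      moreover have "s \<circ> h \<in> H' j" using ah(2) i by (intro gen.gen_step) auto
      ultimately show ?thesis by blast
    qed
  qed
  then show ?thesis using that by blast
qed

text \<open>\<open>beta\<close> and \<open>b 0\<close> have only the point \<open>x\<close> of their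
  supports in common. Their product is therefore a three-cycle on \<open>p\<close>,
  \<open>x\<close>, \<open>b 0 x\<close> times disjoint involutions, and squaring removes the
  latter.\<close>

lemma cyc3_mem_A1:
  assumes "1 \<le> j" "j \<le> k"
  shows "cyc3 p (b 0 x) x \<in> A1 j"
proof -
  define y where "y = b 0 x"
  have "y \<in> {1..N}" unfolding y_def using permutes_in_image[OF b_permutes[OF k_pos]] x_mem by blast
  moreover have "b 0 y = x" unfolding y_def using invol[OF k_pos] by (rule pointfree_idE)
  ultimately have y: "y \<in> {1..N}" "y \<noteq> x" "y \<noteq> p" "b 0 y = x" using b0_x y_def by auto
  define g where "g = beta \<circ> b 0"
  have "g \<in> A1 j" unfolding g_def using assms by (intro gen_comp gen_base) auto
  then have gg: "g \<circ> g \<in> A1 j" by (rule gen_comp[OF _ \<open>g \<in> A1 j\<close>])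
  have d: "distinct [x, p, y]" using y x_p by auto
  have vals: "b 0 x = y" "b 0 y = x" "b 0 p = p" "beta x = p" "beta p = x" "beta y = y"
    using y b_fix[OF k_pos, of p] x_p by (auto simp: y_def beta_apply zeta_apply)
  have "g \<circ> g = cyc3 x p y"
  proof
    fix v
    have bb: "b 0 (b 0 v) = v" using invol[OF k_pos] by (rule pointfree_idE)
    consider "v = x" | "v = y" | "v = p" | "v \<in> {1..N}" "v \<noteq> x" "v \<noteq> y" | "v \<notin> {1..N}" "v \<noteq> p" by blast
    then show "(g \<circ> g) v = cyc3 x p y v"
    proof cases
      case 1
      then show ?thesis using d vals by (simp add: g_def cyc3_apply)
    next
      case 2
      then show ?thesis using d vals by (simp add: g_def cyc3_apply)
    next
      case 3
      then show ?thesis using d vals by (simp add: g_def cyc3_apply)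
    next
      case 4
      have "b 0 v \<in> {1..N}" using permutes_in_image[OF b_permutes[OF k_pos]] 4(1) by blast
      moreover have "b 0 v \<noteq> x" using bb vals(1) 4(3) by metis
      moreover have "b 0 v \<noteq> y" using bb vals(2) 4(2) by metis
      ultimately have "beta (b 0 v) = b 0 v" "beta v = v"
        using 4 by (auto simp: beta_apply zeta_apply)
      moreover have "v \<noteq> p" using 4(1) by auto
      ultimately show ?thesis using d 4 bb by (simp add: g_def cyc3_apply)
    next
      case 5
      then have "zeta v \<notin> {1..N}" "zeta v \<noteq> p" "zeta v \<noteq> x" "v \<noteq> x"
        using x_mem zeta_outside[of v] by auto
      then have "b 0 v = v" "b 0 (zeta v) = zeta v" "beta v = zeta v" "beta (zeta v) = v" "v \<noteq> y"
        using 5 y(1) b_fix[OF k_pos, of v] b_fix[OF k_pos, of "zeta v"] by (auto simp: beta_apply zeta_invol(2))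
      then show ?thesis using 5(2) \<open>v \<noteq> x\<close> d by (simp add: g_def cyc3_apply)
    qed
  qed
  moreover have "cyc3 p y x = cyc3 x p y" using d by (rule cyc3_rotate)
  ultimately show ?thesis using gg by (simp only: y_def)
qed

lemma A1_invol: "j \<le> k \<Longrightarrow> s \<in> insert beta (b ` {..<j}) \<Longrightarrow> s \<circ> s = id"
  using gens_invol by blast

text \<open>The old elements fix \<open>p\<close> and carry \<open>x\<close> over its whole orbit,
  so the class of \<open>p\<close> under three-cycles contains that orbit. For \<open>j = 0\<close>
  there are just two points and no nontrivial even permutation.\<close>

lemma Alt_subset_A1:
  assumes "j \<le> k" shows "Alt (insert p (Orb j)) \<subseteq> A1 j"
proof (cases "j = 0")
  case True
  show ?thesis
  proof
    fix a assume "a \<in> Alt (insert p (Orb j))"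
    then have a: "a permutes {p, x}" "evenperm a" by (auto simp: Alt_def True Orb_0)
    have "a = id"
    proof (cases "a p = p")
      case True
      then have "a permutes {x}" using permutes_superset[OF a(1), of "{x}"] by auto
      then show ?thesis by (simp only: permutes_sing)
    next
      case False
      then have "a p = x" using a(1) by (metis insertE insertI1 permutes_in_image singletonD)
      moreover then have "a x = p" using a(1) x_p(1) by (metis insert_iff permutes_in_image permutes_inj injD singletonD)
      ultimately have "a = transpose p x"
        using a(1) by (intro ext) (auto simp: transpose_def permutes_def)
      then show ?thesis using a(2) x_p(1) evenperm_swap by metis
    qed
    then show "a \<in> A1 j" by (simp only: gen_id)
  qed
next
  case False
  let ?G = "A1 j"
  define y where "y = b 0 x"
  have c: "cyc3 p y x \<in> ?G" unfolding y_def using False assms by (intro cyc3_mem_A1) auto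
  have y: "y \<in> {1..N}" "y \<noteq> x"
    using permutes_in_image[OF b_permutes[OF k_pos]] x_mem b0_x unfolding y_def by auto
  have d: "distinct [p, y, x]" "distinct [p, x, y]" using y x_p by auto
  have "cyc3 p x y \<in> ?G" by (rule cyc3_reverse_mem[OF A1_invol[OF assms] d(1) c])
  then have x: "x \<in> reach ?G p" using d(2) by (auto simp: reach_def)
  have "h x \<in> reach ?G p" if "h \<in> H' j" for h
  proof (rule reach_closed[OF A1_invol[OF assms] _ _ x])
    show "h \<in> ?G" using that gen_mono[of "b ` {..<j}" "insert beta (b ` {..<j})"] by blast
    show "h p \<in> reach ?G p" using H'_fix[OF assms that, of p] by (simp add: reach_def)
  qed
  then have "insert p (Orb j) \<subseteq> reach ?G p" by (auto simp: Orb_def orbit_of_def reach_def)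
  then show ?thesis
    using Orb_subset[OF assms] finite_subset by (intro Alt_subset_gen[OF A1_invol[OF assms]]) auto
qed

text \<open>One factor \<open>beta\<close> undoes \<open>zeta\<close> on \<open>P - {p}\<close>, and
  what is left is covered by \<open>Alt_subset_A1\<close>.\<close>

lemma U_subset_A1:
  assumes "j \<le> k" shows "U j \<subseteq> A1 j"
proof
  fix a assume a: "a \<in> U j"
  have *: "c \<in> A1 j" if "c \<in> Alt (C j)" "\<forall>y\<in>P - {p}. c y = y" for c
  proof -
    have "c permutes insert p (Orb j)"
      using that permutes_superset[of c "C j" "insert p (Orb j)"] by (auto simp: Alt_def C_def)
    then show ?thesis using that(1) Alt_subset_A1[OF assms] by (auto simp: Alt_def)
  qed
  from a obtain e where e: "a \<in> Alt (C j)" "\<And>y. y \<in> P - {p} \<Longrightarrow> a y = (if e then zeta y else y)"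
    by (auto simp: U_def)
  show "a \<in> A1 j"
  proof (cases e)
    case False
    then show ?thesis using * e by auto
  next
    case True
    have "(beta \<circ> a) y = y" if "y \<in> P - {p}" for y
    proof -
      have "y \<noteq> x" "y \<noteq> p" using that x_p by auto
      moreover have "zeta y \<noteq> x" "zeta y \<noteq> p" using calculation x_p zeta_invol(2) by metis+
      ultimately show ?thesis unfolding o_apply e(2)[OF that] using True by (simp add: beta_apply zeta_invol(2))
    qed
    then have "beta \<circ> a \<in> A1 j" using * Alt_comp[OF C_finite[OF assms] beta_C e(1)] by blast
    then have "beta \<circ> (beta \<circ> a) \<in> A1 j" by (rule gen_step[rotated]) simp
    moreover have "beta \<circ> (beta \<circ> a) = a" unfolding comp_assoc[symmetric] beta_invol by (rule id_comp)
    ultimately show ?thesis by simp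
  qed
qed

text \<open>The class of \<open>x\<close> contains \<open>p = beta x\<close>, and
  \<open>alpha\<close> fixes \<open>x\<close>. Hence both path generators preserve the class, and
  alternating between them walks to the end of the path. With \<open>j = 0\<close> the group would
  be the dihedral \<open>gen {alpha, beta}\<close>, without the three-cycle from
  \<open>b 0\<close>.\<close>

lemma Alt_subset_A0:
  assumes "1 \<le> j" "j \<le> k" shows "Alt (C j) \<subseteq> A0 j"
proof -
  let ?G = "A0 j"
  note S = gens_invol[OF assms(2)]
  have sub: "A1 j \<subseteq> ?G" by (intro gen_mono) auto
  define y where "y = b 0 x"
  have y: "y \<in> {1..N}" "y \<noteq> x"
    using permutes_in_image[OF b_permutes[OF k_pos]] x_mem b0_x unfolding y_def by auto
  have "cyc3 p y x \<in> ?G" unfolding y_def using cyc3_mem_A1[OF assms] sub by blast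
  moreover have "cyc3 y x p = cyc3 p y x" "cyc3 x p y = cyc3 p y x"
    using cyc3_rotate[of p y x] cyc3_rotate[of x p y] y x_p by auto
  ultimately have c: "cyc3 x p y \<in> ?G" by simp
  have d: "distinct [x, p, y]" "distinct [x, y, p]" using y x_p by auto
  have px: "p \<in> reach ?G x" using c d by (auto simp: reach_def)
  have xx: "x \<in> reach ?G x" by (simp add: reach_def)
  have gx: "s v \<in> reach ?G x" if "s \<in> ?G" "s x = x" "v \<in> reach ?G x" for s v
    by (rule reach_closed[OF S that(1) _ that(3)]) (simp_all only: that(2) xx)
  have a: "alpha \<in> ?G" "beta \<in> ?G" "alpha x = x" using x_p by (auto intro: gen_base simp: alpha_apply)
  have bx: "beta v \<in> reach ?G x" if "v \<in> reach ?G x" for v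
  proof (rule reach_closed[OF S a(2) _ that])
    show "beta x \<in> reach ?G x" using px by (simp add: beta_apply)
  qed
  have P: "N + t \<in> reach ?G x" if "1 \<le> t" "t \<le> m" for t
    using that
  proof (induction t rule: nat_induct_at_least)
    case base
    then show ?case using px by simp
  next
    case (Suc t)
    then have t: "N + t \<in> reach ?G x" "t < m" by auto
    show ?case
    proof (cases "odd t")
      case True
      then have "alpha (N + t) = N + Suc t" using Suc by (auto simp: alpha_apply P_def)
      then show ?thesis using gx[OF a(1,3) t(1)] by simp
    next
      case False
      then have "beta (N + t) = N + Suc t" using Suc t x_mem by (auto simp: beta_apply zeta_apply)
      then show ?thesis using bx[OF t(1)] by simp
    qed
  qed
  have "z \<in> reach ?G x" if "z \<in> Orb j" for z
  proof (cases "z = x \<or> z = y")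
    case True
    have "cyc3 x y p \<in> ?G" using cyc3_reverse_mem[OF S d(1) c] .
    then show ?thesis using True d(2) by (auto simp: reach_def)
  next
    case False
    have zp: "z \<noteq> p" using that Orb_subset[OF assms(2)] by auto
    have "evenperm (cyc3 x z p)" "cyc3 x z p permutes insert p (Orb j)"
      using False zp x_p that x_Orb unfolding cyc3_def
      by (auto intro!: permutes_compose permutes_swap_id simp: evenperm_comp permutation_swap_id evenperm_swap simp del: o_apply)
    then have "cyc3 x z p \<in> ?G" using Alt_subset_A1[OF assms(2)] sub by (auto simp: Alt_def)
    then show ?thesis using False zp x_p by (auto simp: reach_def)
  qed
  moreover have "z \<in> reach ?G x" if "z \<in> P" for z
    using P[of "z - N"] that by (auto simp: P_def)
  ultimately have "C j \<subseteq> reach ?G x" by (auto simp: C_def)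
  then show ?thesis
    using C_finite[OF assms(2)] x_Orb by (intro Alt_subset_gen[OF S]) (auto simp: C_def)
qed

text \<open>This is where the condition on the base enters: the factor \<open>a\<close> fixes the
  path, so it is an even permutation of the orbit of \<open>x\<close> lying in
  \<open>H' (Suc j)\<close>.\<close>

lemma A1_inter_H': 
  assumes "j < k" shows "A1 j \<inter> H' (Suc j) \<subseteq> H' j"
proof
  fix g assume g: "g \<in> A1 j \<inter> H' (Suc j)"
  then obtain a h where ah: "a \<in> U j" "h \<in> H' j" "g = a \<circ> h" using A1_factor[of j g] assms by auto
  have "bij h" using ah(2) H'_permutes[of j h] assms permutes_bij by auto
  then have "a = g \<circ> inv' h" unfolding ah(3) by (simp add: comp_assoc bij_is_surj surj_iff[THEN iffD1])
  moreover have "h \<in> H' (Suc j)" using ah(2) H'_mono[of j "Suc j"] by auto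
  ultimately have aH: "a \<in> H' (Suc j)" using g H'_inv[of "Suc j"] assms gen_comp by auto
  have "a y = y" if "y \<in> P" for y using that H'_fix[OF _ aH, of y] assms by (auto simp: P_def)
  then have "a permutes Orb j"
    using ah(1) permutes_superset[of a "C j" "Orb j"] by (auto simp: U_def Alt_def C_def)
  then have "a \<in> Alt (Orb j)" using ah(1) by (auto simp: U_def Alt_def)
  then have "a \<in> H' j" using star0[OF assms] aH by blast
  then show "g \<in> H' j" unfolding ah(3) using ah(2) by (rule gen_comp)
qed

text \<open>Old elements are trivial on the path, so \<open>a\<close> acts there as the factor
  \<open>u\<close> from the second group does: by \<open>zeta\<close> or trivially off
  \<open>p\<close>. That puts \<open>a\<close> into \<open>U j\<close>.\<close>

lemma A0_inter_A1:
  assumes "j < k" shows "A0 j \<inter> A1 (Suc j) \<subseteq> A1 j"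
proof
  fix g assume g: "g \<in> A0 j \<inter> A1 (Suc j)"
  then obtain a h where ah: "a \<in> Alt (C j)" "h \<in> H' j" "g = a \<circ> h" using A0_factor[of j g] assms by auto
  obtain u h2 where u: "u \<in> U (Suc j)" "h2 \<in> H' (Suc j)" "g = u \<circ> h2" using A1_factor[of "Suc j" g] assms g by auto
  obtain e where e: "\<And>y. y \<in> P - {p} \<Longrightarrow> u y = (if e then zeta y else y)" using u(1) by (auto simp: U_def)
  have "a y = (if e then zeta y else y)" if "y \<in> P - {p}" for y
  proof -
    have "h y = y" "h2 y = y" using that H'_fix[OF _ ah(2), of y] H'_fix[OF _ u(2), of y] assms by (auto simp: P_def)
    then have "a y = g y" "g y = u y" using ah(3) u(3) by (metis o_apply)+
    then show ?thesis using e[OF that] by simp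
  qed
  then have "a \<in> U j" using ah(1) unfolding U_def by blast
  then have "a \<in> A1 j" using U_subset_A1[of j] assms by auto
  moreover have "h \<in> A1 j" using ah(2) gen_mono[of "b ` {..<j}" "insert beta (b ` {..<j})"] by blast
  ultimately show "g \<in> A1 j" unfolding ah(3) by (rule gen_comp)
qed

section \<open>The glued generators as a string C-group\<close>

lemma glue_simps: "glue 0 = alpha" "glue (Suc 0) = beta" "glue (Suc (Suc i)) = b i"
  by (auto simp: glue_def)

lemma glue_image_ge2: "glue ` {Suc (Suc i)..<Suc (Suc j)} = b ` {i..<j}"
proof -
  have "{Suc (Suc i)..<Suc (Suc j)} = (\<lambda>l. Suc (Suc l)) ` {i..<j}" by (simp flip: image_Suc_atLeastLessThan add: image_image)
  then show ?thesis by (simp add: image_image glue_simps)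
qed

lemma glue_image1: "glue ` {Suc 0..<Suc (Suc j)} = insert beta (b ` {..<j})"
proof -
  have "{Suc 0..<Suc (Suc j)} = insert (Suc 0) {Suc (Suc 0)..<Suc (Suc j)}" by auto
  then show ?thesis using glue_image_ge2[of 0 j] by (simp add: glue_simps lessThan_atLeast0)
qed

lemma glue_image0: "glue ` {0..<Suc (Suc j)} = insert alpha (insert beta (b ` {..<j}))"
proof -
  have "{0..<Suc (Suc j)} = insert 0 {Suc 0..<Suc (Suc j)}" by auto
  then show ?thesis using glue_image1[of j] by (simp add: glue_simps)
qed

lemma alpha_ne_beta: "alpha \<noteq> beta" "alpha \<noteq> id" "beta \<noteq> id"
proof -
  have "alpha (N + m) \<noteq> N + m" "beta (N + m) = N + m"
    using m_div x_mem by (auto simp: alpha_apply P_def beta_apply zeta_apply)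
  then show "alpha \<noteq> beta" "alpha \<noteq> id" by (auto simp only: id_apply)
  have "beta x \<noteq> x" using x_p by (auto simp: beta_apply)
  then show "beta \<noteq> id" by (auto simp only: id_apply)
qed

lemma alpha_beta_trivial: "gen {alpha} \<inter> gen {beta} \<subseteq> {id}"
  unfolding gen_singleton[OF alpha_invol] gen_singleton[OF beta_invol] using alpha_ne_beta by blast

lemma glue_commute_alpha: "i < k \<Longrightarrow> alpha \<circ> b i = b i \<circ> alpha"
proof
  fix y assume i: "i < k"
  show "(alpha \<circ> b i) y = (b i \<circ> alpha) y"
  proof (cases "y \<in> {1..N}")
    case True
    then have "b i y \<in> {1..N}" using permutes_in_image[OF b_permutes[OF i]] by blast
    then show ?thesis using True by (simp add: alpha_apply P_def)
  next
    case False
    moreover have "alpha permutes P" using alpha_Alt by (simp add: Alt_def)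
    then have "alpha y \<in> P \<longleftrightarrow> y \<in> P" by (rule permutes_in_image)
    moreover have "alpha y = y" if "y \<notin> P" using that by (simp add: alpha_apply)
    ultimately have "alpha y \<notin> {1..N}" by (cases "y \<in> P") (auto simp: P_def)
    then show ?thesis using False b_fix[OF i] by simp
  qed
qed

lemma glue_commute_beta: "1 \<le> i \<Longrightarrow> i < k \<Longrightarrow> beta \<circ> b i = b i \<circ> beta"
proof
  fix y assume i: "1 \<le> i" "i < k"
  have inj: "b i y = x \<longleftrightarrow> y = x" using b_x[OF i] permutes_inj[OF b_permutes[OF i(2)]] by (metis injD)
  show "(beta \<circ> b i) y = (b i \<circ> beta) y"
  proof (cases "y \<in> {1..N}")
    case True
    then have "b i y \<in> {1..N}" using permutes_in_image[OF b_permutes[OF i(2)]] by blast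
    then show ?thesis using True inj b_fix[OF i(2), of p] by (auto simp: beta_apply zeta_apply)
  next
    case False
    then have "zeta y \<notin> {1..N}" by (rule zeta_outside)
    then show ?thesis using False b_fix[OF i(2)] b_x[OF i] x_mem by (auto simp: beta_apply)
  qed
qed

lemma glue_string: "string_involutions (k + 2) glue"
proof
  show "glue i \<circ> glue i = id" if "i < k + 2" for i
    using that alpha_invol beta_invol invol[of "i - 2"] unfolding glue_def by (auto simp del: o_apply)
  show "glue i \<circ> glue j = glue j \<circ> glue i" if "i + 2 \<le> j" "j < k + 2" for i j
  proof -
    have j: "glue j = b (j - 2)" "j - 2 < k" using that by (auto simp: glue_def)
    consider "i = 0" | "i = 1" | "2 \<le> i" by linarith
    then show ?thesis
    proof cases
      case 1
      then show ?thesis unfolding j(1) using glue_commute_alpha[OF j(2)] by (simp only: glue_simps)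
    next
      case 2
      then have "glue i = beta" "1 \<le> j - 2" using that by (auto simp: glue_def)
      then show ?thesis unfolding j(1) using glue_commute_beta j(2) by metis
    next
      case 3
      then have "glue i = b (i - 2)" "i - 2 + 2 \<le> j - 2" using that by (auto simp: glue_def)
      then show ?thesis unfolding j(1) using far_commute j(2) by metis
    qed
  qed
qed

lemma glue_ip: "interval_ip (k + 2) glue"
  unfolding interval_ip_def
proof (intro allI impI)
  fix i j assume ij: "i < j" "j < k + 2"
  consider "i = 0" "j = 1" | j' where "i = 0" "j = Suc (Suc j')" | j' where "i = 1" "j = Suc (Suc j')"
    | i' j' where "i = Suc (Suc i')" "j = Suc (Suc j')"
    using ij by (metis One_nat_def less_nat_zero_code nat.exhaust not_less_eq)
  then show "gen (glue ` {i..<j}) \<inter> gen (glue ` {i<..j}) \<subseteq> gen (glue ` {i<..<j})"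
  proof cases
    case 1
    then have "{i..<j} = {0}" "{i<..j} = {Suc 0}" "{i<..<j} = {}" by auto
    then show ?thesis using alpha_beta_trivial by (simp add: glue_simps)
  next
    case 2
    then have e: "{i<..j} = {Suc 0..<Suc (Suc (Suc j'))}" "{i<..<j} = {Suc 0..<Suc (Suc j')}" by auto
    show ?thesis unfolding e unfolding 2 glue_image0 glue_image1
      using A0_inter_A1[of j'] ij 2 by simp
  next
    case 3
    then have e: "{i<..j} = {Suc (Suc 0)..<Suc (Suc (Suc j'))}" "{i<..<j} = {Suc (Suc 0)..<Suc (Suc j')}"
      "{i..<j} = {Suc 0..<Suc (Suc j')}" by auto
    show ?thesis unfolding e glue_image_ge2 glue_image1
      using A1_inter_H'[of j'] ij 3 by (simp add: lessThan_atLeast0)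
  next
    case 4
    then have e: "{i<..j} = {Suc (Suc (Suc i'))..<Suc (Suc (Suc j'))}" "{i<..<j} = {Suc (Suc (Suc i'))..<Suc (Suc j')}"
      "{i..<j} = {Suc (Suc i')..<Suc (Suc j')}" by auto
    have "gen (b ` {i'..<j'}) \<inter> gen (b ` {i'<..j'}) \<subseteq> gen (b ` {i'<..<j'})"
      using b_ip ij 4 by (auto simp: interval_ip_def)
    moreover have "{i'<..j'} = {Suc i'..<Suc j'}" "{i'<..<j'} = {Suc i'..<j'}" by auto
    ultimately show ?thesis unfolding e glue_image_ge2 by simp
  qed
qed

theorem glue_alt_string: "alt_string (N + m) (k + 2) glue"
proof -
  have sub: "insert x P \<subseteq> {1..N + m}" "{1..N} \<subseteq> {1..N + m}" using x_mem by (auto simp: P_def)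
  have "glue i \<in> Alt {1..N + m} \<and> glue i \<noteq> id" if "i < k + 2" for i
  proof -
    have "alpha \<in> Alt {1..N + m}" "beta \<in> Alt {1..N + m}"
      using alpha_Alt beta_Alt sub Alt_mono[of P "{1..N + m}"] Alt_mono[of "insert x P" "{1..N + m}"] by auto
    moreover have "b j \<in> Alt {1..N + m} \<and> b j \<noteq> id" if "j < k" for j
      using b_Alt[OF that] b_ne[OF that] Alt_mono[OF sub(2)] by blast
    ultimately show ?thesis using alpha_ne_beta(2,3) that unfolding glue_def by auto
  qed
  moreover have "Alt {1..N + m} \<subseteq> gen (glue ` {..<k + 2})"
  proof -
    have "C k = {1..N + m}" using m_div unfolding C_def Orb_k P_def by auto
    moreover have "{..<k + 2} = {0..<Suc (Suc k)}" by auto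
    ultimately show ?thesis using Alt_subset_A0[of k] k_pos by (simp add: glue_image0)
  qed
  ultimately show ?thesis unfolding alt_string_def using glue_string glue_ip by blast
qed

end

section \<open>Coset enumeration\<close>

text \<open>A verified coset table: \<open>T\<close> lists representatives of left cosets of
  \<open>gen A\<close>, and the second premise is closure under the generators. No bound on the
  group order is involved.\<close>

lemma gen_cosets:
  assumes "id \<in> T" "\<And>s t. s \<in> S \<Longrightarrow> t \<in> T \<Longrightarrow> \<exists>t'\<in>T. \<exists>h\<in>gen A. s \<circ> t = t' \<circ> h" "g \<in> gen S"
  shows "\<exists>t\<in>T. \<exists>h\<in>gen A. g = t \<circ> h"
  using assms(3)
proof (induction rule: gen.induct)
  case gen_id
  show ?case using assms(1) gen.gen_id[of A] by (metis comp_id)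
next
  case (gen_step s g)
  then obtain t h where th: "t \<in> T" "h \<in> gen A" "g = t \<circ> h" by blast
  obtain t' h' where t': "t' \<in> T" "h' \<in> gen A" "s \<circ> t = t' \<circ> h'" using assms(2)[OF gen_step.hyps(1) th(1)] by blast
  have "s \<circ> g = t' \<circ> (h' \<circ> h)" unfolding th(3) using t'(3) by (metis comp_assoc)
  then show ?case using t' th(2) gen_comp by blast
qed

lemma gen_fix: "(\<And>s. s \<in> S \<Longrightarrow> s y = y) \<Longrightarrow> g \<in> gen S \<Longrightarrow> g y = y"
  by (erule gen_induct_left) auto

text \<open>If every representative except the identity moves \<open>y\<close> while
  \<open>A\<close> fixes it, an element fixing \<open>y\<close> has to lie in the trivial
  coset.\<close>

lemma gen_stabilizer:
  assumes "id \<in> T" "\<And>s t. s \<in> S \<Longrightarrow> t \<in> T \<Longrightarrow> \<exists>t'\<in>T. \<exists>h\<in>gen A. s \<circ> t = t' \<circ> h"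
    and "\<And>t. t \<in> T \<Longrightarrow> t \<noteq> id \<Longrightarrow> t y \<noteq> y" "\<And>s. s \<in> A \<Longrightarrow> s y = y"
    and "g \<in> gen S" "g y = y"
  shows "g \<in> gen A"
proof -
  obtain t h where th: "t \<in> T" "h \<in> gen A" "g = t \<circ> h" using gen_cosets[OF assms(1,2,5)] by blast
  have "h y = y" by (rule gen_fix[OF _ th(2)]) (rule assms(4))
  then have "t y = y" using assms(6) th(3) by simp
  then have "t = id" using assms(3)[OF th(1)] by blast
  then show ?thesis using th by (simp only: id_comp)
qed

lemma dihedral_elements:
  fixes u v :: "'a \<Rightarrow> 'a"
  assumes "u \<circ> u = id" "v \<circ> v = id" "(u \<circ> v) ^^ L = id" "0 < L" "g \<in> gen {u, v}"
  obtains i h where "i < L" "h \<in> {id, v}" "g = (u \<circ> v) ^^ i \<circ> h"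
proof -
  define c where "c = u \<circ> v"
  have cL: "c ^^ L = id" using assms(3) by (simp only: c_def)
  have split: "c ^^ (i + j) = c ^^ i \<circ> c ^^ j" for i j by (rule funpow_add)
  have mod: "c ^^ (i mod L) = c ^^ i" for i
  proof -
    have "c ^^ (L * (i div L)) = id" unfolding funpow_mult[symmetric] cL by (rule id_funpow)
    moreover have "c ^^ i = c ^^ (L * (i div L) + i mod L)" by simp
    ultimately show ?thesis unfolding split by (simp only: id_comp)
  qed
  have vc: "v \<circ> c = c ^^ (L - 1) \<circ> v"
  proof -
    have "L = (L - 1) + 1" using assms(4) by simp
    then have "c ^^ (L - 1) \<circ> c ^^ 1 = c ^^ L" using split[of "L - 1" 1] by metis
    then have d: "c ^^ (L - 1) \<circ> c = id" unfolding cL by (simp only: One_nat_def funpow.simps comp_id)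
    have "c \<circ> (v \<circ> u) = u \<circ> (v \<circ> v) \<circ> u" unfolding c_def by (simp only: comp_assoc)
    then have cvu: "c \<circ> (v \<circ> u) = id" unfolding assms(2) comp_id assms(1) .
    have "c ^^ (L - 1) = c ^^ (L - 1) \<circ> (c \<circ> (v \<circ> u))" unfolding cvu by (simp only: comp_id)
    also have "\<dots> = v \<circ> u" unfolding comp_assoc[symmetric] d by (simp only: id_comp comp_assoc)
    finally show ?thesis unfolding c_def by (simp only: comp_assoc)
  qed
  have vci: "v \<circ> c ^^ i = c ^^ ((L - 1) * i) \<circ> v" for i
  proof (induction i)
    case (Suc i)
    have "v \<circ> c ^^ Suc i = (v \<circ> c) \<circ> c ^^ i" by (simp only: funpow.simps comp_assoc)
    also have "\<dots> = c ^^ (L - 1) \<circ> (v \<circ> c ^^ i)" unfolding vc by (simp only: comp_assoc)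
    also have "\<dots> = c ^^ ((L - 1) + (L - 1) * i) \<circ> v" unfolding Suc split by (simp only: comp_assoc)
    finally show ?case by (simp only: mult_Suc_right)
  qed (simp only: mult_0_right funpow.simps id_comp comp_id)
  have u: "u = c \<circ> v" unfolding c_def comp_assoc assms(2) by (simp only: comp_id)
  have "\<exists>i. \<exists>h\<in>{id, v}. g = c ^^ i \<circ> h"
    using assms(5)
  proof (induction rule: gen.induct)
    case gen_id
    show ?case by (rule exI[of _ 0], rule bexI[of _ id]) (simp_all only: funpow.simps id_comp insertI1)
  next
    case (gen_step s g)
    then obtain i h where ih: "h \<in> {id, v}" "g = c ^^ i \<circ> h" by blast
    have vh: "v \<circ> h \<in> {id, v}" using ih(1) assms(2) by (metis comp_id insertE insertI1 insertI2 singletonD singletonI)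
    have vg: "v \<circ> g = c ^^ ((L - 1) * i) \<circ> (v \<circ> h)" unfolding ih(2) using vci by (metis comp_assoc)
    show ?case
    proof (cases "s = v")
      case True
      then show ?thesis using vg vh by blast
    next
      case False
      then have "s = u" using gen_step by blast
      then have "s \<circ> g = c \<circ> (v \<circ> g)" using u by (simp only: comp_assoc)
      then have "s \<circ> g = c ^^ Suc ((L - 1) * i) \<circ> (v \<circ> h)" unfolding vg by (simp only: funpow.simps comp_assoc)
      then show ?thesis using vh by blast
    qed
  qed
  then obtain i h where "h \<in> {id, v}" "g = c ^^ i \<circ> h" by blast
  then show ?thesis using that[of "i mod L" h] mod[of i] assms(4) unfolding c_def[symmetric] by simp
qed

text \<open>A reflection differs from a power of \<open>u \<circ> v\<close> by the factor
  \<open>v\<close>, which lies in \<open>gen B\<close> anyway; so only the powers have to be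
  tested.\<close>

lemma dihedral_inter:
  fixes u v :: "'a \<Rightarrow> 'a"
  assumes "u \<circ> u = id" "v \<circ> v = id" "(u \<circ> v) ^^ L = id" "0 < L" "v \<in> gen B"
    and "\<And>i. 0 < i \<Longrightarrow> i < L \<Longrightarrow> (u \<circ> v) ^^ i \<notin> gen B"
  shows "gen {u, v} \<inter> gen B \<subseteq> gen {v}"
proof
  fix g assume g: "g \<in> gen {u, v} \<inter> gen B"
  then obtain i h where ih: "i < L" "h \<in> {id, v}" "g = (u \<circ> v) ^^ i \<circ> h"
    using dihedral_elements[OF assms(1-4), of g] by blast
  have hh: "h \<circ> h = id" using ih(2) assms(2) by (metis comp_id insertE singletonD)
  have h: "h \<in> gen B" "h \<in> gen {v}" using ih(2) assms(5) gen_id gen_base by blast+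
  have "g \<circ> h = (u \<circ> v) ^^ i" unfolding ih(3) comp_assoc hh by (simp only: comp_id)
  then have "(u \<circ> v) ^^ i \<in> gen B" using g h(1) gen_comp by fastforce
  then have "i = 0" using assms(6) ih(1) by blast
  then have "g = h" using ih(3) by (simp only: funpow.simps id_comp)
  then show "g \<in> gen {v}" using h by simp
qed

section \<open>The group of degree six and a fifth path point\<close>

text \<open>The three involutions generate \<open>PSL(2,5)\<close> acting on the projective line; the first two
  generate the dihedral group of order ten fixing the last point. The six elements of \<open>T\<close> are coset
  representatives.\<close>

lemma six_points:
  assumes dist: "distinct [q0, q1, q2, q3, q4, q5]"
  defines "b \<equiv> transpose q0 q1 \<circ> transpose q2 q3" and "a \<equiv> transpose q1 q2 \<circ> transpose q3 q4"
    and "t \<equiv> transpose q2 q3 \<circ> transpose q4 q5"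
  shows "g \<in> gen {t, a, b} \<Longrightarrow> g q5 = q5 \<Longrightarrow> g \<in> gen {a, b}"
    and "g \<in> gen {t, a} \<Longrightarrow> g q5 = q5 \<Longrightarrow> g \<in> gen {a}"
proof -
  have v: "a q0 = q0" "a q1 = q2" "a q2 = q1" "a q3 = q4" "a q4 = q3" "a q5 = q5"
    "b q0 = q1" "b q1 = q0" "b q2 = q3" "b q3 = q2" "b q4 = q4" "b q5 = q5"
    "t q0 = q0" "t q1 = q1" "t q2 = q3" "t q3 = q2" "t q4 = q5" "t q5 = q4"
    using dist by (auto simp: a_def b_def t_def transpose_def)
  have o: "a y = y" "b y = y" "t y = y" if "y \<notin> {q0, q1, q2, q3, q4, q5}" for y
    using that by (auto simp: a_def b_def t_def transpose_def)
  have eqI: "f = f'" if "f q0 = f' q0" "f q1 = f' q1" "f q2 = f' q2" "f q3 = f' q3" "f q4 = f' q4" "f q5 = f' q5"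
    "\<And>y. y \<notin> {q0, q1, q2, q3, q4, q5} \<Longrightarrow> f y = f' y" for f f'
  proof
    fix y show "f y = f' y" using that by (cases "y \<in> {q0, q1, q2, q3, q4, q5}") auto
  qed
  note R = v o
  have invs: "t \<circ> t = id" "a \<circ> a = id" "b \<circ> b = id" by (rule eqI; simp add: R)+
  \<comment> \<open>The representatives are prefixes of a walk that carries \<open>q5\<close>
    through \<open>q4\<close>, \<open>q3\<close>, \<open>q2\<close>, \<open>q1\<close> to
    \<open>q0\<close>, one point at a time; this also shows that they lie in different
    cosets.\<close>
  define t2 where "t2 = a \<circ> t"
  define t3 where "t3 = t \<circ> t2"
  define t4 where "t4 = a \<circ> t3"
  define t5 where "t5 = b \<circ> t4"
  note D = t2_def t3_def t4_def t5_def
  have v2: "t2 q5 = q3" "t3 q5 = q2" "t4 q5 = q1" "t5 q5 = q0" by (simp_all add: D R)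
  have at: "a \<circ> t2 = t" "t \<circ> t3 = t2" "a \<circ> t4 = t3" "b \<circ> t5 = t4" "t \<circ> t4 = t4 \<circ> a"
    "b \<circ> t = t \<circ> b" "b \<circ> t2 = t3 \<circ> (b \<circ> a \<circ> b)" "b \<circ> t3 = t2 \<circ> (b \<circ> a \<circ> b)"
    "t \<circ> t5 = t5 \<circ> a" "a \<circ> t5 = t5 \<circ> (a \<circ> b \<circ> a \<circ> b \<circ> a)"
    unfolding D by (rule eqI; simp add: R)+
  have base: "a \<in> gen {a, b}" "b \<in> gen {a, b}" "a \<in> gen {a}" "id \<in> gen {a, b}" "id \<in> gen {a}"
    by (auto intro: gen_base) (simp_all only: gen_id)
  have bab: "b \<circ> a \<circ> b \<in> gen {a, b}" "a \<circ> b \<circ> a \<circ> b \<circ> a \<in> gen {a, b}"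
    using base by (auto intro!: gen_comp simp del: o_apply)
  note coset_simps = comp_id id_comp invs at t2_def[symmetric]
    t3_def[symmetric] t4_def[symmetric] t5_def[symmetric] base bab insert_iff simp_thms
  have ne: "q5 \<noteq> q4" "q5 \<noteq> q3" "q5 \<noteq> q2" "q5 \<noteq> q1" "q5 \<noteq> q0" using dist by auto
  show "g \<in> gen {a, b}" if "g \<in> gen {t, a, b}" "g q5 = q5"
  proof -
    let ?T = "{id, t, t2, t3, t4, t5}"
    define E :: "('a \<Rightarrow> 'a) \<Rightarrow> ('a \<Rightarrow> 'a) \<Rightarrow> bool" where "E s w \<longleftrightarrow> (\<exists>t'\<in>?T. \<exists>h\<in>gen {a, b}. s \<circ> w = t' \<circ> h)" for s w
    have I: "E s w" if "s \<circ> w = w' \<circ> h" "w' \<in> ?T" "h \<in> gen {a, b}" for s w w' h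
      using that unfolding E_def by blast
    have Et0: "E t id" by (rule I[of _ _ t id]) (simp_all only: coset_simps)
    have Ea0: "E a id" by (rule I[of _ _ id a]) (simp_all only: coset_simps)
    have Eb0: "E b id" by (rule I[of _ _ id b]) (simp_all only: coset_simps)
    have Et1: "E t t" by (rule I[of _ _ id id]) (simp_all only: coset_simps)
    have Ea1: "E a t" by (rule I[of _ _ t2 id]) (simp_all only: coset_simps)
    have Eb1: "E b t" by (rule I[of _ _ t b]) (simp_all only: coset_simps)
    have Et2: "E t t2" by (rule I[of _ _ t3 id]) (simp_all only: coset_simps)
    have Ea2: "E a t2" by (rule I[of _ _ t id]) (simp_all only: coset_simps)
    have Eb2: "E b t2" by (rule I[of _ _ t3 "b \<circ> a \<circ> b"]) (simp_all only: coset_simps)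
    have Et3: "E t t3" by (rule I[of _ _ t2 id]) (simp_all only: coset_simps)
    have Ea3: "E a t3" by (rule I[of _ _ t4 id]) (simp_all only: coset_simps)
    have Eb3: "E b t3" by (rule I[of _ _ t2 "b \<circ> a \<circ> b"]) (simp_all only: coset_simps)
    have Et4: "E t t4" by (rule I[of _ _ t4 a]) (simp_all only: coset_simps)
    have Ea4: "E a t4" by (rule I[of _ _ t3 id]) (simp_all only: coset_simps)
    have Eb4: "E b t4" by (rule I[of _ _ t5 id]) (simp_all only: coset_simps)
    have Et5: "E t t5" by (rule I[of _ _ t5 a]) (simp_all only: coset_simps)
    have Ea5: "E a t5" by (rule I[of _ _ t5 "a \<circ> b \<circ> a \<circ> b \<circ> a"]) (simp_all only: coset_simps)
    have Eb5: "E b t5" by (rule I[of _ _ t4 id]) (simp_all only: coset_simps)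
    note F = Et0 Ea0 Eb0 Et1 Ea1 Eb1 Et2 Ea2 Eb2 Et3 Ea3 Eb3 Et4 Ea4 Eb4 Et5 Ea5 Eb5
    show ?thesis
    proof (rule gen_stabilizer[of ?T "{t, a, b}" "{a, b}" q5 g])
      fix s w assume "s \<in> {t, a, b}" "w \<in> ?T"
      then have "E s w" by (elim insertE emptyE) (simp_all only: F)
      then show "\<exists>t'\<in>?T. \<exists>h\<in>gen {a, b}. s \<circ> w = t' \<circ> h" by (simp only: E_def)
    next
      fix w assume "w \<in> ?T" "w \<noteq> id"
      then show "w q5 \<noteq> q5" by (elim insertE emptyE) (simp_all only: v v2 ne[symmetric] simp_thms)
    next
      fix s assume "s \<in> {a, b}"
      then show "s q5 = q5" by (elim insertE emptyE) (simp_all only: v)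
    qed (use that in \<open>simp_all only: insert_iff simp_thms\<close>)
  qed
  show "g \<in> gen {a}" if "g \<in> gen {t, a}" "g q5 = q5"
  proof -
    \<comment> \<open>Without \<open>b\<close> the walk ends at \<open>q1\<close>: both
      \<open>t\<close> and \<open>a\<close> fix \<open>q0\<close>.\<close>
    let ?T = "{id, t, t2, t3, t4}"
    define E :: "('a \<Rightarrow> 'a) \<Rightarrow> ('a \<Rightarrow> 'a) \<Rightarrow> bool" where "E s w \<longleftrightarrow> (\<exists>t'\<in>?T. \<exists>h\<in>gen {a}. s \<circ> w = t' \<circ> h)" for s w
    have I: "E s w" if "s \<circ> w = w' \<circ> h" "w' \<in> ?T" "h \<in> gen {a}" for s w w' h
      using that unfolding E_def by blast
    have Et0: "E t id" by (rule I[of _ _ t id]) (simp_all only: coset_simps)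
    have Ea0: "E a id" by (rule I[of _ _ id a]) (simp_all only: coset_simps)
    have Et1: "E t t" by (rule I[of _ _ id id]) (simp_all only: coset_simps)
    have Ea1: "E a t" by (rule I[of _ _ t2 id]) (simp_all only: coset_simps)
    have Et2: "E t t2" by (rule I[of _ _ t3 id]) (simp_all only: coset_simps)
    have Ea2: "E a t2" by (rule I[of _ _ t id]) (simp_all only: coset_simps)
    have Et3: "E t t3" by (rule I[of _ _ t2 id]) (simp_all only: coset_simps)
    have Ea3: "E a t3" by (rule I[of _ _ t4 id]) (simp_all only: coset_simps)
    have Et4: "E t t4" by (rule I[of _ _ t4 a]) (simp_all only: coset_simps)
    have Ea4: "E a t4" by (rule I[of _ _ t3 id]) (simp_all only: coset_simps)
    note F = Et0 Ea0 Et1 Ea1 Et2 Ea2 Et3 Ea3 Et4 Ea4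
    show ?thesis
    proof (rule gen_stabilizer[of ?T "{t, a}" "{a}" q5 g])
      fix s w assume "s \<in> {t, a}" "w \<in> ?T"
      then have "E s w" by (elim insertE emptyE) (simp_all only: F)
      then show "\<exists>t'\<in>?T. \<exists>h\<in>gen {a}. s \<circ> w = t' \<circ> h" by (simp only: E_def)
    next
      fix w assume "w \<in> ?T" "w \<noteq> id"
      then show "w q5 \<noteq> q5" by (elim insertE emptyE) (simp_all only: v v2 ne[symmetric] simp_thms)
    next
      fix s assume "s \<in> {a}"
      then show "s q5 = q5" by (elim insertE emptyE) (simp_all only: v)
    qed (use that in \<open>simp_all only: insert_iff simp_thms\<close>)
  qed
qed

locale gluing4 = gluing N k b x 4 for N k b x
begin

text \<open>With \<open>m = 4\<close> the points \<open>x, N + 1, \<dots>, N + 5\<close> and the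
  maps \<open>beta\<close>, \<open>alpha\<close>, \<open>tau\<close> form the configuration of
  \<open>six_points\<close>. \<open>tau\<close> and \<open>beta\<close> share a transposition and
  are otherwise disjoint, so they commute.\<close>

definition tau :: "nat \<Rightarrow> nat" where "tau = transpose (N + 2) (N + 3) \<circ> transpose (N + 4) (N + 5)"

definition extend :: "nat \<Rightarrow> nat \<Rightarrow> nat" where "extend i = (if i = 0 then tau else glue (i - 1))"

abbreviation B :: "nat \<Rightarrow> (nat \<Rightarrow> nat) set" where
  "B j \<equiv> gen (insert tau (insert alpha (insert beta (b ` {..<j}))))"

lemma alpha4: "alpha = transpose (N + 1) (N + 2) \<circ> transpose (N + 3) (N + 4)"
proof -
  have "(4::nat) div 2 = Suc (Suc 0)" by simp
  then have "alpha = transpose (N + 1 + 2) (N + 1 + 2 + 1) \<circ> transpose (N + 1) (N + 1 + 1)"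
    by (simp only: alpha_def swaps.simps mult_Suc_right mult_0_right add_0_right comp_id)
  then show ?thesis by (simp only:) (rule ext, auto simp: transpose_def)
qed

lemma beta4: "beta = transpose x (N + 1) \<circ> transpose (N + 2) (N + 3)"
  using x_mem by (intro ext) (auto simp: beta_apply zeta_apply transpose_def)

lemma six:
  shows "g \<in> gen {tau, alpha, beta} \<Longrightarrow> g (N + 5) = N + 5 \<Longrightarrow> g \<in> gen {alpha, beta}"
    and "g \<in> gen {tau, alpha} \<Longrightarrow> g (N + 5) = N + 5 \<Longrightarrow> g \<in> gen {alpha}"
proof -
  have "distinct [x, N + 1, N + 2, N + 3, N + 4, N + 5]" using x_mem by auto
  note six_points[OF this, folded alpha4 beta4 tau_def]
  then show "g \<in> gen {tau, alpha, beta} \<Longrightarrow> g (N + 5) = N + 5 \<Longrightarrow> g \<in> gen {alpha, beta}"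
    and "g \<in> gen {tau, alpha} \<Longrightarrow> g (N + 5) = N + 5 \<Longrightarrow> g \<in> gen {alpha}" by blast+
qed

lemma fix5: "alpha (N + 5) = N + 5" "beta (N + 5) = N + 5" "tau (N + 5) = N + 4"
  using x_mem by (auto simp: alpha_apply beta_apply zeta_apply P_def tau_def transpose_def)

lemma A0_fix5:
  assumes "j \<le> k" "g \<in> A0 j" shows "g (N + 5) = N + 5"
proof (rule gen_fix[OF _ assms(2)])
  fix s assume "s \<in> insert alpha (insert beta (b ` {..<j}))"
  then show "s (N + 5) = N + 5" using fix5 b_fix assms(1) by auto
qed

lemma tau_invol: "tau \<circ> tau = id"
  unfolding tau_def by (rule ext) (auto simp: transpose_def)

lemma tau_Alt: "tau \<in> Alt {N + 2..N + 5}"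
proof -
  have "tau permutes {N + 2..N + 5}" unfolding tau_def by (intro permutes_compose permutes_swap_id) auto
  moreover have "evenperm tau" unfolding tau_def
    using evenperm_comp[OF permutation_swap_id permutation_swap_id, of "N + 2" "N + 3" "N + 4" "N + 5"]
    by (simp only: evenperm_swap) simp
  ultimately show ?thesis by (simp add: Alt_def)
qed

lemma B_factor:
  assumes "j \<le> k" "g \<in> B j"
  obtains a h where "a \<in> Alt (insert (N + 5) (C j))" "h \<in> H' j" "g = a \<circ> h"
proof -
  let ?D = "insert (N + 5) (C j)"
  have fin: "finite ?D" using C_finite[OF assms(1)] by simp
  have tD: "tau \<in> Alt ?D" using Alt_mono[of "{N + 2..N + 5}" ?D] tau_Alt by (force simp: C_def P_def)
  have aD: "alpha \<in> Alt ?D" "beta \<in> Alt ?D" using alpha_C beta_C Alt_mono[of "C j" ?D] by blast+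
  have "\<exists>a\<in>Alt ?D. \<exists>h\<in>H' j. g = a \<circ> h"
    using assms(2)
  proof (induction rule: gen.induct)
    case gen_id
    have "id \<in> Alt ?D" by (simp only: Alt_def mem_Collect_eq permutes_id evenperm_id)
    then show ?case using gen.gen_id[of "b ` {..<j}"] by (metis comp_id)
  next
    case (gen_step s g)
    then obtain a h where ah: "a \<in> Alt ?D" "h \<in> H' j" "g = a \<circ> h" by blast
    show ?case
    proof (cases "s \<in> {tau, alpha, beta}")
      case True
      then have "s \<circ> a \<in> Alt ?D" using ah(1) tD aD Alt_comp[OF fin] by blast
      then show ?thesis using ah by (metis comp_assoc)
    next
      case False
      then obtain i where i: "i < j" "s = b i" using gen_step by auto
      have ss: "s \<circ> s = id" using i assms(1) invol by auto
      have "s \<circ> a \<circ> s \<in> Alt ?D"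
      proof (rule Alt_conj[OF fin ah(1) ss])
        have "s \<in> H' j" using i by (intro gen_base) auto
        then show "s y \<in> ?D" if "y \<in> ?D" for y
          using that Orb_closed b_fix[of i y] i assms by (auto simp: C_def P_def)
        show "permutation s" using b_permutes[of i] i assms permutation_permutes by (metis finite_atLeastAtMost less_le_trans)
      qed
      moreover have "(s \<circ> a \<circ> s) \<circ> (s \<circ> h) = s \<circ> a \<circ> (s \<circ> s) \<circ> h" by (simp only: comp_assoc)
      then have "s \<circ> g = (s \<circ> a \<circ> s) \<circ> (s \<circ> h)" unfolding ah(3) ss by (simp only: comp_id comp_assoc)
      moreover have "s \<circ> h \<in> H' j" using ah(2) i by (intro gen.gen_step) auto
      ultimately show ?thesis by blast
    qed
  qed
  then show ?thesis using that by blast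
qed

lemma B_inter_A0:
  assumes "j < k" shows "B j \<inter> A0 (Suc j) \<subseteq> A0 j"
proof
  fix g assume g: "g \<in> B j \<inter> A0 (Suc j)"
  then have g5: "g (N + 5) = N + 5" using A0_fix5[of "Suc j"] assms by auto
  show "g \<in> A0 j"
  proof (cases "j = 0")
    case True
    then show ?thesis using g g5 six(1) by simp
  next
    case False
    obtain a h where ah: "a \<in> Alt (insert (N + 5) (C j))" "h \<in> H' j" "g = a \<circ> h"
      using B_factor[of j g] g assms by auto
    have "h (N + 5) = N + 5" using H'_fix[OF _ ah(2), of "N + 5"] assms by auto
    then have "a (N + 5) = N + 5" using g5 ah(3) by simp
    then have "a permutes C j"
      using ah(1) permutes_superset[of a "insert (N + 5) (C j)" "C j"] by (auto simp: Alt_def)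
    then have "a \<in> Alt (C j)" using ah(1) by (auto simp: Alt_def)
    then have "a \<in> A0 j" using Alt_subset_A0[of j] False assms by auto
    moreover have "h \<in> A0 j" using ah(2) gen_mono[of "b ` {..<j}" "insert alpha (insert beta (b ` {..<j}))"] by blast
    ultimately show ?thesis unfolding ah(3) by (rule gen_comp)
  qed
qed

lemma extend_image: "extend ` {Suc i..<Suc j} = glue ` {i..<j}"
proof -
  have "extend (Suc l) = glue l" for l by (simp add: extend_def)
  then show ?thesis by (simp flip: image_Suc_atLeastLessThan add: image_image)
qed

lemma extend_image0: "extend ` {0..<Suc j} = insert tau (glue ` {0..<j})"
proof -
  have e: "{0..<Suc j} = insert 0 {Suc 0..<Suc j}" by auto
  have "extend 0 = tau" by (simp add: extend_def)
  then show ?thesis unfolding e image_insert extend_image by simp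
qed

lemma extend_ip: "interval_ip (k + 3) extend"
  unfolding interval_ip_def
proof (intro allI impI)
  fix i j assume ij: "i < j" "j < k + 3"
  consider "i = 0" "j = 1" | "i = 0" "j = 2" | l where "i = 0" "j = Suc (Suc (Suc l))" | i' j' where "i = Suc i'" "j = Suc j'"
  proof -
    obtain j' where j': "j = Suc j'" using ij by (cases j) auto
    show ?thesis
    proof (cases i)
      case 0
      then show ?thesis using that(1-3) j' by (cases j'; cases "j' - 1") auto
    qed (use that(4) j' in auto)
  qed
  then show "gen (extend ` {i..<j}) \<inter> gen (extend ` {i<..j}) \<subseteq> gen (extend ` {i<..<j})"
  proof cases
    case 1
    then have "{i..<j} = {0}" "{i<..j} = {1}" "{i<..<j} = {}" by auto
    moreover have "tau \<noteq> alpha"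
    proof
      assume "tau = alpha"
      then show False using fix5 by auto
    qed
    then have "gen {tau} \<inter> gen {alpha} \<subseteq> {id}"
      unfolding gen_singleton[OF tau_invol] gen_singleton[OF alpha_invol] by blast
    ultimately show ?thesis by (simp add: extend_def glue_simps)
  next
    case 2
    then have "{i..<j} = {0, 1}" "{i<..j} = {1, 2}" "{i<..<j} = {1}" by auto
    moreover have "extend ` {0, 1} = {tau, alpha}" "extend ` {1, 2} = {alpha, beta}" "extend ` {1} = {alpha}"
      by (auto simp: extend_def glue_def)
    moreover have "g \<in> gen {alpha}" if "g \<in> gen {tau, alpha}" "g \<in> gen {alpha, beta}" for g
      using six(2)[OF that(1)] A0_fix5[of 0 g] that(2) by simp
    ultimately show ?thesis by (simp only: subset_iff Int_iff) blast
  next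
    case 3
    then have e: "{i..<j} = {0..<Suc (Suc (Suc l))}" "{i<..j} = {Suc 0..<Suc (Suc (Suc (Suc l)))}"
      "{i<..<j} = {Suc 0..<Suc (Suc (Suc l))}" by auto
    show ?thesis unfolding e extend_image0 extend_image glue_image0
      using B_inter_A0[of l] ij 3 by simp
  next
    case 4
    then have e: "{i..<j} = {Suc i'..<Suc j'}" "{i<..j} = {Suc (Suc i')..<Suc (Suc j')}"
      "{i<..<j} = {Suc (Suc i')..<Suc j'}" by auto
    have "gen (glue ` {i'..<j'}) \<inter> gen (glue ` {i'<..j'}) \<subseteq> gen (glue ` {i'<..<j'})"
      using glue_ip ij 4 by (auto simp: interval_ip_def)
    moreover have "{i'<..j'} = {Suc i'..<Suc j'}" "{i'<..<j'} = {Suc i'..<j'}" by auto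
    ultimately show ?thesis unfolding e extend_image by simp
  qed
qed

lemma extend_string: "string_involutions (k + 3) extend"
proof
  interpret G: string_involutions "k + 2" glue by (rule glue_string)
  show "extend i \<circ> extend i = id" if "i < k + 3" for i
    using that tau_invol G.invol[of "i - 1"] unfolding extend_def by (auto simp del: o_apply)
  show "extend i \<circ> extend j = extend j \<circ> extend i" if "i + 2 \<le> j" "j < k + 3" for i j
  proof (cases "i = 0")
    case False
    then have "extend i = glue (i - 1)" "extend j = glue (j - 1)" using that by (auto simp: extend_def)
    then show ?thesis using G.far_commute[of "i - 1" "j - 1"] that False by auto
  next
    case True
    have tb: "tau \<circ> beta = beta \<circ> tau"
      unfolding beta4 tau_def using x_mem by (intro ext) (auto simp: transpose_def)
    have "tau \<circ> b l = b l \<circ> tau" if "l < k" for l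
    proof
      fix y show "(tau \<circ> b l) y = (b l \<circ> tau) y"
      proof (cases "y \<in> {1..N}")
        case True
        then have "b l y \<in> {1..N}" using permutes_in_image[OF b_permutes[OF that]] by blast
        then show ?thesis using True by (auto simp: tau_def transpose_def)
      next
        case False
        then have "tau y \<notin> {1..N}" by (auto simp: tau_def transpose_def)
        then show ?thesis using False b_fix[OF that] by simp
      qed
    qed
    then show ?thesis using that True tb by (auto simp: extend_def glue_def simp del: o_apply)
  qed
qed

theorem extend_alt_string: "alt_string (N + 5) (k + 3) extend"
proof -
  have g: "alt_string (N + 4) (k + 2) glue" by (rule glue_alt_string)
  have tau: "tau \<in> Alt {1..N + 5}" using tau_Alt Alt_mono[of "{N + 2..N + 5}" "{1..N + 5}"] by auto
  have "tau \<noteq> id" using fix5(3) by (auto simp only: id_apply)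
  have "Alt {1..N + 4} \<subseteq> Alt {1..N + 5}" by (rule Alt_mono) auto
  then have "extend i \<in> Alt {1..N + 5} \<and> extend i \<noteq> id" if "i < k + 3" for i
    using g tau \<open>tau \<noteq> id\<close> that unfolding alt_string_def extend_def by auto
  moreover have "Alt {1..N + 5} \<subseteq> gen (extend ` {..<k + 3})"
  proof -
    let ?S = "extend ` {..<k + 3}"
    have S: "s \<circ> s = id" if "s \<in> ?S" for s
      using that extend_string by (auto simp: string_involutions_def simp del: o_apply)
    have "{..<k + 3} = {0..<Suc (k + 2)}" by auto
    then have e: "?S = insert tau (glue ` {..<k + 2})" using extend_image0[of "k + 2"] by (simp add: lessThan_atLeast0)
    then have "gen (glue ` {..<k + 2}) \<subseteq> gen ?S" by (intro gen_mono) auto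
    then have sub: "Alt {1..N + 4} \<subseteq> gen ?S" using g by (auto simp: alt_string_def)
    have r: "z \<in> reach (gen ?S) 1" if "z \<in> {1..N + 4}" for z
    proof (cases "z = 1")
      case False
      define w :: nat where "w = (if z = 2 then 3 else 2)"
      have d: "distinct [1, z, w]" "{1, z, w} \<subseteq> {1..N + 4}" using False that by (auto simp: w_def)
      have "evenperm (cyc3 1 z w)" "cyc3 1 z w permutes {1..N + 4}"
        using d unfolding cyc3_def
        by (auto intro!: permutes_compose permutes_swap_id simp: evenperm_comp permutation_swap_id evenperm_swap simp del: o_apply)
      then have "cyc3 1 z w \<in> gen ?S" using sub by (auto simp: Alt_def)
      then show ?thesis using d by (auto simp: reach_def)
    qed (simp add: reach_def)
    have N1: "1 \<le> N" using x_mem by auto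
    have "tau 1 = 1" using N1 by (auto simp: tau_def transpose_def)
    \<comment> \<open>\<open>tau\<close> fixes 1 and so preserves its class, which already contains
      \<open>N + 4\<close>; this brings in the new point.\<close>
    have "tau (N + 4) \<in> reach (gen ?S) 1"
    proof (rule reach_closed[where S = ?S and g = tau and y = "N + 4"])
      show "s \<circ> s = id" if "s \<in> ?S" for s using S[OF that] .
      show "tau \<in> gen ?S" using e by (intro gen_base) auto
      show "tau 1 \<in> reach (gen ?S) 1" using \<open>tau 1 = 1\<close> by (simp add: reach_def)
      show "N + 4 \<in> reach (gen ?S) 1" using r by simp
    qed
    moreover have "tau (N + 4) = N + 5" by (auto simp: tau_def transpose_def)
    moreover have "{1..N + 5} = insert (N + 5) {1..N + 4}" by auto
    ultimately have "{1..N + 5} \<subseteq> reach (gen ?S) 1" using r by (simp only: insert_subset subset_iff) blast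
    then show ?thesis by (rule Alt_subset_gen[where S = ?S, rotated 3]) (use S in auto)
  qed
  ultimately show ?thesis unfolding alt_string_def using extend_string extend_ip by blast
qed

end

section \<open>A string group on a path\<close>

lemma transpose_mem_gen:
  assumes "\<And>l. a \<le> l \<Longrightarrow> l < c \<Longrightarrow> transpose l (Suc l) \<in> gen S" "a \<le> u" "u \<le> v" "v \<le> c"
  shows "transpose u v \<in> gen S"
  using assms(3,4)
proof (induction v rule: dec_induct)
  case base
  then show ?case by (simp only: transpose_same gen_id)
next
  case (step v)
  show ?case
  proof (cases "u = v")
    case True
    then show ?thesis using assms(1)[of v] assms(2) step by simp
  next
    case False
    then have "transpose v (Suc v) \<circ> transpose u v \<circ> transpose v (Suc v) = transpose u (Suc v)"
      using step by (intro ext) (auto simp: transpose_def)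
    moreover have "transpose v (Suc v) \<in> gen S" "transpose u v \<in> gen S"
      using assms(1,2) step by auto
    ultimately show ?thesis using gen_comp by metis
  qed
qed

lemma permutes_mem_gen:
  assumes "\<And>l. a \<le> l \<Longrightarrow> l < c \<Longrightarrow> transpose l (Suc l) \<in> gen S" "g permutes {a..c}"
  shows "g \<in> gen S"
  using assms(2) finite_atLeastAtMost[of a c]
proof (induction rule: permutes_induct)
  case id
  show ?case by (rule gen_id)
next
  case (swap u v p)
  have "transpose u v \<in> gen S"
  proof (cases "u \<le> v")
    case True
    then show ?thesis using swap by (intro transpose_mem_gen[OF assms(1)]) auto
  next
    case False
    then have "transpose v u \<in> gen S" using swap by (intro transpose_mem_gen[OF assms(1)]) auto
    then show ?thesis by (simp only: transpose_commute)
  qed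
  then show ?case using swap by (intro gen_comp)
qed

text \<open>The edges of the path on \<open>1, \<dots>, K\<close> are labelled \<open>0, 1, \<dots>, q - 1, q - 2, q - 1, q - 2, \<dots>\<close>.\<close>

locale path_group =
  fixes q K :: nat
  assumes q2: "2 \<le> q" and K_ge: "q + 2 \<le> K"
begin

text \<open>The number of edges with label \<open>i\<close>. The last two labels alternate to the
  end of the path, with first edges at \<open>q - 1\<close> and \<open>q\<close>; the counts halve
  the number of points from there to \<open>K\<close>.\<close>

definition cnt :: "nat \<Rightarrow> nat" where
  "cnt i = (if i + 2 < q then 1 else if i + 2 = q then (K - q + 2) div 2 else (K - q + 1) div 2)"

definition f :: "nat \<Rightarrow> nat \<Rightarrow> nat" where "f i = swaps (i + 1) (cnt i)"

lemma cnt: "1 \<le> cnt i" "i < q \<Longrightarrow> i + 1 + 2 * cnt i \<le> K + 1"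
  using q2 K_ge by (auto simp: cnt_def)

lemma f_apply: "f i y = (if i + 1 \<le> y \<and> y < i + 1 + 2 * cnt i then if even (y - (i + 1)) then y + 1 else y - 1 else y)"
  unfolding f_def by (rule swaps_apply)

lemma f_small: "i + 2 < q \<Longrightarrow> f i = transpose (i + 1) (i + 2)"
  by (rule ext) (auto simp: f_apply cnt_def transpose_def)

lemma f_invol: "f i \<circ> f i = id"
  unfolding f_def by (rule swaps_invol)

lemma f_permutes: "i < q \<Longrightarrow> f i permutes {1..K}"
  unfolding f_def using cnt(2)[of i] by (intro permutes_subset[OF swaps_permutes]) auto

lemma f_fix: "y \<le> i \<Longrightarrow> f i y = y"
  by (simp add: f_apply)

lemma f_start: "f i (i + 1) = i + 2"
  using cnt(1)[of i] by (simp add: f_apply)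

sublocale string_involutions q f
proof
  show "f i \<circ> f i = id" for i by (rule f_invol)
  show "f i \<circ> f j = f j \<circ> f i" if "i + 2 \<le> j" "j < q" for i j
  proof
    fix y
    have fi: "f i = transpose (i + 1) (i + 2)" using that by (intro f_small) auto
    have fj: "f j (i + 1) = i + 1" "f j (i + 2) = i + 2" using that by (auto intro: f_fix)
    have "f j y = u \<longleftrightarrow> y = f j u" for u using f_invol[of j] pointfree_idE by metis
    then show "(f i \<circ> f j) y = (f j \<circ> f i) y" unfolding fi using fj by (auto simp: transpose_def)
  qed
qed

lemma H_f_permutes: "A \<subseteq> {..<q} \<Longrightarrow> g \<in> H A \<Longrightarrow> g permutes {1..K}"
proof -
  assume A: "A \<subseteq> {..<q}" and "g \<in> H A"
  from this(2) show ?thesis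
  proof (induction rule: gen.induct)
    case (gen_step t g)
    then have "t permutes {1..K}" using A f_permutes by auto
    then show ?case using gen_step.IH by (rule permutes_compose[rotated])
  qed (rule permutes_id)
qed

text \<open>\<open>f (q - 2)\<close> is split into its first transposition \<open>s\<close> and the
  rest \<open>w\<close>. As \<open>w\<close> lives beyond \<open>q\<close>, it commutes with all
  permutations of the points up to \<open>q\<close>.\<close>

definition s :: "nat \<Rightarrow> nat" where "s = transpose (q - 1) q"
definition w :: "nat \<Rightarrow> nat" where "w = swaps (q + 1) (cnt (q - 2) - 1)"

lemma w_apply: "w y = (if q + 1 \<le> y then f (q - 2) y else y)"
proof -
  have e: "y - Suc (q - 2) = y - Suc q + 2" if "Suc q \<le> y" using that q2 by auto
  have "even (y - Suc (q - 2)) \<longleftrightarrow> even (y - Suc q)" if "Suc q \<le> y" unfolding e[OF that] by simp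
  moreover have "Suc (q + 2 * (cnt (q - 2) - 1)) = Suc (q - 2 + 2 * cnt (q - 2))" using cnt(1)[of "q - 2"] q2 by linarith
  ultimately show ?thesis unfolding w_def swaps_apply f_apply using q2 by auto
qed

lemma f_sw: "f (q - 2) = s \<circ> w"
proof
  fix y
  have "f (q - 2) (q - 1) = q" using f_start[of "q - 2"] q2 by (simp add: numeral_2_eq_2 Suc_diff_Suc)
  moreover have "f (q - 2) (f (q - 2) (q - 1)) = q - 1" using f_invol pointfree_idE by metis
  moreover have "f (q - 2) y = y" if "y < q - 1" using that by (intro f_fix) auto
  moreover have "f (q - 2) y \<noteq> q - 1 \<and> f (q - 2) y \<noteq> q" if "q < y"
  proof -
    have "f (q - 2) (f (q - 2) y) = y" using f_invol pointfree_idE by metis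
    then show ?thesis using that calculation(1,2) by auto
  qed
  moreover have "y < q - 1 \<or> y = q - 1 \<or> y = q \<or> q < y" by linarith
  ultimately show "f (q - 2) y = (s \<circ> w) y" unfolding o_apply s_def using q2
    by (auto simp: w_apply transpose_def)
qed

lemma w_invol: "w \<circ> w = id"
  unfolding w_def by (rule swaps_invol)

lemma s_invol: "s \<circ> s = id"
  unfolding s_def by simp

lemma w_fix: "y \<le> q \<Longrightarrow> w y = y"
  by (simp add: w_apply)

text \<open>\<open>f (q - 3) \<circ> f (q - 2)\<close> is a three-cycle on \<open>q - 2\<close>,
  \<open>q - 1\<close>, \<open>q\<close> times the disjoint involution \<open>w\<close>, so its cube
  is \<open>w\<close>.\<close>

lemma w_mem_gen:
  assumes "q \<ge> 3" "f (q - 3) \<in> gen S" "f (q - 2) \<in> gen S" shows "w \<in> gen S"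
proof -
  have f3: "f (q - 3) = transpose (q - 2) (q - 1)"
    using f_small[of "q - 3"] assms(1) by (simp add: numeral_eq_Suc Suc_diff_Suc)
  define d where "d = f (q - 3) \<circ> f (q - 2)"
  have "d \<in> gen S" unfolding d_def using assms(2,3) by (rule gen_comp)
  then have "d \<circ> (d \<circ> d) \<in> gen S" by (intro gen_comp)
  moreover have "d \<circ> (d \<circ> d) = w"
  proof
    fix y
    have dist: "q - 2 \<noteq> q - 1" "q - 2 \<noteq> q" "q - 1 \<noteq> q" using assms(1) by auto
    have v: "d (q - 2) = q - 1" "d (q - 1) = q" "d q = q - 2"
      unfolding d_def f3 f_sw s_def using dist by (auto simp: w_fix transpose_def)
    have o: "d y = w y" if "y \<notin> {q - 2, q - 1, q}" for y
    proof -
      have "w (w y) = y" using w_invol pointfree_idE by metis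
      then have "w y \<notin> {q - 2, q - 1, q}" using that w_fix[of "w y"] by auto
      then show ?thesis unfolding d_def f3 f_sw s_def by (auto simp: transpose_def)
    qed
    show "(d \<circ> (d \<circ> d)) y = w y"
    proof (cases "y \<in> {q - 2, q - 1, q}")
      case True
      then show ?thesis using v w_fix[of y] by auto
    next
      case False
      have ww: "w (w y) = y" using w_invol pointfree_idE by metis
      then have "w y \<notin> {q - 2, q - 1, q}" using False w_fix[of "w y"] by auto
      then show ?thesis using o False ww by simp
    qed
  qed
  ultimately show ?thesis by simp
qed

text \<open>A common element fixes \<open>i + 1\<close>, because generators of larger index do.
  Where all generators involved are single transpositions, the groups are full symmetric groups on
  consecutive points, and fixing \<open>i + 1\<close> is enough. The label \<open>q - 2\<close>
  brings in the extra factor \<open>w\<close>.\<close>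

lemma f_ip: "interval_ip q f"
  unfolding interval_ip_def
proof (intro allI impI subsetI)
  fix i j g assume ij: "i < j" "j < q" and g: "g \<in> H {i..<j} \<inter> H {i<..j}"
  have fix1: "g (i + 1) = i + 1"
    by (rule gen_fix[of "f ` {i<..j}"]) (use g in \<open>auto intro: f_fix\<close>)
  consider "j + 2 \<le> q" | "i + 2 = q" "j + 1 = q" | "i + 3 \<le> q" "j + 1 = q" using ij by linarith
  then show "g \<in> H {i<..<j}"
  proof cases
    case 1
    have "g permutes {i + 1..j + 1}"
    proof -
      have "g \<in> H {i..<j}" using g by blast
      then show ?thesis
      proof (induction rule: gen.induct)
        case (gen_step t g)
        then obtain l where l: "i \<le> l" "l < j" "t = f l" by auto
        then have "t = transpose (l + 1) (l + 2)" using f_small[of l] 1 by auto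
        then have "t permutes {i + 1..j + 1}" using l by (auto intro!: permutes_swap_id)
        then show ?case using gen_step.IH by (rule permutes_compose[rotated])
      qed (rule permutes_id)
    qed
    moreover have "{i + 1..j + 1} - {i + 2..j + 1} \<subseteq> {i + 1}" by auto
    ultimately have p: "g permutes {i + 2..j + 1}" 
      using fix1 permutes_superset[of g "{i + 1..j + 1}" "{i + 2..j + 1}"] by blast
    show ?thesis
    proof (rule permutes_mem_gen[OF _ p])
      fix l assume "i + 2 \<le> l" "l < j + 1"
      then have "f (l - 1) = transpose l (Suc l)" "l - 1 \<in> {i<..<j}" using f_small[of "l - 1"] 1 by auto
      then show "transpose l (Suc l) \<in> H {i<..<j}" by (metis gen_base imageI)
    qed
  next
    case 2
    then have e: "{i..<j} = {q - 2}" "{i<..j} = {q - 1}" "{i<..<j} = {}" by auto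
    have "f (q - 2) (q - 1) = q" using f_start[of "q - 2"] q2 by (simp add: numeral_2_eq_2 Suc_diff_Suc)
    moreover have "f (q - 1) (q - 1) = q - 1" by (rule f_fix) simp
    ultimately have "f (q - 2) \<noteq> f (q - 1)" using q2 by auto
    then show ?thesis using g gen_singleton[OF f_invol] unfolding e by auto
  next
    case 3
    have q3: "q \<ge> 3" using 3 by simp
    have "g \<in> H {i..<j}" using g by blast
    \<comment> \<open>\<open>w\<close> commutes with everything of the form \<open>p\<close>, so a
      single optional factor \<open>w\<close> on the right suffices.\<close>
    then have "\<exists>p h. g = p \<circ> h \<and> p permutes {i + 1..q} \<and> h \<in> {id, w}"
    proof (induction rule: gen.induct)
      case gen_id
      show ?case by (intro exI[of _ id]) (simp only: id_comp permutes_id insertI1 simp_thms)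
    next
      case (gen_step t g)
      then obtain p h where ph: "g = p \<circ> h" "p permutes {i + 1..q}" "h \<in> {id, w}" by blast
      obtain l where l: "i \<le> l" "l < j" "t = f l" using gen_step by auto
      show ?case
      proof (cases "l + 2 < q")
        case True
        then have "t = transpose (l + 1) (l + 2)" using f_small l by simp
        then have "t permutes {i + 1..q}" using l True by (auto intro!: permutes_swap_id)
        then have "t \<circ> p permutes {i + 1..q}" using ph(2) by (rule permutes_compose[rotated])
        moreover have "t \<circ> g = (t \<circ> p) \<circ> h" using ph by (simp only: comp_assoc)
        ultimately show ?thesis using ph(3) by blast
      next
        case False
        then have "l = q - 2" using l 3 by linarith
        then have t: "t = s \<circ> w" using l f_sw by simp
        have "w \<circ> p = p \<circ> w"
        proof
          fix y
          have ww: "w (w y) = y" using w_invol pointfree_idE by metis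
          show "(w \<circ> p) y = (p \<circ> w) y"
          proof (cases "y \<in> {i + 1..q}")
            case True
            then have "p y \<le> q" using permutes_in_image[OF ph(2), of y] by simp
            then show ?thesis using True w_fix by simp
          next
            case False
            then have "w y \<notin> {i + 1..q}" using ww w_fix[of "w y"] by auto
            then show ?thesis using False ph(2) by (simp add: permutes_def)
          qed
        qed
        then have "t \<circ> g = (s \<circ> p) \<circ> (w \<circ> h)" unfolding t ph(1) by (metis comp_assoc)
        moreover have "s permutes {i + 1..q}" unfolding s_def using 3 by (intro permutes_swap_id) auto
        then have "s \<circ> p permutes {i + 1..q}" using ph(2) by (rule permutes_compose[rotated])
        moreover have "w \<circ> h \<in> {id, w}" using ph(3) w_invol by (metis comp_id insertE insertI1 insertI2 singletonD singletonI)
        ultimately show ?thesis by blast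
      qed
    qed
    then obtain p h where ph: "g = p \<circ> h" "p permutes {i + 1..q}" "h \<in> {id, w}" by blast
    have "h (i + 1) = i + 1" using ph(3) 3 w_fix[of "i + 1"] by auto
    then have "p (i + 1) = i + 1" using fix1 ph(1) by simp
    moreover have "{i + 1..q} - {i + 2..q} \<subseteq> {i + 1}" by auto
    ultimately have p: "p permutes {i + 2..q}" using permutes_superset[OF ph(2), of "{i + 2..q}"] by blast
    show ?thesis
    proof (cases "i + 3 = q")
      case False
      let ?G = "H {i<..<j}"
      have m: "f (q - 3) \<in> ?G" "f (q - 2) \<in> ?G" using 3 False by (auto intro!: gen_base)
      have w: "w \<in> ?G" by (rule w_mem_gen[OF q3 m])
      have "s = f (q - 2) \<circ> w" unfolding f_sw comp_assoc w_invol by (simp only: comp_id)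
      then have s: "s \<in> ?G" using gen_comp[OF m(2) w] by simp
      have "p \<in> ?G"
      proof (rule permutes_mem_gen[OF _ p])
        fix l assume l: "i + 2 \<le> l" "l < q"
        show "transpose l (Suc l) \<in> ?G"
        proof (cases "l + 1 = q")
          case True
          then have "transpose l (Suc l) = s" by (auto simp: s_def)
          then show ?thesis using s by simp
        next
          case False
          then have "f (l - 1) = transpose l (Suc l)" "l - 1 \<in> {i<..<j}" using f_small[of "l - 1"] l 3 by auto
          then show ?thesis by (metis gen_base imageI)
        qed
      qed
      moreover have "h \<in> ?G" using ph(3) w gen_id by blast
      ultimately show ?thesis unfolding ph(1) by (rule gen_comp)
    next
      case True
      \<comment> \<open>Only \<open>f (q - 2) = s \<circ> w\<close> remains in the middle, so
        \<open>s\<close> and \<open>w\<close> can no longer be produced separately. They are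
        excluded from the dihedral group on the other side because neither commutes with
        \<open>f (q - 1)\<close>.\<close>
      then have e: "{i<..j} = {q - 2, q - 1}" "{i<..<j} = {q - 2}" using 3 by auto
      have g2: "g \<in> gen {f (q - 1), f (q - 2)}" using g unfolding e by (simp add: insert_commute)
      have sw: "s \<circ> w = w \<circ> s"
      proof -
        have "s \<circ> w \<circ> (s \<circ> w) = id" using f_invol[of "q - 2"] unfolding f_sw .
        then show ?thesis using s_invol w_invol by (metis comp_assoc comp_id id_comp)
      qed
      have y1: "f (q - 1) q = q + 1" "f (q - 1) (q + 1) = q" "f (q - 1) (q - 1) = q - 1"
      proof -
        show a: "f (q - 1) q = q + 1" using f_start[of "q - 1"] q2 by simp
        show "f (q - 1) (q + 1) = q" using f_invol[of "q - 1"] a by (metis pointfree_idE)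
        show "f (q - 1) (q - 1) = q - 1" by (rule f_fix) simp
      qed
      \<comment> \<open>The room \<open>K \<ge> q + 2\<close> is used here: \<open>w\<close> really
        moves \<open>q + 1\<close>.\<close>
      have c2: "cnt (q - 2) \<ge> 2" using K_ge q2 by (auto simp: cnt_def)
      then have wq: "w (q + 1) = q + 2" unfolding w_def swaps_apply by auto
      have "w \<circ> f (q - 1) \<noteq> f (q - 1) \<circ> w"
      proof
        assume "w \<circ> f (q - 1) = f (q - 1) \<circ> w"
        then have "w (f (q - 1) q) = f (q - 1) (w q)" by (metis o_apply)
        then show False using y1 wq w_fix[of q] by simp
      qed
      moreover have "s \<circ> f (q - 1) \<noteq> f (q - 1) \<circ> s"
      proof
        assume "s \<circ> f (q - 1) = f (q - 1) \<circ> s"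
        then have "s (f (q - 1) (q - 1)) = f (q - 1) (s (q - 1))" by (metis o_apply)
        then show False using y1 by (simp add: s_def)
      qed
      ultimately have nn: "w \<notin> gen {f (q - 1), f (q - 2)}" "s \<notin> gen {f (q - 1), f (q - 2)}"
        using dihedral_commute[OF f_invol[of "q - 1"] w_invol s_invol sw[symmetric]]
          dihedral_commute[OF f_invol[of "q - 1"] s_invol w_invol sw] unfolding f_sw sw by blast+
      have "p permutes {q - 1, q}"
      proof -
        have "{i + 2..q} = {q - 1, q}" using True by auto
        then show ?thesis using p by simp
      qed
      then have "p \<in> {id, s}" unfolding s_def using permutes_insert[of "q - 1" "{q}"]
        by (auto simp del: o_apply simp only: permutes_doubleton_iff insert_iff)
      then consider "g = id" | "g = s" | "g = w" | "g = f (q - 2)"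
        using ph(1,3) f_sw by (metis comp_id id_comp insertE singletonD)
      then show ?thesis
      proof cases
        case 1
        then show ?thesis by (simp only: gen_id)
      next
        case 4
        then show ?thesis unfolding e using gen_base[of "f (q - 2)"] by simp
      qed (use nn g2 in auto)
    qed
  qed
qed

end

section \<open>Doubling the path\<close>

context path_group
begin

definition lift :: "(nat \<Rightarrow> nat) \<Rightarrow> nat \<Rightarrow> nat" where
  "lift g y = (if y \<le> K then g y else if y \<le> 2 * K then K + g (y - K) else y)"

definition par :: "nat \<Rightarrow> nat" where
  "par y = (if 1 \<le> y \<and> y \<le> K then y + K else if K < y \<and> y \<le> 2 * K then y - K else y)"

text \<open>The pair \<open>{q + 1, q + 2}\<close> is preserved by every \<open>f i\<close> with
  \<open>i \<le> q - 2\<close>, while \<open>f (q - 1)\<close> moves \<open>q + 1\<close> to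
  \<open>q\<close>. Crossing between the copies at exactly these two points therefore commutes with
  all generators but the neighbouring one, and two crossings keep the permutation even.\<close>

definition sg :: "nat \<Rightarrow> nat" where
  "sg = transpose (q + 1) (K + (q + 1)) \<circ> transpose (q + 2) (K + (q + 2))"

definition e :: "nat \<Rightarrow> nat \<Rightarrow> nat" where "e i = (if i < q then lift (f i) else sg)"

lemma lift_id: "lift id = id"
  by (rule ext) (auto simp: lift_def)

lemma perm_le: "g permutes {1..K} \<Longrightarrow> y \<le> K \<Longrightarrow> g y \<le> K" "g permutes {1..K} \<Longrightarrow> 1 \<le> y \<Longrightarrow> 1 \<le> g y"
proof -
  assume g: "g permutes {1..K}"
  have 0: "g 0 = 0" using g by (simp add: permutes_def)
  show "y \<le> K \<Longrightarrow> g y \<le> K" using permutes_in_image[OF g, of y] 0 by (cases "y = 0") auto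
  show "1 \<le> y \<Longrightarrow> 1 \<le> g y" using permutes_in_image[OF g, of y] g
    by (cases "y \<le> K") (auto simp: permutes_def)
qed

lemma lift_comp: "h permutes {1..K} \<Longrightarrow> lift (g \<circ> h) = lift g \<circ> lift h"
proof
  fix y assume h: "h permutes {1..K}"
  consider "y \<le> K" | "K < y" "y \<le> 2 * K" | "2 * K < y" by linarith
  then show "lift (g \<circ> h) y = (lift g \<circ> lift h) y"
  proof cases
    case 2
    then have "1 \<le> h (y - K)" "h (y - K) \<le> K" using perm_le[OF h, of "y - K"] by auto
    then show ?thesis using 2 by (simp add: lift_def)
  qed (use perm_le(1)[OF h, of y] in \<open>simp_all add: lift_def\<close>)
qed

lemma par_invol: "par (par y) = y"
  by (auto simp: par_def)

lemma lift_par: "g permutes {1..K} \<Longrightarrow> lift g \<circ> par = par \<circ> lift g"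
proof
  fix y assume g: "g permutes {1..K}"
  have 0: "g 0 = 0" using g by (simp add: permutes_def)
  consider "y = 0" | "1 \<le> y" "y \<le> K" | "K < y" "y \<le> 2 * K" | "2 * K < y" by linarith
  then show "(lift g \<circ> par) y = (par \<circ> lift g) y"
  proof cases
    case 3
    then have "1 \<le> g (y - K)" "g (y - K) \<le> K" using perm_le[OF g, of "y - K"] by auto
    then show ?thesis using 3 by (simp add: lift_def par_def)
  qed (use 0 perm_le[OF g, of y] in \<open>simp_all add: lift_def par_def\<close>)
qed

lemma lift_permutes: assumes "g permutes {1..K}" shows "lift g permutes {1..2 * K}"
proof (rule permutes_of_bij)
  have "lift (inv' g) \<circ> lift g = id" "lift g \<circ> lift (inv' g) = id"
    using lift_comp[OF assms, of "inv' g"] lift_comp[OF permutes_inv[OF assms], of g] permutes_inv_o[OF assms] lift_id by simp_all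
  then show "bij (lift g)" using o_bij by blast
  show "lift g y = y" if "y \<notin> {1..2 * K}" for y
    using that assms by (auto simp: lift_def permutes_def)
qed

lemma sg_apply: "sg y = (if y \<in> {q + 1, q + 2, K + (q + 1), K + (q + 2)} then par y else y)"
  using q2 K_ge by (auto simp: sg_def par_def transpose_def)

lemma sg_invol: "sg \<circ> sg = id"
  using q2 K_ge by (intro ext) (auto simp: sg_def transpose_def)

lemma sg_par: "sg \<circ> par = par \<circ> sg"
  using q2 K_ge by (intro ext) (auto simp: sg_def par_def transpose_def)

text \<open>Each transposition occurs twice, once per copy.\<close>

lemma evenperm_lift:
  assumes "g permutes {1..K}" shows "evenperm (lift g)"
  using assms finite_atLeastAtMost[of 1 K]
proof (induction rule: permutes_induct)
  case id
  show ?case by (simp only: lift_id evenperm_id)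
next
  case (swap a c p)
  have "lift (transpose a c) = transpose a c \<circ> transpose (K + a) (K + c)"
    using swap(1,2) by (intro ext) (auto simp: lift_def transpose_def)
  moreover have "evenperm (transpose a c \<circ> transpose (K + a) (K + c))"
    using evenperm_comp[OF permutation_swap_id permutation_swap_id, of a c "K + a" "K + c"] by (simp only: evenperm_swap) simp
  ultimately have t: "evenperm (lift (transpose a c))" by simp
  have "permutation (lift p)" "permutation (lift (transpose a c))"
    using lift_permutes[OF swap(4)] lift_permutes[OF permutes_swap_id[OF swap(1,2)]] permutation_permutes finite_atLeastAtMost by blast+
  then have "evenperm (lift (transpose a c) \<circ> lift p)" using t swap(5) by (simp only: evenperm_comp)
  then show ?case unfolding lift_comp[OF swap(4)] .
qed

lemma lift_eq: "g permutes {1..K} \<Longrightarrow> h permutes {1..K} \<Longrightarrow> lift g = lift h \<Longrightarrow> g = h"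
proof
  fix y assume gh: "g permutes {1..K}" "h permutes {1..K}" and "lift g = lift h"
  then have "lift g y = lift h y" by simp
  moreover have "g y = y" "h y = y" if "\<not> y \<le> K" using that gh by (auto simp: permutes_def)
  ultimately show "g y = h y" by (cases "y \<le> K") (auto simp: lift_def)
qed

lemma gen_e_plain:
  assumes "A \<subseteq> {..<q}" shows "gen (e ` A) = lift ` H A"
proof
  show "gen (e ` A) \<subseteq> lift ` H A"
  proof
    fix g assume "g \<in> gen (e ` A)"
    then show "g \<in> lift ` H A"
    proof (induction rule: gen.induct)
      case gen_id
      show ?case using lift_id gen.gen_id[of "f ` A"] by (metis imageI)
    next
      case (gen_step t g)
      then obtain i h where i: "i \<in> A" "t = lift (f i)" and h: "h \<in> H A" "g = lift h"
        using assms by (auto simp: e_def)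
      have "t \<circ> g = lift (f i \<circ> h)" unfolding i h using lift_comp[OF H_f_permutes[OF assms h(1)]] by simp
      moreover have "f i \<circ> h \<in> H A" using i h by (intro gen.gen_step) auto
      ultimately show ?case by blast
    qed
  qed
  show "lift ` H A \<subseteq> gen (e ` A)"
  proof (rule image_subsetI)
    fix h assume "h \<in> H A"
    then show "lift h \<in> gen (e ` A)"
    proof (induction rule: gen.induct)
      case gen_id
      show ?case unfolding lift_id by (rule gen.gen_id)
    next
      case (gen_step t h)
      then obtain i where i: "i \<in> A" "t = f i" by auto
      have "lift (t \<circ> h) = e i \<circ> lift h"
        using lift_comp[OF H_f_permutes[OF assms gen_step.hyps(2)]] i assms by (auto simp: e_def simp del: o_apply)
      moreover have "e i \<in> e ` A" using i(1) by simp
      ultimately show ?case using gen.gen_step gen_step.IH by metis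
    qed
  qed
qed

text \<open>On the pairs \<open>{y, par y}\<close> the generator \<open>sg\<close> acts trivially.
  Passing to these pairs is thus a projection to the path group that simply drops the last
  index.\<close>

lemma gen_e_vertical:
  assumes "g \<in> gen (e ` A)"
  shows "\<exists>h\<in>H (A \<inter> {..<q}). \<forall>y. g y = lift h y \<or> g y = par (lift h y)"
  using assms
proof (induction rule: gen.induct)
  case gen_id
  show ?case using gen.gen_id[of "f ` (A \<inter> {..<q})"] by (intro bexI[of _ id]) (simp_all only: lift_id, blast)
next
  case (gen_step t g)
  then obtain h where h: "h \<in> H (A \<inter> {..<q})" "\<And>y. g y = lift h y \<or> g y = par (lift h y)" by blast
  have hp: "h permutes {1..K}" using H_f_permutes[OF _ h(1)] by blast
  obtain i where i: "i \<in> A" "t = e i" using gen_step by blast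
  show ?case
  proof (cases "i < q")
    case True
    then have t: "t = lift (f i)" using i by (simp add: e_def)
    have "(t \<circ> g) y = lift (f i \<circ> h) y \<or> (t \<circ> g) y = par (lift (f i \<circ> h) y)" for y
    proof -
      have "lift (f i) (par z) = par (lift (f i) z)" for z using lift_par[OF f_permutes[OF True]] by (metis o_apply)
      then show ?thesis unfolding t lift_comp[OF hp] o_apply using h(2)[of y] by auto
    qed
    moreover have "f i \<circ> h \<in> H (A \<inter> {..<q})" using True i h by (intro gen.gen_step) auto
    ultimately show ?thesis by blast
  next
    case False
    then have "t = sg" using i by (simp add: e_def)
    then have "(t \<circ> g) y = lift h y \<or> (t \<circ> g) y = par (lift h y)" for y
      using h(2)[of y] par_invol by (auto simp: sg_apply)
    then show ?thesis using h(1) by blast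
  qed
qed

lemma gen_e_par: "g \<in> gen (e ` A) \<Longrightarrow> g \<circ> par = par \<circ> g"
  by (rule gen_commute[of "e ` A"]) (auto simp: e_def lift_par[OF f_permutes] sg_par simp del: o_apply)

lemma e_invol: "i < q + 1 \<Longrightarrow> e i \<circ> e i = id"
proof (cases "i < q")
  case True
  then show ?thesis using lift_comp[OF f_permutes[OF True], of "f i"] f_invol[of i] lift_id by (simp add: e_def del: o_apply)
qed (simp add: e_def sg_invol del: o_apply)

lemma e_string: "string_involutions (q + 1) e"
proof
  show "e i \<circ> e i = id" if "i < q + 1" for i using e_invol[OF that] .
  show "e i \<circ> e j = e j \<circ> e i" if "i + 2 \<le> j" "j < q + 1" for i j
  proof (cases "j < q")
    case True
    then have "i < q" using that by simp
    then show ?thesis using far_commute[OF that(1) True] lift_comp[OF f_permutes[OF True], of "f i"]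
        lift_comp[OF f_permutes[OF \<open>i < q\<close>], of "f j"] True by (simp add: e_def del: o_apply)
  next
    case False
    then have j: "j = q" "i \<le> q - 2" "i < q" using that by auto
    have fq: "f i (q + 1) = q + 1 \<and> f i (q + 2) = q + 2 \<or> f i (q + 1) = q + 2 \<and> f i (q + 2) = q + 1"
    proof (cases "i + 2 < q")
      case True
      then show ?thesis using f_small[OF True] by auto
    next
      case False
      then have i: "i = q - 2" using j by simp
      have c2: "cnt (q - 2) \<ge> 2" using K_ge q2 by (auto simp: cnt_def)
      have "f i (q + 1) = q + 2" using w_apply[of "q + 1"] c2 unfolding i w_def swaps_apply by auto
      moreover then have "f i (q + 2) = q + 1" using f_invol[of i] by (metis pointfree_idE)
      ultimately show ?thesis by blast
    qed
    let ?S = "{q + 1, q + 2, K + (q + 1), K + (q + 2)}"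
    have m: "lift (f i) z \<in> ?S" if "z \<in> ?S" for z
    proof -
      have "lift (f i) (q + 1) = f i (q + 1)" "lift (f i) (q + 2) = f i (q + 2)"
        "lift (f i) (K + (q + 1)) = K + f i (q + 1)" "lift (f i) (K + (q + 2)) = K + f i (q + 2)"
        using K_ge q2 by (simp_all add: lift_def)
      then show ?thesis using that fq by (elim insertE emptyE) (simp_all, presburger+)
    qed
    have "lift (f i) (lift (f i) z) = z" for z
      using e_invol[of i] j(3) pointfree_idE[of "lift (f i)" "lift (f i)" z] by (simp add: e_def del: o_apply)
    then have m2: "lift (f i) y \<in> ?S \<longleftrightarrow> y \<in> ?S" for y using m by metis
    have "e i \<circ> sg = sg \<circ> e i"
    proof
      fix y
      have "lift (f i) (par y) = par (lift (f i) y)" using lift_par[OF f_permutes[OF j(3)]] by (metis o_apply)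
      then show "(e i \<circ> sg) y = (sg \<circ> e i) y" using m2[of y] j(3) by (simp add: sg_apply e_def)
    qed
    then show ?thesis using j by (simp add: e_def del: o_apply)
  qed
qed

text \<open>The new case is \<open>j = q\<close>. There \<open>g\<close> is a lift on one side, and
  its projection to pairs belongs to the inner interval by the other. A lift is determined by its
  projection, which gives the claim.\<close>

lemma e_ip: "interval_ip (q + 1) e"
  unfolding interval_ip_def
proof (intro allI impI subsetI)
  fix i j g assume ij: "i < j" "j < q + 1" and g: "g \<in> gen (e ` {i..<j}) \<inter> gen (e ` {i<..j})"
  have s: "{i..<j} \<subseteq> {..<q}" "{i<..<j} \<subseteq> {..<q}" using ij by auto
  obtain h where h: "h \<in> H {i..<j}" "g = lift h" using g gen_e_plain[OF s(1)] by blast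
  have hp: "h permutes {1..K}" by (rule H_f_permutes[OF s(1) h(1)])
  show "g \<in> gen (e ` {i<..<j})"
  proof (cases "j < q")
    case True
    then have s2: "{i<..j} \<subseteq> {..<q}" by auto
    obtain h' where h': "h' \<in> H {i<..j}" "g = lift h'" using g gen_e_plain[OF s2] by blast
    have "h = h'" using lift_eq[OF hp H_f_permutes[OF s2 h'(1)]] h(2) h'(2) by simp
    then have "h \<in> H {i<..<j}" using f_ip ij True h(1) h'(1) unfolding interval_ip_def by blast
    then show ?thesis unfolding gen_e_plain[OF s(2)] h(2) by blast
  next
    case False
    then have "{i<..j} \<inter> {..<q} = {i<..<j}" using ij by auto
    then obtain h' where h': "h' \<in> H {i<..<j}" "\<And>y. g y = lift h' y \<or> g y = par (lift h' y)"
      using gen_e_vertical[of g "{i<..j}"] g by auto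
    have h'p: "h' permutes {1..K}" by (rule H_f_permutes[OF s(2) h'(1)])
    have "h = h'"
    proof
      fix y
      show "h y = h' y"
      proof (cases "y \<in> {1..K}")
        case True
        then have "h y \<in> {1..K}" "h' y \<in> {1..K}" using permutes_in_image[OF hp] permutes_in_image[OF h'p] by blast+
        then show ?thesis using h'(2)[of y] h(2) True by (auto simp: lift_def par_def)
      qed (use hp h'p in \<open>auto simp: permutes_def\<close>)
    qed
    then show ?thesis unfolding gen_e_plain[OF s(2)] h(2) using h'(1) by blast
  qed
qed

lemma e_start: "i < q \<Longrightarrow> e i (i + 1) = i + 2"
  using f_start[of i] K_ge by (simp add: e_def lift_def)

lemma f_edge:
  assumes "1 \<le> t" "t < K" obtains i where "i < q" "f i t = t + 1"
proof -
  consider "t \<le> q" | "t > q" "even (t - q)" | "t > q" "odd (t - q)" by linarith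
  then show ?thesis
  proof cases
    case 1
    then show ?thesis using that[of "t - 1"] f_start[of "t - 1"] assms by simp
  next
    case 2
    have "t < q + 2 * cnt (q - 1)" using 2 q2 assms(2) by (simp add: cnt_def)
    then have "f (q - 1) t = t + 1" using 2 q2 by (simp add: f_apply)
    then show ?thesis using that[of "q - 1"] q2 by simp
  next
    case 3
    have "even (t - (q - 1))" using 3 q2 by presburger
    moreover have "q - 2 + 1 = q - 1" using q2 by simp
    moreover have "cnt (q - 2) = (K - q + 2) div 2" using q2 by (auto simp: cnt_def)
    then have "t < q - 1 + 2 * cnt (q - 2)" using 3 q2 assms(2) by presburger
    ultimately have "f (q - 2) t = t + 1" using 3 by (simp only: f_apply) simp
    then show ?thesis using that[of "q - 2"] q2 by simp
  qed
qed

lemma e_transitive: "{1..2 * K} \<subseteq> orbit_of (gen (e ` {..<q + 1})) 1"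
proof -
  let ?G = "gen (e ` {..<q + 1})"
  let ?O = "orbit_of ?G 1"
  have inv: "t \<circ> t = id" if "t \<in> e ` {..<q + 1}" for t using that e_invol by auto
  have closed: "g y \<in> ?O" if "g \<in> ?G" "y \<in> ?O" for g y
  proof -
    from that(2) obtain h where h: "h \<in> ?G" "y = h 1" unfolding orbit_of_def by blast
    have "g \<circ> h \<in> ?G" using that(1) h(1) by (rule gen_comp)
    then show ?thesis unfolding orbit_of_def h(2) by (metis imageI o_apply)
  qed
  have a: "t \<in> ?O" if "1 \<le> t" "t \<le> K" for t
    using that
  proof (induction t rule: nat_induct_at_least)
    case base
    have "id 1 \<in> (\<lambda>g. g 1) ` ?G" by (rule imageI) (rule gen_id)
    then show ?case by (simp add: orbit_of_def)
  next
    case (Suc t)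
    then obtain i where i: "i < q" "f i t = t + 1" using f_edge[of t] by auto
    have "e i \<in> ?G" using i by (intro gen_base) auto
    then have "e i t \<in> ?O" using closed Suc by simp
    then show ?case using i Suc by (simp add: e_def lift_def)
  qed
  have qK: "1 \<le> q + 1" "q + 1 \<le> K" using K_ge by auto
  obtain h where h: "h \<in> ?G" "h 1 = q + 1" using a[OF qK] unfolding orbit_of_def by (metis imageE)
  have sG: "sg \<in> ?G" by (intro gen_base image_eqI[of _ _ q]) (auto simp: e_def)
  have par: "g (par y) = par (g y)" if "g \<in> ?G" for g y using gen_e_par[OF that] by (metis o_apply)
  \<comment> \<open>To change copies, walk from 1 to \<open>q + 1\<close> by \<open>h\<close>, cross
    by \<open>sg\<close>, and walk back. Since \<open>h\<close> commutes with \<open>par\<close>,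
    the walk ends at \<open>par 1\<close>.\<close>
  have "sg (q + 1) \<in> ?O" using closed[OF sG a[OF qK]] .
  then have "h (par 1) \<in> ?O" using par[OF h(1), of 1] h(2) by (simp add: sg_apply)
  then have "inv' h (h (par 1)) \<in> ?O" using closed[OF gen_inv[OF inv h(1)]] by blast
  then have p1: "par 1 \<in> ?O" using gen_bij[OF inv h(1)] by (simp add: bij_is_inj)
  have c: "par y \<in> ?O" if "y \<in> ?O" for y
  proof -
    from that obtain g where g: "g \<in> ?G" "y = g 1" unfolding orbit_of_def by blast
    then show ?thesis using closed[OF g(1) p1] par[OF g(1)] by simp
  qed
  show ?thesis
  proof
    fix y assume y: "y \<in> {1..2 * K}"
    show "y \<in> ?O"
    proof (cases "y \<le> K")
      case False
      then have "par (y - K) = y" "y - K \<in> ?O" using y a by (auto simp: par_def)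
      then show ?thesis using c by metis
    qed (use y a in simp)
  qed
qed

sublocale E: glue_base "2 * K" "q + 1" e 1
proof (intro glue_base.intro e_string, unfold_locales)
  have sgp: "sg permutes {1..2 * K}" unfolding sg_def using K_ge q2
    by (intro permutes_compose permutes_swap_id) auto
  have "evenperm sg" unfolding sg_def
    using evenperm_comp[OF permutation_swap_id permutation_swap_id, of "q + 1" "K + (q + 1)" "q + 2" "K + (q + 2)"] K_ge
    by (simp only: evenperm_swap) simp
  then show "e i \<in> Alt {1..2 * K}" if "i < q + 1" for i
    using that sgp lift_permutes[OF f_permutes] evenperm_lift[OF f_permutes] by (auto simp: e_def Alt_def)
  show "interval_ip (q + 1) e" by (rule e_ip)
  show "1 \<in> {1..2 * K}" using K_ge by auto
  show "e 0 1 \<noteq> 1" using e_start[of 0] q2 by simp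
  show "e i 1 = 1" if "1 \<le> i" "i < q + 1" for i
    using that f_fix[of 1 i] K_ge q2 by (auto simp: e_def lift_def sg_apply)
  show "e i \<noteq> id" if "i < q + 1" for i
  proof (cases "i < q")
    case True
    then show ?thesis using e_start[OF True] by auto
  next
    case False
    then have "e i (q + 1) \<noteq> q + 1" using K_ge by (simp add: e_def sg_apply par_def)
    then show ?thesis by auto
  qed
  show "{1..2 * K} \<subseteq> orbit_of (gen (e ` {..<q + 1})) 1" by (rule e_transitive)
  show "gen (e ` {..<Suc j}) \<inter> Alt (orbit_of (gen (e ` {..<j})) 1) \<subseteq> gen (e ` {..<j})" if "1 \<le> j" "j < q + 1" for j
  proof
    fix a assume a: "a \<in> gen (e ` {..<Suc j}) \<inter> Alt (orbit_of (gen (e ` {..<j})) 1)"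
    have s: "{..<j} \<subseteq> {..<q}" using that by auto
    \<comment> \<open>As \<open>j \<le> q\<close>, the crossing \<open>sg\<close> is not among these
      generators, so the orbit stays in the first copy.\<close>
    have "orbit_of (gen (e ` {..<j})) 1 \<subseteq> {1..K}"
    proof
      fix y assume "y \<in> orbit_of (gen (e ` {..<j})) 1"
      then obtain h where h: "h \<in> H {..<j}" "y = lift h 1" unfolding gen_e_plain[OF s] orbit_of_def by auto
      have "h permutes {1..K}" by (rule H_f_permutes[OF s h(1)])
      then have "h 1 \<in> {1..K}" using permutes_in_image[of h "{1..K}" 1] K_ge by auto
      then show "y \<in> {1..K}" using h(2) K_ge by (auto simp: lift_def)
    qed
    then have ap: "a permutes {1..K}" using a permutes_subset by (auto simp: Alt_def)
    have "a y = y" for y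
    proof (cases "y \<in> {1..K}")
      case True
      then have "par y \<notin> {1..K}" by (auto simp: par_def)
      then have "a (par y) = par y" using ap by (simp add: permutes_def)
      then have "par (a y) = par y" using gen_e_par[of a "{..<Suc j}"] a by (metis IntD1 o_apply)
      then show ?thesis using par_invol by metis
    qed (use ap in \<open>simp add: permutes_def\<close>)
    then have "a = id" by auto
    then show "a \<in> gen (e ` {..<j})" by (simp only: gen_id)
  qed
qed auto

end

text \<open>Rank \<open>r\<close> splits into \<open>q = r - 3\<close> path labels, one crossing and
  two glued generators; degree \<open>n\<close> into two copies of \<open>K = (n - 4) div 2\<close>
  points and four path vertices. Then \<open>q \<ge> 2\<close> means \<open>r \<ge> 5\<close>, and
  \<open>K \<ge> q + 2\<close> is the bound on \<open>n\<close>.\<close>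

theorem alt_string_even:
  assumes "5 \<le> r" "2 * r + 2 \<le> n" "even n"
  shows "\<exists>rho. alt_string n r rho"
proof -
  interpret path_group "r - 3" "(n - 4) div 2" by unfold_locales (use assms in auto)
  interpret gluing "2 * ((n - 4) div 2)" "r - 3 + 1" e 1 4 by unfold_locales auto
  have "2 * ((n - 4) div 2) + 4 = n" "r - 3 + 1 + 2 = r" using assms by auto
  then show ?thesis using glue_alt_string by metis
qed

text \<open>The same count with one more point and one more generator: \<open>q = r - 4\<close> and
  \<open>K = (n - 5) div 2\<close>, so that \<open>K \<ge> q + 2\<close> becomes
  \<open>n \<ge> 2 * r + 1\<close>.\<close>

theorem alt_string_odd:
  assumes "6 \<le> r" "2 * r + 1 \<le> n" "odd n"
  shows "\<exists>rho. alt_string n r rho"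
proof -
  interpret path_group "r - 4" "(n - 5) div 2" by unfold_locales (use assms in auto)
  interpret gluing4 "2 * ((n - 5) div 2)" "r - 4 + 1" e 1 by unfold_locales auto
  have "2 * ((n - 5) div 2) + 5 = n" "r - 4 + 1 + 3 = r" using assms by (auto elim!: oddE)
  then show ?thesis using extend_alt_string by metis
qed

section \<open>Permutations given by lists of transpositions\<close>

fun perm_of :: "(nat \<times> nat) list \<Rightarrow> nat \<Rightarrow> nat" where
  "perm_of [] y = y"
| "perm_of ((a, c) # ts) y = transpose a c (perm_of ts y)"

definition even_in :: "nat \<Rightarrow> (nat \<times> nat) list \<Rightarrow> bool" where
  "even_in N ts \<longleftrightarrow> even (length ts) \<and> (\<forall>(a, c)\<in>set ts. 1 \<le> a \<and> a < c \<and> c \<le> N)"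

lemma perm_of_Alt:
  assumes "even_in N ts" shows "perm_of ts \<in> Alt {1..N}"
proof -
  have "perm_of ts permutes {1..N} \<and> (evenperm (perm_of ts) \<longleftrightarrow> even (length ts))"
    if "\<forall>(a, c)\<in>set ts. 1 \<le> a \<and> a < c \<and> c \<le> N"
    using that
  proof (induction ts)
    case Nil
    have "perm_of [] = id" by (rule ext) simp
    then show ?case by (simp only: permutes_id evenperm_id list.size even_zero simp_thms)
  next
    case (Cons t ts)
    obtain a c where t: "t = (a, c)" "1 \<le> a" "a < c" "c \<le> N" using Cons.prems by (cases t) auto
    have IH: "perm_of ts permutes {1..N}" "evenperm (perm_of ts) \<longleftrightarrow> even (length ts)" using Cons by auto
    have eq: "perm_of (t # ts) = transpose a c \<circ> perm_of ts" by (rule ext) (simp add: t)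
    have "transpose a c permutes {1..N}" using t by (intro permutes_swap_id) auto
    then have "perm_of (t # ts) permutes {1..N}" unfolding eq by (rule permutes_compose[OF IH(1)])
    moreover have "permutation (perm_of ts)" using IH(1) finite_atLeastAtMost permutation_permutes by blast
    then have "evenperm (perm_of (t # ts)) \<longleftrightarrow> (evenperm (transpose a c) \<longleftrightarrow> evenperm (perm_of ts))"
      unfolding eq by (rule evenperm_comp[OF permutation_swap_id])
    ultimately show ?case using IH(2) t by (simp add: evenperm_swap del: perm_of.simps)
  qed
  then show ?thesis using assms by (simp add: Alt_def even_in_def)
qed

fun word :: "(nat \<times> nat) list list \<Rightarrow> nat list \<Rightarrow> nat \<Rightarrow> nat" where
  "word L [] y = y"
| "word L (i # w) y = perm_of (L ! i) (word L w y)"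

fun images :: "(nat \<times> nat) list list \<Rightarrow> nat list \<Rightarrow> nat list \<Rightarrow> nat list" where
  "images L [] ys = ys"
| "images L (i # w) ys = map (perm_of (L ! i)) (images L w ys)"

lemma images_eq: "images L w ys = map (word L w) ys"
  by (induction w) (simp_all add: map_idI)

text \<open>Comparing lists of values rather than quantifying over points keeps the simplifier from
  unfolding \<open>perm_of\<close> at a variable, which is exponential in the length of the word.\<close>

definition word_eq :: "nat \<Rightarrow> (nat \<times> nat) list list \<Rightarrow> nat list \<Rightarrow> nat list \<Rightarrow> bool" where
  "word_eq N L w w' \<longleftrightarrow> (\<forall>i\<in>set (w @ w'). i < length L) \<and> images L w [1..<Suc N] = images L w' [1..<Suc N]"

lemma set_points: "set [1..<Suc N] = {1..N}"
  by auto

lemma word_Nil: "word L [] = id" and word_Cons: "word L (i # w) = perm_of (L ! i) \<circ> word L w"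
  by (rule ext; simp)+

lemma word_append: "word L (w @ w') = word L w \<circ> word L w'"
  by (induction w) (simp_all only: append_Nil append_Cons word_Nil word_Cons id_comp comp_assoc)

lemma word_power: "word L (concat (replicate n w)) = word L w ^^ n"
  by (induction n) (simp_all only: replicate.simps concat.simps word_Nil word_append funpow.simps)

lemma word_mem_gen: "set w \<subseteq> A \<Longrightarrow> word L w \<in> gen ((\<lambda>i. perm_of (L ! i)) ` A)"
proof (induction w)
  case (Cons i w)
  then show ?case unfolding word_Cons by (intro gen.gen_step) auto
qed (simp only: word_Nil gen_id)

lemma word_eqD:
  assumes "\<forall>ts\<in>set L. even_in N ts" "word_eq N L w w'" shows "word L w = word L w'"
proof -
  have points: "word L w y = word L w' y" if "y \<in> {1..N}" for y
    using assms(2) that unfolding word_eq_def images_eq map_eq_conv set_points by blast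
  have out: "word L v y = y" if "\<forall>i\<in>set v. i < length L" "y \<notin> {1..N}" for v y
    using that(1)
  proof (induction v)
    case (Cons i v)
    then have "perm_of (L ! i) permutes {1..N}" using perm_of_Alt[of N "L ! i"] assms(1) by (simp add: Alt_def)
    then show ?case using Cons that(2) by (simp add: permutes_def)
  qed simp
  show ?thesis
  proof
    fix y show "word L w y = word L w' y"
    proof (cases "y \<in> {1..N}")
      case True
      then show ?thesis by (rule points)
    qed (use assms(2) out[of w y] out[of w' y] in \<open>auto simp: word_eq_def\<close>)
  qed
qed

lemma word1: "word L [i] = perm_of (L ! i)" "word L [i, j] = perm_of (L ! i) \<circ> perm_of (L ! j)"
  by (rule ext; simp)+

lemma gen_invariant:
  assumes "\<And>s y. s \<in> S \<Longrightarrow> f (s y) = f y" "g \<in> gen S" shows "f (g y) = f y"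
  using assms(2) by (induction rule: gen.induct) (auto simp: assms(1))

lemma orbit_of_subset:
  assumes "x \<in> C" "\<And>s y. s \<in> S \<Longrightarrow> y \<in> C \<Longrightarrow> s y \<in> C" shows "orbit_of (gen S) x \<subseteq> C"
proof -
  have "g x \<in> C" if "g \<in> gen S" for g using that by (induction rule: gen.induct) (auto simp: assms)
  then show ?thesis by (auto simp: orbit_of_def)
qed

text \<open>The blocks \<open>g ` D\<close> and \<open>D\<close> agree outside \<open>C\<close>, hence coincide.\<close>

lemma invariant_blocks_id:
  assumes "\<And>s D. s \<in> S \<Longrightarrow> D \<in> F \<Longrightarrow> s ` D \<in> F" "g \<in> gen S" "g permutes C"
    and trace: "\<And>D D'. D \<in> F \<Longrightarrow> D' \<in> F \<Longrightarrow> D - C = D' - C \<Longrightarrow> D = D'"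
    and sep: "\<And>y z. y \<in> C \<Longrightarrow> z \<in> C \<Longrightarrow> (\<And>D. D \<in> F \<Longrightarrow> y \<in> D \<longleftrightarrow> z \<in> D) \<Longrightarrow> y = z"
  shows "g = id"
proof -
  have img: "g ` D \<in> F" if "D \<in> F" for D
    using assms(2)
  proof (induction rule: gen.induct)
    case (gen_step s g)
    show ?case using assms(1)[OF gen_step.hyps(1) gen_step.IH] by (simp only: image_comp)
  qed (use that in simp)
  have fx: "g ` D = D" if "D \<in> F" for D
  proof (rule trace[OF img[OF that] that])
    have "g y = y" if "y \<notin> C" for y using that assms(3) by (simp add: permutes_def)
    moreover have "g y \<in> C" if "y \<in> C" for y using that permutes_in_image[OF assms(3)] by blast
    ultimately show "g ` D - C = D - C" by (auto simp: image_iff) metis+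
  qed
  have "g y = y" for y
  proof (cases "y \<in> C")
    case True
    have "g y \<in> D \<longleftrightarrow> y \<in> D" if "D \<in> F" for D
      using fx[OF that] permutes_inj[OF assms(3)] by (metis inj_image_mem_iff)
    then show ?thesis using sep[of "g y" y] True permutes_in_image[OF assms(3)] by blast
  qed (use assms(3) in \<open>simp add: permutes_def\<close>)
  then show ?thesis by auto
qed

text \<open>\<open>f\<close> labels points by unions of orbits of the second group. A power of the
  first product that changes some label cannot belong to that group, which leaves
  \<open>l - 1\<close> finite tests.\<close>

lemma dihedral_inter_invariant:
  assumes L: "\<forall>ts\<in>set L. even_in N ts" and eqs: "word_eq N L [i, i] []" "word_eq N L [j, j] []"
    "word_eq N L (concat (replicate l [i, j])) []"
    and f: "\<forall>m\<in>{j, k}. map f (images L [m] [1..<Suc N]) = map f [1..<Suc N]"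
    and len: "j < length L" "k < length L" "0 < l"
    and moved: "\<forall>n\<in>set [1..<l]. map f (images L (concat (replicate n [i, j])) [1..<Suc N]) \<noteq> map f [1..<Suc N]"
  shows "gen {perm_of (L ! i), perm_of (L ! j)} \<inter> gen {perm_of (L ! j), perm_of (L ! k)} \<subseteq> gen {perm_of (L ! j)}"
proof (rule dihedral_inter)
  show "perm_of (L ! i) \<circ> perm_of (L ! i) = id" "perm_of (L ! j) \<circ> perm_of (L ! j) = id"
    using word_eqD[OF L eqs(1)] word_eqD[OF L eqs(2)] by (simp_all only: word1 word_Nil)
  show "(perm_of (L ! i) \<circ> perm_of (L ! j)) ^^ l = id"
    using word_eqD[OF L eqs(3)] by (simp only: word_power word1 word_Nil)
  show "(perm_of (L ! i) \<circ> perm_of (L ! j)) ^^ n \<notin> gen {perm_of (L ! j), perm_of (L ! k)}" if n: "0 < n" "n < l" for n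
  proof
    assume a: "(perm_of (L ! i) \<circ> perm_of (L ! j)) ^^ n \<in> gen {perm_of (L ! j), perm_of (L ! k)}"
    have sinv: "f (s y) = f y" if "s \<in> {perm_of (L ! j), perm_of (L ! k)}" for s y
    proof -
      obtain m where m: "m \<in> {j, k}" "s = perm_of (L ! m)" using \<open>s \<in> _\<close> by blast
      then have p: "s permutes {1..N}" using len perm_of_Alt[of N "L ! m"] L by (auto simp: Alt_def)
      show ?thesis
      proof (cases "y \<in> {1..N}")
        case True
        moreover have "map f (images L [m] [1..<Suc N]) = map f [1..<Suc N]" using f m(1) by blast
        ultimately show ?thesis
          unfolding images_eq map_map map_eq_conv set_points word1 m(2) by (simp del: perm_of.simps)
      qed (use p in \<open>simp add: permutes_def\<close>)
    qed
    have "f (word L (concat (replicate n [i, j])) y) = f y" for y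
      unfolding word_power word1 using sinv a by (rule gen_invariant)
    then have "map f (images L (concat (replicate n [i, j])) [1..<Suc N]) = map f [1..<Suc N]"
      unfolding images_eq map_map map_eq_conv by simp
    moreover have "n \<in> set [1..<l]" using n by simp
    ultimately show False using moved by blast
  qed
qed (use len in \<open>auto intro: gen_base\<close>)

text \<open>The executable share of \<open>glue_base\<close> for ranks 2 and 3. The last clause
  yields transitivity by induction: each point beyond 1 is the image of a smaller one under a
  generator.\<close>

definition base_check :: "nat \<Rightarrow> (nat \<times> nat) list list \<Rightarrow> bool" where
  "base_check N L \<longleftrightarrow> 1 \<le> N \<and> length L \<in> {2, 3} \<and> (\<forall>ts\<in>set L. even_in N ts)
    \<and> (\<forall>i\<in>set [0..<length L]. word_eq N L [i, i] [] \<and> (\<exists>y\<in>set [1..<Suc N]. perm_of (L ! i) y \<noteq> y))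
    \<and> (length L = 3 \<longrightarrow> word_eq N L [0, 2] [2, 0])
    \<and> perm_of (L ! 0) 1 \<noteq> 1 \<and> (\<forall>i\<in>set [1..<length L]. perm_of (L ! i) 1 = 1)
    \<and> (length L = 3 \<longrightarrow> (\<exists>y\<in>set [1..<Suc N]. perm_of (L ! 1) y \<noteq> perm_of (L ! 2) y))
    \<and> (\<forall>v\<in>set [2..<Suc N]. \<exists>u\<in>set [1..<v]. \<exists>i\<in>set [0..<length L]. perm_of (L ! i) u = v)"

text \<open>At such small rank only one interval pair and one instance of \<open>star\<close> are
  not immediate. For \<open>j = 1\<close> the orbit is \<open>{1, b 0 1}\<close>, which has no
  nontrivial even permutation.\<close>

lemma glue_base_perm_of:
  fixes L :: "(nat \<times> nat) list list"
  defines "b \<equiv> \<lambda>i. perm_of (L ! i)"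
  assumes chk: "base_check N L"
    and ip: "length L = 3 \<Longrightarrow> gen {b 0, b 1} \<inter> gen {b 1, b 2} \<subseteq> gen {b 1}"
    and star: "length L = 3 \<Longrightarrow> gen {b 0, b 1, b 2} \<inter> Alt (orbit_of (gen {b 0, b 1}) 1) \<subseteq> gen {b 0, b 1}"
  shows "glue_base N (length L) b 1"
proof -
  have L: "\<forall>ts\<in>set L. even_in N ts" and k: "length L = 2 \<or> length L = 3" using chk by (auto simp: base_check_def)
  have inv: "b i \<circ> b i = id" if "i < length L" for i
  proof -
    have "word_eq N L [i, i] []" using chk that by (simp add: base_check_def)
    from word_eqD[OF L this] show ?thesis by (simp only: word1 word_Nil b_def)
  qed
  have b0: "b 0 1 \<noteq> 1" and bx: "\<And>i. 1 \<le> i \<Longrightarrow> i < length L \<Longrightarrow> b i 1 = 1"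
    using chk by (auto simp: base_check_def b_def)
  have ne: "b i \<noteq> id" if "i < length L" for i
  proof -
    have "i \<in> set [0..<length L]" using that by simp
    then have "\<exists>y. b i y \<noteq> y" using chk unfolding base_check_def b_def by blast
    then show ?thesis by auto
  qed
  have b12: "b 1 \<noteq> b 2" if "length L = 3" proof
    assume "b 1 = b 2"
    then show False using chk that unfolding base_check_def b_def by metis
  qed
  have single: "gen {b i} = {id, b i}" if "i < length L" for i using gen_singleton[OF inv[OF that]] .
  have i01: "gen {b 0} \<inter> gen {b 1} \<subseteq> {id}"
  proof -
    have "b 0 \<noteq> b 1" using b0 bx[of 1] k by force
    moreover have "gen {b 0} = {id, b 0}" "gen {b 1} = {id, b 1}" by (rule single; use k in force)+
    ultimately show ?thesis by blast
  qed
  have i12: "gen {b 1} \<inter> gen {b 2} \<subseteq> {id}" if "length L = 3"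
  proof -
    have "gen {b 1} = {id, b 1}" "gen {b 2} = {id, b 2}" by (rule single; use that in force)+
    then show ?thesis using b12[OF that] by blast
  qed
  interpret string_involutions "length L" b
  proof
    show "b i \<circ> b i = id" if "i < length L" for i using inv[OF that] .
    fix i j assume ij: "i + 2 \<le> j" "j < length L"
    then have *: "length L = 3" "i = 0" "j = 2" using k by auto
    then have "word_eq N L [0, 2] [2, 0]" using chk by (simp add: base_check_def)
    from word_eqD[OF L this] show "b i \<circ> b j = b j \<circ> b i" unfolding * by (simp only: word1 b_def)
  qed
  show ?thesis
  proof
    show "b i \<in> Alt {1..N}" if "i < length L" for i using that L perm_of_Alt[of N "L ! i"] by (simp add: b_def)
    show "interval_ip (length L) b" unfolding interval_ip_def
    proof (intro allI impI)
      fix i j assume ij: "i < j" "j < length L"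
      then consider "i = 0" "j = 1" | "i = 1" "j = 2" "length L = 3" | "i = 0" "j = 2" "length L = 3" using k by force
      then show "gen (b ` {i..<j}) \<inter> gen (b ` {i<..j}) \<subseteq> gen (b ` {i<..<j})"
      proof cases
        case 1
        moreover have "{0..<1::nat} = {0}" "{0<..1::nat} = {1}" "{0<..<1::nat} = {}" by auto
        ultimately show ?thesis using i01 by simp
      next
        case 2
        moreover have "{1..<2::nat} = {1}" "{1<..2::nat} = {2}" "{1<..<2::nat} = {}" by auto
        ultimately show ?thesis using i12 by simp
      next
        case 3
        moreover have "{0..<2::nat} = {0, 1}" "{0<..2::nat} = {1, 2}" "{0<..<2::nat} = {1}" by auto
        ultimately show ?thesis using ip by simp
      qed
    qed
    show "1 \<in> {1..N}" using chk by (simp add: base_check_def)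
    show "0 < length L" using k by auto
    show "b 0 1 \<noteq> 1" by (rule b0)
    show "b i 1 = 1" if "1 \<le> i" "i < length L" for i using bx that .
    show "b i \<noteq> id" if "i < length L" for i using ne[OF that] .
    let ?G = "gen (b ` {..<length L})"
    have "v \<in> orbit_of ?G 1" if "v \<in> {1..N}" for v
      using that
    proof (induction v rule: less_induct)
      case (less v)
      show ?case
      proof (cases "v = 1")
        case True
        have "id 1 \<in> (\<lambda>g. g 1) ` ?G" by (rule imageI) (rule gen_id)
        then show ?thesis using True by (simp add: orbit_of_def)
      next
        case False
        then have "v \<in> set [2..<Suc N]" using less.prems by (simp add: less_Suc_eq_le del: upt_Suc)
        then have "\<exists>u\<in>set [1..<v]. \<exists>i\<in>set [0..<length L]. perm_of (L ! i) u = v"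
          using chk unfolding base_check_def by blast
        then obtain u i where ui: "1 \<le> u" "u < v" "i < length L" "b i u = v" by (auto simp: b_def)
        then have "u \<in> orbit_of ?G 1" using less by simp
        then obtain g where g: "g \<in> ?G" "u = g 1" unfolding orbit_of_def by blast
        have "b i \<circ> g \<in> ?G" using ui(3) g(1) by (intro gen.gen_step) auto
        then have "(b i \<circ> g) 1 \<in> orbit_of ?G 1" unfolding orbit_of_def by (rule imageI)
        then show ?thesis using ui(4) g(2) by simp
      qed
    qed
    then show "{1..N} \<subseteq> orbit_of ?G 1" by blast
    show "gen (b ` {..<Suc j}) \<inter> Alt (orbit_of (gen (b ` {..<j})) 1) \<subseteq> gen (b ` {..<j})" if j: "1 \<le> j" "j < length L" for j
    proof (cases "j = 1")
      case True
      have "b ` {..<1} = {b 0}" "0 < length L" using k by auto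
      then have "gen (b ` {..<1}) = {id, b 0}" using single[of 0] by (simp only:)
      then have o: "orbit_of (gen (b ` {..<1})) 1 = {1, b 0 1}" by (auto simp: orbit_of_def)
      have "a = id" if "a \<in> Alt {1, b 0 1}" for a
      proof -
        have "a = id \<or> a = transpose 1 (b 0 1)" using that by (simp add: Alt_def permutes_doubleton_iff)
        moreover have "\<not> evenperm (transpose 1 (b 0 1))" using b0 evenperm_swap[of 1 "b 0 1"] by metis
        ultimately show ?thesis using that by (auto simp: Alt_def)
      qed
      then show ?thesis using True o gen_id by auto
    next
      case False
      then have "j = 2" "length L = 3" using j k by auto
      moreover have "{..<Suc 2} = {0, 1, 2::nat}" "{..<2} = {0, 1::nat}" by auto
      ultimately show ?thesis using star by simp
    qed
  qed
qed

text \<open>The points in \<open>C\<close> are to contain the orbit of 1 under the first two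
  generators. Blocks are kept as sorted lists so that invariance of the family is plain list
  membership after sorting.\<close>

definition block_check :: "(nat \<times> nat) list list \<Rightarrow> nat list \<Rightarrow> nat list list \<Rightarrow> bool" where
  "block_check L C F \<longleftrightarrow> 1 \<in> set C \<and> (\<forall>i\<in>{0, 1}. \<forall>y\<in>set C. perm_of (L ! i) y \<in> set C)
    \<and> (\<forall>i\<in>{0, 1, 2}. \<forall>D\<in>set F. sort (map (perm_of (L ! i)) D) \<in> set F)
    \<and> (\<forall>D\<in>set F. \<forall>D'\<in>set F. D = D' \<or> (\<exists>y\<in>set (D @ D'). y \<notin> set C \<and> (y \<in> set D) \<noteq> (y \<in> set D')))
    \<and> (\<forall>y\<in>set C. \<forall>z\<in>set C. y = z \<or> (\<exists>D\<in>set F. (y \<in> set D) \<noteq> (z \<in> set D)))"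

lemma star_of_blocks:
  fixes L :: "(nat \<times> nat) list list"
  defines "b \<equiv> \<lambda>i. perm_of (L ! i)"
  assumes "block_check L C F"
  shows "gen {b 0, b 1, b 2} \<inter> Alt (orbit_of (gen {b 0, b 1}) 1) \<subseteq> gen {b 0, b 1}"
proof
  fix g assume g: "g \<in> gen {b 0, b 1, b 2} \<inter> Alt (orbit_of (gen {b 0, b 1}) 1)"
  have "s y \<in> set C" if "s \<in> {b 0, b 1}" "y \<in> set C" for s y
    using assms that unfolding block_check_def by blast
  then have "orbit_of (gen {b 0, b 1}) 1 \<subseteq> set C"
    using assms by (intro orbit_of_subset) (auto simp: block_check_def)
  then have gC: "g permutes set C" using g permutes_subset by (auto simp: Alt_def)
  have "g = id"
  proof (rule invariant_blocks_id[of "{b 0, b 1, b 2}" "set ` set F" g "set C"])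
    fix s D assume "s \<in> {b 0, b 1, b 2}" "D \<in> set ` set F"
    then obtain i E where iE: "i \<in> {0, 1, 2}" "s = perm_of (L ! i)" "E \<in> set F" "D = set E" unfolding b_def by blast
    then have "sort (map s E) \<in> set F" using assms unfolding block_check_def by blast
    moreover have "s ` D = set (sort (map s E))" using iE(4) by simp
    ultimately show "s ` D \<in> set ` set F" by blast
  next
    fix D D' assume "D \<in> set ` set F" "D' \<in> set ` set F" and eq: "D - set C = D' - set C"
    then obtain E E' where E: "E \<in> set F" "D = set E" "E' \<in> set F" "D' = set E'" by blast
    then have "E = E' \<or> (\<exists>y. y \<notin> set C \<and> (y \<in> D) \<noteq> (y \<in> D'))" using assms unfolding block_check_def by blast
    then show "D = D'" using eq E by blast
  next
    fix y z assume "y \<in> set C" "z \<in> set C" and D: "\<And>D. D \<in> set ` set F \<Longrightarrow> y \<in> D \<longleftrightarrow> z \<in> D"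
    then have "y = z \<or> (\<exists>D\<in>set F. (y \<in> set D) \<noteq> (z \<in> set D))" using assms unfolding block_check_def by blast
    then show "y = z" using D by blast
  qed (use g gC in auto)
  then show "g \<in> gen {b 0, b 1}" by (simp only: gen_id)
qed

context gluing
begin

lemma glue_values: "glue 0 = alpha" "glue 1 = beta" "glue 2 = b 0" "glue 3 = b 1" "glue 4 = b 2"
  by (simp_all add: glue_def numeral_2_eq_2)

text \<open>In the glued sequence the product at positions 2 and 3 is
  \<open>b 0 \<circ> b 1\<close>, so its odd order makes rank reduction applicable.\<close>

lemma glue_reduce:
  assumes "2 \<le> k" "(b 0 \<circ> b 1) ^^ (2 * l + 1) = id"
  shows "alt_string (N + m) (k + 1) (reduce glue)"
proof (rule alt_string_reduce)
  show "alt_string (N + m) (Suc (k + 1)) glue" using glue_alt_string by simp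
  interpret G: string_involutions "k + 2" glue using glue_alt_string by (simp add: alt_string_def)
  show "3 \<le> k + 1" using assms(1) by simp
  show "glue 0 \<in> gen {glue 0 \<circ> glue 2, glue 3}"
  proof (rule mem_gen_of_odd_order)
    show "glue 0 \<circ> glue 0 = id" by (rule G.invol) simp
    show "glue 0 \<circ> glue 2 = glue 2 \<circ> glue 0" by (rule G.far_commute) (use assms(1) in simp_all)
    show "glue 0 \<circ> glue 3 = glue 3 \<circ> glue 0" by (rule G.far_commute) (use assms(1) in simp_all)
    show "(glue 2 \<circ> glue 3) ^^ (2 * l + 1) = id" unfolding glue_values by (rule assms(2))
  qed
  have x: "alpha x = x" "alpha p = p + 1" "beta x = p" "b 0 p = p" "b 0 x \<noteq> p" "beta (b 0 x) = b 0 x"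
  proof -
    show "alpha x = x" using x_p by (simp add: alpha_apply)
    show "alpha p = p + 1" using m_div by (simp add: alpha_apply P_def)
    show "beta x = p" by (simp add: beta_apply)
    show "b 0 p = p" using b_permutes[of 0] k_pos by (simp add: permutes_def)
    have "b 0 x \<in> {1..N}" using permutes_in_image[OF b_permutes[of 0]] k_pos x_mem by blast
    then show "b 0 x \<noteq> p" "beta (b 0 x) = b 0 x" using b0_x by (auto simp: beta_apply zeta_apply)
  qed
  show "glue 0 \<circ> glue 1 \<noteq> glue 1 \<circ> glue 0"
  proof
    assume "glue 0 \<circ> glue 1 = glue 1 \<circ> glue 0"
    then have "alpha (beta x) = beta (alpha x)" unfolding glue_values by (metis o_apply)
    then show False using x by simp
  qed
  show "glue 2 \<circ> glue 1 \<noteq> glue 1 \<circ> glue 2"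
  proof
    assume "glue 2 \<circ> glue 1 = glue 1 \<circ> glue 2"
    then have "b 0 (beta x) = beta (b 0 x)" unfolding glue_values by (metis o_apply)
    then show False using x by simp
  qed
qed

text \<open>After one reduction the sequence starts with
  \<open>beta, alpha \<circ> b 0, b 1, b 2\<close>. A second reduction asks for odd order of
  \<open>b 1 \<circ> b 2\<close>.\<close>

lemma glue_reduce_reduce:
  assumes "3 \<le> k" "(b 0 \<circ> b 1) ^^ (2 * l + 1) = id" "(b 1 \<circ> b 2) ^^ (2 * l' + 1) = id" "b 1 (b 0 x) \<noteq> b 0 x"
  shows "alt_string (N + m) k (reduce (reduce glue))"
proof (rule alt_string_reduce)
  have s: "reduce glue 0 = beta" "reduce glue 1 = alpha \<circ> b 0" "reduce glue 2 = b 1" "reduce glue 3 = b 2"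
    unfolding reduce_def by (simp_all add: glue_def numeral_2_eq_2 numeral_3_eq_3)
  show a: "alt_string (N + m) (Suc k) (reduce glue)" using glue_reduce[OF _ assms(2)] assms(1) by simp
  interpret G: string_involutions "Suc k" "reduce glue" using a by (simp add: alt_string_def)
  show "reduce glue 0 \<in> gen {reduce glue 0 \<circ> reduce glue 2, reduce glue 3}"
  proof (rule mem_gen_of_odd_order)
    show "reduce glue 0 \<circ> reduce glue 0 = id" by (rule G.invol) simp
    show "reduce glue 0 \<circ> reduce glue 2 = reduce glue 2 \<circ> reduce glue 0" by (rule G.far_commute) (use assms(1) in simp_all)
    show "reduce glue 0 \<circ> reduce glue 3 = reduce glue 3 \<circ> reduce glue 0" by (rule G.far_commute) (use assms(1) in simp_all)
    show "(reduce glue 2 \<circ> reduce glue 3) ^^ (2 * l' + 1) = id" unfolding s by (rule assms(3))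
  qed
  have big: "b i y = y" if "N < y" "i < k" for i y using b_permutes[OF that(2)] that(1) by (simp add: permutes_def)
  have b0x: "b 0 x \<in> {1..N}" using permutes_in_image[OF b_permutes[of 0]] k_pos x_mem by blast
  show "reduce glue 0 \<circ> reduce glue 1 \<noteq> reduce glue 1 \<circ> reduce glue 0"
  proof
    assume "reduce glue 0 \<circ> reduce glue 1 = reduce glue 1 \<circ> reduce glue 0"
    \<comment> \<open>The witness is the last path vertex: \<open>beta\<close> fixes it, while
      \<open>alpha\<close> moves it to a vertex that \<open>beta\<close> moves on.\<close>
    then have e: "beta (alpha (b 0 (N + m))) = alpha (b 0 (beta (N + m)))" unfolding s by (metis o_apply)
    have o: "odd (m - 1)" "even (m - 2)" using m_div by auto
    have "N + m \<noteq> x" "N + m - 1 \<noteq> x" using x_mem m_div(3) by auto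
    then have "alpha (N + m) = N + m - 1" "beta (N + m) = N + m" "beta (N + m - 1) = N + m - 2"
      using m_div(3) o by (auto simp: alpha_apply beta_apply zeta_apply P_def)
    moreover have "b 0 (N + m) = N + m" using big k_pos m_div(3) by simp
    ultimately have "N + m - 2 = N + m - 1" using e by simp
    then show False using m_div(3) by simp
  qed
  show "reduce glue 2 \<circ> reduce glue 1 \<noteq> reduce glue 1 \<circ> reduce glue 2"
  proof
    assume "reduce glue 2 \<circ> reduce glue 1 = reduce glue 1 \<circ> reduce glue 2"
    then have "b 1 (alpha (b 0 x)) = alpha (b 0 (b 1 x))" unfolding s by (metis o_apply)
    moreover have "alpha (b 0 x) = b 0 x" using b0x by (auto simp: alpha_apply P_def)
    ultimately show False using b_x[of 1] assms(1,4) by simp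
  qed
qed (rule assms(1))

end

section \<open>Five small groups\<close>

text \<open>Found by computer search. \<open>L6\<close> generates \<open>PSL(2,5)\<close> on the projective line, \<open>L11\<close> generates
  \<open>PSL(2,11)\<close> on the points of a biplane, and \<open>L12\<close> commutes with \<open>y \<mapsto> 13 - y\<close>.\<close>

abbreviation L5 :: "(nat \<times> nat) list list" where
  "L5 \<equiv> [[(1, 2), (3, 4)], [(2, 3), (4, 5)]]"

abbreviation L6 :: "(nat \<times> nat) list list" where
  "L6 \<equiv> [[(1, 2), (3, 4)], [(2, 3), (4, 5)], [(3, 4), (5, 6)]]"

abbreviation L9 :: "(nat \<times> nat) list list" where
  "L9 \<equiv> [[(1, 2), (5, 6)], [(2, 3), (4, 5), (6, 7), (8, 9)], [(3, 4), (7, 8)]]"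

abbreviation L11 :: "(nat \<times> nat) list list" where
  "L11 \<equiv> [[(1, 2), (3, 4), (5, 7), (9, 11)], [(2, 3), (4, 6), (5, 8), (7, 9)], [(3, 5), (4, 7), (8, 10), (9, 11)]]"

abbreviation L12 :: "(nat \<times> nat) list list" where
  "L12 \<equiv> [[(1, 2), (5, 6), (7, 8), (11, 12)], [(2, 3), (4, 5), (8, 9), (10, 11)], [(3, 4), (5, 7), (6, 8), (9, 10)]]"

lemma checks: "base_check 5 L5" "base_check 6 L6" "base_check 9 L9" "base_check 11 L11" "base_check 12 L12"
  by code_simp+

lemma even_in_of_check: "base_check N L \<Longrightarrow> \<forall>ts\<in>set L. even_in N ts"
  by (simp add: base_check_def)

lemma base5: "glue_base 5 2 (\<lambda>i. perm_of (L5 ! i)) 1"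
proof -
  have "length L5 = 2" by simp
  then show ?thesis using glue_base_perm_of[OF checks(1)] by (metis numeral_eq_iff semiring_norm(89))
qed

lemma ip6: "gen {perm_of (L6 ! 0), perm_of (L6 ! 1)} \<inter> gen {perm_of (L6 ! 1), perm_of (L6 ! 2)} \<subseteq> gen {perm_of (L6 ! 1)}"
  by (rule dihedral_inter_invariant[OF even_in_of_check[OF checks(2)], where l = 5 and f = "\<lambda>y. y = 1"]; code_simp)

text \<open>The labels separate the orbits \<open>{1}\<close>, \<open>{2, \<dots>, 5}\<close> and
  \<open>{6, \<dots>, 9}\<close> of the second and third generator.\<close>

lemma ip9: "gen {perm_of (L9 ! 0), perm_of (L9 ! 1)} \<inter> gen {perm_of (L9 ! 1), perm_of (L9 ! 2)} \<subseteq> gen {perm_of (L9 ! 1)}"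
  by (rule dihedral_inter_invariant[OF even_in_of_check[OF checks(3)], where l = 12 and f = "\<lambda>y. (y \<le> 1, y \<le> 5)"]; code_simp)

lemma ip11: "gen {perm_of (L11 ! 0), perm_of (L11 ! 1)} \<inter> gen {perm_of (L11 ! 1), perm_of (L11 ! 2)} \<subseteq> gen {perm_of (L11 ! 1)}"
  by (rule dihedral_inter_invariant[OF even_in_of_check[OF checks(4)], where l = 5 and f = "\<lambda>y. y = 1"]; code_simp)

lemma ip12: "gen {perm_of (L12 ! 0), perm_of (L12 ! 1)} \<inter> gen {perm_of (L12 ! 1), perm_of (L12 ! 2)} \<subseteq> gen {perm_of (L12 ! 1)}"
  by (rule dihedral_inter_invariant[OF even_in_of_check[OF checks(5)], where l = 3 and f = "\<lambda>y. y = 1"]; code_simp)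

text \<open>The short list is the orbit of 1 under the first two generators; the eleven others are
  the blocks of the biplane, each determined by its points outside that orbit.\<close>

lemma blocks11: "block_check L11 [1, 2, 3, 4, 6]
  [[1, 2, 3, 7, 9], [1, 2, 4, 5, 11], [1, 3, 6, 8, 11], [2, 4, 6, 8, 9], [1, 5, 6, 9, 10], [3, 4, 5, 6, 7],
   [2, 6, 7, 10, 11], [1, 4, 7, 8, 10], [3, 4, 9, 10, 11], [2, 3, 5, 8, 10], [5, 7, 8, 9, 11]]"
  by code_simp

lemma blocks12: "block_check L12 [1, 2, 3] [[1, 12], [2, 11], [3, 10], [4, 9], [5, 8], [6, 7]]"
  by code_simp


lemma base11: "glue_base 11 3 (\<lambda>i. perm_of (L11 ! i)) 1"
  using glue_base_perm_of[OF checks(4) ip11 star_of_blocks[OF blocks11]] by (simp add: numeral_3_eq_3 del: perm_of.simps)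

lemma base12: "glue_base 12 3 (\<lambda>i. perm_of (L12 ! i)) 1"
  using glue_base_perm_of[OF checks(5) ip12 star_of_blocks[OF blocks12]] by (simp add: numeral_3_eq_3 del: perm_of.simps)

text \<open>The orbit in question omits the point 6, so the claim is about the stabiliser of 6,
  found by coset enumeration in \<open>six_points\<close>.\<close>

lemma star6:
  "gen {perm_of (L6 ! 0), perm_of (L6 ! 1), perm_of (L6 ! 2)} \<inter> Alt (orbit_of (gen {perm_of (L6 ! 0), perm_of (L6 ! 1)}) 1)
    \<subseteq> gen {perm_of (L6 ! 0), perm_of (L6 ! 1)}"
proof
  let ?b = "transpose 1 2 \<circ> transpose 3 (4 :: nat)" and ?a = "transpose 2 3 \<circ> transpose 4 (5 :: nat)"
    and ?t = "transpose 3 4 \<circ> transpose 5 (6 :: nat)"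
  have e: "perm_of (L6 ! 0) = ?b" "perm_of (L6 ! 1) = ?a" "perm_of (L6 ! 2) = ?t"
    by (rule ext; simp)+
  fix g assume g: "g \<in> gen {perm_of (L6 ! 0), perm_of (L6 ! 1), perm_of (L6 ! 2)}
    \<inter> Alt (orbit_of (gen {perm_of (L6 ! 0), perm_of (L6 ! 1)}) 1)"
  have "\<forall>i\<in>{0, 1}. \<forall>y\<in>set [1..<6]. perm_of (L6 ! i) y \<in> set [1..<6]" by code_simp
  then have "orbit_of (gen {perm_of (L6 ! 0), perm_of (L6 ! 1)}) 1 \<subseteq> set [1..<6]"
    by (intro orbit_of_subset) (simp, blast)
  then have "6 \<notin> orbit_of (gen {perm_of (L6 ! 0), perm_of (L6 ! 1)}) 1" by auto
  then have "g 6 = 6" using g by (auto simp: Alt_def permutes_def)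
  moreover have "g \<in> gen {?t, ?a, ?b}" using g unfolding e by (simp only: insert_commute Int_iff)
  ultimately have "g \<in> gen {?a, ?b}" using six_points(1)[of 1 2 3 4 5 "6 :: nat" g] by simp
  then show "g \<in> gen {perm_of (L6 ! 0), perm_of (L6 ! 1)}" unfolding e by (simp only: insert_commute)
qed

lemma base6: "glue_base 6 3 (\<lambda>i. perm_of (L6 ! i)) 1"
  using glue_base_perm_of[OF checks(2) ip6 star6] by (simp add: numeral_3_eq_3 del: perm_of.simps)

lemma base9: "glue_base 9 3 (\<lambda>i. perm_of (L9 ! i)) 1"
proof -
  let ?L = "L9 @ [[(1, 2), (2, 3)]]"
  let ?S = "{perm_of (L9 ! 0), perm_of (L9 ! 1)}"
  have L: "\<forall>ts\<in>set ?L. even_in 9 ts" by code_simp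
  \<comment> \<open>On the orbits \<open>{1, 2, 3}\<close>, \<open>{4, 5, 6, 7}\<close>,
    \<open>{8, 9}\<close> the product of the first two generators has orders 3, 4 and 2. Its fourth
    power is therefore a bare three-cycle, and here, unlike for the other bases, the alternating
    group of the orbit really lies in the subgroup.\<close>
  have w: "word_eq 9 ?L (concat (replicate 4 [0, 1])) [3]" by code_simp
  have inv: "s \<circ> s = id" if "s \<in> ?S" for s
  proof -
    have c: "word_eq 9 L9 [0, 0] []" "word_eq 9 L9 [1, 1] []" by code_simp+
    from word_eqD[OF even_in_of_check[OF checks(3)] c(1)] word_eqD[OF even_in_of_check[OF checks(3)] c(2)]
    show ?thesis using that unfolding word1 word_Nil by blast
  qed
  have nth: "?L ! 0 = L9 ! 0" "?L ! 1 = L9 ! 1" "?L ! 3 = [(1, 2), (2, 3)]" by simp_all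
  have "word ?L (concat (replicate 4 [0, 1])) \<in> gen ((\<lambda>i. perm_of (?L ! i)) ` {0, 1})" by (rule word_mem_gen) simp
  then have "perm_of [(1, 2), (2, 3)] \<in> gen ?S"
    unfolding word_eqD[OF L w] word1 image_insert image_empty nth .
  moreover have "perm_of [(1, 2), (2, 3)] = cyc3 1 2 3" by (rule ext) (simp add: cyc3_def)
  ultimately have c: "cyc3 1 2 3 \<in> gen ?S" by (simp only:)
  have d: "distinct [1, 2, 3 :: nat]" "distinct [1, 3, 2 :: nat]" by simp_all
  have "cyc3 1 3 2 \<in> gen ?S" using inv d(1) c by (rule cyc3_reverse_mem)
  then have "{1, 2, 3} \<subseteq> reach (gen ?S) 1" using c d unfolding reach_def by blast
  then have A: "Alt {1, 2, 3} \<subseteq> gen ?S" using inv by (intro Alt_subset_gen) auto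
  have "\<forall>i\<in>{0, 1}. \<forall>y\<in>set [1, 2, 3]. perm_of (L9 ! i) y \<in> set [1, 2, 3]" by code_simp
  then have "orbit_of (gen ?S) 1 \<subseteq> set [1, 2, 3]" by (intro orbit_of_subset) (simp, blast)
  then have "Alt (orbit_of (gen ?S) 1) \<subseteq> Alt {1, 2, 3}" by (intro Alt_mono) simp
  then have star: "gen {perm_of (L9 ! 0), perm_of (L9 ! 1), perm_of (L9 ! 2)} \<inter> Alt (orbit_of (gen ?S) 1) \<subseteq> gen ?S"
    using A by blast
  show ?thesis using glue_base_perm_of[OF checks(3) ip9 star] by (simp add: numeral_3_eq_3 del: perm_of.simps)
qed

lemma alt_string_of_base:
  assumes base: "glue_base N 3 (\<lambda>i. perm_of (L ! i)) 1" and n: "N < n" "4 dvd n - N"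
  shows "\<exists>rho. alt_string n 5 rho"
    and "\<lbrakk>\<forall>ts\<in>set L. even_in N ts; word_eq N L (concat (replicate (2 * l + 1) [0, 1])) [];
      word_eq N L (concat (replicate (2 * l' + 1) [1, 2])) [];
      perm_of (L ! 1) (perm_of (L ! 0) 1) \<noteq> perm_of (L ! 0) 1; r \<in> {3, 4}\<rbrakk> \<Longrightarrow> \<exists>rho. alt_string n r rho"
proof -
  interpret gluing N 3 "\<lambda>i. perm_of (L ! i)" 1 "n - N"
    by (intro gluing.intro base gluing_axioms.intro) (use n in auto)
  have N: "N + (n - N) = n" using n by simp
  show "\<exists>rho. alt_string n 5 rho" using glue_alt_string unfolding N by auto
  show "\<exists>rho. alt_string n r rho" if L: "\<forall>ts\<in>set L. even_in N ts"
    and o1: "word_eq N L (concat (replicate (2 * l + 1) [0, 1])) []"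
    and o2: "word_eq N L (concat (replicate (2 * l' + 1) [1, 2])) []"
    and ne: "perm_of (L ! 1) (perm_of (L ! 0) 1) \<noteq> perm_of (L ! 0) 1" and r: "r \<in> {3, 4}"
  proof -
    note o = word_eqD[OF L o1, unfolded word_power word1 word_Nil] word_eqD[OF L o2, unfolded word_power word1 word_Nil]
    have "alt_string n 4 (reduce glue)" using glue_reduce[OF _ o(1)] unfolding N by simp
    moreover have "alt_string n 3 (reduce (reduce glue))" using glue_reduce_reduce[OF _ o ne] unfolding N by simp
    ultimately show ?thesis using r by blast
  qed
qed

section \<open>Degree twelve and the theorem\<close>

text \<open>The fifth entry is no generator: it is the three-cycle that a word in the first four is
  compared with.\<close>

abbreviation R12 :: "(nat \<times> nat) list list" where
  "R12 \<equiv> [[(4, 5), (6, 8), (9, 11), (10, 12)], [(3, 4), (5, 7), (8, 10), (11, 12)],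
    [(2, 3), (4, 6), (5, 8), (10, 12)], [(1, 2), (6, 9), (8, 11), (10, 12)], [(1, 2), (2, 3)]]"

text \<open>The hypotheses of \<open>gen_stabilizer\<close> in executable form: \<open>W\<close>
  holds words for the coset representatives and \<open>V\<close> words in the subgroup generators
  \<open>A\<close> that serve as correction factors.\<close>

definition stabilizer_check :: "nat \<Rightarrow> (nat \<times> nat) list list \<Rightarrow> nat list \<Rightarrow> nat list \<Rightarrow> nat list list \<Rightarrow> nat list list \<Rightarrow> nat \<Rightarrow> bool" where
  "stabilizer_check N L I A W V x \<longleftrightarrow> [] \<in> set W \<and> (\<forall>v\<in>set V. \<forall>i\<in>set v. i \<in> set A)
    \<and> (\<forall>i\<in>set I. \<forall>w\<in>set W. \<exists>w'\<in>set W. \<exists>v\<in>set V. word_eq N L (i # w) (w' @ v))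
    \<and> (\<forall>w\<in>set W. w = [] \<or> word L w x \<noteq> x) \<and> (\<forall>i\<in>set A. perm_of (L ! i) x = x)"

lemma word_stabilizer:
  assumes L: "\<forall>ts\<in>set L. even_in N ts" and chk: "stabilizer_check N L I A W V x"
    and g: "g \<in> gen ((\<lambda>i. perm_of (L ! i)) ` set I)" "g x = x"
  shows "g \<in> gen ((\<lambda>i. perm_of (L ! i)) ` set A)"
proof (rule gen_stabilizer[of "word L ` set W", OF _ _ _ _ g])
  show "id \<in> word L ` set W" using chk unfolding stabilizer_check_def by (metis imageI word_Nil)
next
  fix s t assume "s \<in> (\<lambda>i. perm_of (L ! i)) ` set I" "t \<in> word L ` set W"
  then obtain i w where iw: "i \<in> set I" "s = perm_of (L ! i)" "w \<in> set W" "t = word L w" by blast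
  then obtain w' v where v: "w' \<in> set W" "v \<in> set V" "word_eq N L (i # w) (w' @ v)"
    using chk unfolding stabilizer_check_def by blast
  then have "s \<circ> t = word L w' \<circ> word L v" using word_eqD[OF L v(3)] iw by (simp only: word_Cons word_append)
  moreover have "set v \<subseteq> set A" using chk v(2) unfolding stabilizer_check_def by blast
  then have "word L v \<in> gen ((\<lambda>i. perm_of (L ! i)) ` set A)" by (rule word_mem_gen)
  ultimately show "\<exists>t'\<in>word L ` set W. \<exists>h\<in>gen ((\<lambda>i. perm_of (L ! i)) ` set A). s \<circ> t = t' \<circ> h" using v(1) by blast
next
  fix t assume "t \<in> word L ` set W" "t \<noteq> id"
  then obtain w where "w \<in> set W" "t = word L w" "w \<noteq> []" using word_Nil by blast
  then show "t x \<noteq> x" using chk unfolding stabilizer_check_def by blast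
next
  fix s assume "s \<in> (\<lambda>i. perm_of (L ! i)) ` set A"
  then show "s x = x" using chk unfolding stabilizer_check_def by blast
qed

lemma R12_even: "\<forall>ts\<in>set R12. even_in 12 ts"
  by code_simp

lemma R12_relations:
  "\<forall>i\<in>set [0..<4]. word_eq 12 R12 [i, i] []" "word_eq 12 R12 [0, 2] [2, 0]" "word_eq 12 R12 [0, 3] [3, 0]"
  "word_eq 12 R12 [1, 3] [3, 1]" "word_eq 12 R12 (concat (replicate (2 * 1 + 1) [2, 3])) []"
  "word_eq 12 R12 (concat (replicate 2 [0, 1, 2, 1, 2, 1, 2, 1, 3])) [4]"
  by code_simp+

lemma R12_values:
  "\<forall>i\<in>set [0..<4]. \<exists>y\<in>set [1..<13]. perm_of (R12 ! i) y \<noteq> y"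
  "\<forall>i\<in>set [0..<3]. perm_of (R12 ! i) 1 = 1" "perm_of (R12 ! 3) 1 = 2"
  "\<forall>i\<in>set [0..<3]. \<exists>y\<in>set [1..<13]. perm_of (R12 ! i) y \<noteq> perm_of (R12 ! Suc i) y"
  "\<forall>v\<in>set [2..<13]. \<exists>u\<in>set [1..<v]. \<exists>i\<in>set [0..<4]. perm_of (R12 ! i) u = v"
  "word R12 [0, 1] 4 \<noteq> word R12 [1, 0] 4" "word R12 [2, 1] 3 \<noteq> word R12 [1, 2] 3"
  by code_simp+

lemma R12_inter02: "gen {perm_of (R12 ! 0), perm_of (R12 ! 1)} \<inter> gen {perm_of (R12 ! 1), perm_of (R12 ! 2)} \<subseteq> gen {perm_of (R12 ! 1)}"
  by (rule dihedral_inter_invariant[OF R12_even, where l = 12 and f = "\<lambda>y. (y = 1, y = 9, y \<le> 4 \<or> y = 6)"]; code_simp)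

lemma R12_inter13: "gen {perm_of (R12 ! 3), perm_of (R12 ! 2)} \<inter> gen {perm_of (R12 ! 2), perm_of (R12 ! 1)} \<subseteq> gen {perm_of (R12 ! 2)}"
  by (rule dihedral_inter_invariant[OF R12_even, where l = 3 and f = "\<lambda>y. y = 1"]; code_simp)

lemma R12_stabilizer:
  "stabilizer_check 12 R12 [1, 2, 3] [1, 2] [[], [3], [2, 3], [1, 2, 3], [2, 1, 2, 3], [3, 2, 1, 2, 3]]
    [[], [1], [2], [1, 2, 1, 2, 1, 2, 1, 2, 1]] 1"
  by code_simp

lemma alt_string_12_4: "alt_string 12 4 (\<lambda>i. perm_of (R12 ! i))"
proof -
  define rho where "rho i = perm_of (R12 ! i)" for i
  have rho: "rho = (\<lambda>i. perm_of (R12 ! i))" by (rule ext) (rule rho_def)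
  have inv: "rho i \<circ> rho i = id" if "i < 4" for i
  proof -
    have "i \<in> set [0..<4]" using that by simp
    then have "word_eq 12 R12 [i, i] []" using R12_relations(1) by blast
    from word_eqD[OF R12_even this] show ?thesis by (simp only: word1 word_Nil rho_def)
  qed
  have ne: "rho i \<noteq> id" if "i < 4" for i
  proof -
    have "i \<in> set [0..<4]" using that by simp
    then have "\<exists>y. rho i y \<noteq> y" using R12_values(1) unfolding rho_def by blast
    then show ?thesis by auto
  qed
  have ne2: "rho i \<noteq> rho (Suc i)" if "i < 3" for i
  proof -
    have "i \<in> set [0..<3]" using that by simp
    then show ?thesis using R12_values(4) unfolding rho_def by metis
  qed
  have fix1: "rho i 1 = 1" if "i < 3" for i
  proof -
    have "i \<in> set [0..<3]" using that by simp
    then show ?thesis using R12_values(2) unfolding rho_def by blast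
  qed
  have c: "rho 0 \<circ> rho 2 = rho 2 \<circ> rho 0" "rho 0 \<circ> rho 3 = rho 3 \<circ> rho 0" "rho 1 \<circ> rho 3 = rho 3 \<circ> rho 1"
    unfolding rho_def by (rule R12_relations(2-4)[THEN word_eqD[OF R12_even], unfolded word1])+
  have comm: "rho i \<circ> rho j = rho j \<circ> rho i" if ij: "i + 2 \<le> j" "j < 4" for i j
  proof -
    consider "i = 0" "j = 2" | "i = 0" "j = 3" | "i = 1" "j = 3" using ij by linarith
    then show ?thesis by cases (simp_all only: c)
  qed
  have string: "string_involutions 4 rho" by (intro string_involutions.intro inv comm)
  have single: "gen {rho i} = {id, rho i}" if "i < 4" for i using gen_singleton[OF inv[OF that]] .
  have ip: "interval_ip 4 rho" unfolding interval_ip_def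
  proof (intro allI impI)
    fix i j assume "i < j" "j < (4 :: nat)"
    then consider "j = Suc i" "i < 3" | "i = 0" "j = 2" | "i = 1" "j = 3" | "i = 0" "j = 3" by linarith
    then show "gen (rho ` {i..<j}) \<inter> gen (rho ` {i<..j}) \<subseteq> gen (rho ` {i<..<j})"
    proof cases
      case 1
      then have "{i..<j} = {i}" "{i<..j} = {Suc i}" "{i<..<j} = {}" by auto
      then show ?thesis using single[of i] single[of "Suc i"] 1 ne2[of i] by auto
    next
      case 2
      moreover have "{0..<2} = {0, 1 :: nat}" "{0<..2} = {1, 2 :: nat}" "{0<..<2} = {1 :: nat}" by auto
      ultimately show ?thesis using R12_inter02 by (simp only: image_insert image_empty rho_def)
    next
      case 3
      moreover have "{1..<3} = {2, 1 :: nat}" "{1<..3} = {3, 2 :: nat}" "{1<..<3} = {2 :: nat}" by auto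
      ultimately show ?thesis using R12_inter13 by (simp only: image_insert image_empty rho_def Int_commute)
    next
      case 4
      show ?thesis
      proof
        fix g assume g: "g \<in> gen (rho ` {i..<j}) \<inter> gen (rho ` {i<..j})"
        \<comment> \<open>The first three generators all fix 1, so the intersection lies in the
          stabiliser of 1 in the group of the last three, which the coset table identifies.\<close>
        have "g 1 = 1" by (rule gen_fix[of "rho ` {i..<j}"]) (use 4 fix1 g in auto)
        moreover have s: "{i<..j} = set [1, 2, 3]" "{i<..<j} = set [1, 2]" using 4 by auto
        moreover have "g \<in> gen (rho ` set [1, 2, 3])" using g unfolding s by blast
        ultimately show "g \<in> gen (rho ` {i<..<j})"
          unfolding s rho by - (rule word_stabilizer[OF R12_even R12_stabilizer])
      qed
    qed
  qed
  let ?S = "rho ` {..<4}"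
  have inv': "s \<circ> s = id" if "s \<in> ?S" for s using that inv by blast
  have "word R12 (concat (replicate 2 [0, 1, 2, 1, 2, 1, 2, 1, 3])) \<in> gen ((\<lambda>i. perm_of (R12 ! i)) ` {..<4})"
    by (rule word_mem_gen) simp
  moreover have "word R12 [4] = cyc3 1 2 3" by (rule ext) (simp add: cyc3_def)
  ultimately have c: "cyc3 1 2 3 \<in> gen ?S" unfolding word_eqD[OF R12_even R12_relations(6)] rho by (simp only:)
  have d: "distinct [1, 2, 3 :: nat]" by simp
  then have r12: "1 \<in> reach (gen ?S) 1" "2 \<in> reach (gen ?S) 1" using c unfolding reach_def by blast+
  have "v \<in> reach (gen ?S) 1" if "v \<in> {1..12}" for v
    using that
  proof (induction v rule: less_induct)
    case (less v)
    show ?case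
    proof (cases "v = 1")
      case False
      then have "v \<in> set [2..<13]" using less.prems unfolding set_upt by simp
      then obtain u i where ui: "u \<in> set [1..<v]" "i \<in> set [0..<4]" "perm_of (R12 ! i) u = v"
        using R12_values(5) by blast
      then have i: "rho i \<in> gen ?S" "i < 4" by (auto intro: gen_base)
      have "rho i 1 = 1 \<or> rho i 1 = 2" using i(2) fix1[of i] R12_values(3) by (cases "i = 3") (auto simp: rho_def)
      then have a: "rho i 1 \<in> reach (gen ?S) 1" using r12 by (elim disjE) (simp_all only:)
      have b: "u \<in> reach (gen ?S) 1" using ui(1) less by simp
      have "rho i u \<in> reach (gen ?S) 1" using inv' i(1) a b by (rule reach_closed)
      moreover have "rho i u = v" using ui(3) unfolding rho_def .
      ultimately show ?thesis by (simp only:)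
    qed (simp add: reach_def)
  qed
  then have "Alt {1..12} \<subseteq> gen ?S" using inv' by (intro Alt_subset_gen) auto
  moreover have "rho i \<in> Alt {1..12}" if "i < 4" for i
  proof -
    have "R12 ! i \<in> set R12" by (rule nth_mem) (use that in simp)
    then show ?thesis unfolding rho_def using R12_even perm_of_Alt by blast
  qed
  ultimately show ?thesis using string ip ne unfolding alt_string_def rho by blast
qed

lemma alt_string_12_3: "alt_string 12 3 (reduce (\<lambda>i. perm_of (R12 ! i)))"
proof (rule alt_string_reduce)
  show "alt_string 12 (Suc 3) (\<lambda>i. perm_of (R12 ! i))" using alt_string_12_4 by (simp del: perm_of.simps)
  note rel = R12_relations(2-4)[THEN word_eqD[OF R12_even], unfolded word1]
  have "0 \<in> set [0..<4]" by simp
  then have i: "word_eq 12 R12 [0, 0] []" using R12_relations(1) by blast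
  show "perm_of (R12 ! 0) \<in> gen {perm_of (R12 ! 0) \<circ> perm_of (R12 ! 2), perm_of (R12 ! 3)}"
    by (rule mem_gen_of_odd_order[OF word_eqD[OF R12_even i, unfolded word1 word_Nil] rel(1,2)
          word_eqD[OF R12_even R12_relations(5), unfolded word_power word1 word_Nil]])
  show "perm_of (R12 ! 0) \<circ> perm_of (R12 ! 1) \<noteq> perm_of (R12 ! 1) \<circ> perm_of (R12 ! 0)"
    using R12_values(6) unfolding word1 by metis
  show "perm_of (R12 ! 2) \<circ> perm_of (R12 ! 1) \<noteq> perm_of (R12 ! 1) \<circ> perm_of (R12 ! 2)"
    using R12_values(7) unfolding word1 by metis
qed simp

lemma alt_string_exists:
  assumes "12 \<le> n" "3 \<le> r" "r \<le> (n - 1) div 2"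
  shows "\<exists>rho. alt_string n r rho"
proof -
  have orders: "word_eq 6 L6 (concat (replicate (2 * 2 + 1) [0, 1])) []" "word_eq 6 L6 (concat (replicate (2 * 2 + 1) [1, 2])) []"
    "word_eq 11 L11 (concat (replicate (2 * 2 + 1) [0, 1])) []" "word_eq 11 L11 (concat (replicate (2 * 2 + 1) [1, 2])) []"
    "word_eq 12 L12 (concat (replicate (2 * 1 + 1) [0, 1])) []" "word_eq 12 L12 (concat (replicate (2 * 2 + 1) [1, 2])) []"
    "word_eq 5 L5 (concat (replicate (2 * 2 + 1) [0, 1])) []"
    by code_simp+
  have ne: "perm_of (L6 ! 1) (perm_of (L6 ! 0) 1) \<noteq> perm_of (L6 ! 0) 1" "perm_of (L11 ! 1) (perm_of (L11 ! 0) 1) \<noteq> perm_of (L11 ! 0) 1"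
    "perm_of (L12 ! 1) (perm_of (L12 ! 0) 1) \<noteq> perm_of (L12 ! 0) 1"
    by code_simp+
  \<comment> \<open>The bases of degree 6, 12 and 11 serve the residues 2, 0 and 3 modulo 4. Residue
    1 uses degree 9 for rank 5 and the rank 2 base of degree 5, with at most one reduction, for
    ranks 4 and 3. Rank 5 appears separately only for odd \<open>n\<close>, where the doubled family
    starts at rank 6.\<close>
  consider (a) "even n \<and> 5 \<le> r" | (b) "odd n \<and> 6 \<le> r" | (c) "n mod 4 = 2 \<and> r \<le> 4"
    | (d) "n mod 4 = 0 \<and> n \<noteq> 12 \<and> r \<le> 4" | (e) "n = 12 \<and> r \<le> 4" | (f) "n mod 4 = 3 \<and> r \<le> 4"
    | (g) "n mod 4 = 3 \<and> r = 5" | (h) "n mod 4 = 1 \<and> r = 5" | (i) "n mod 4 = 1 \<and> r \<le> 4"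
  proof -
    have "even n \<and> 5 \<le> r \<or> odd n \<and> 6 \<le> r \<or> n mod 4 = 2 \<and> r \<le> 4
      \<or> n mod 4 = 0 \<and> n \<noteq> 12 \<and> r \<le> 4 \<or> n = 12 \<and> r \<le> 4 \<or> n mod 4 = 3 \<and> r \<le> 4
      \<or> n mod 4 = 3 \<and> r = 5 \<or> n mod 4 = 1 \<and> r = 5 \<or> n mod 4 = 1 \<and> r \<le> 4"
      by presburger
    then show thesis using that by argo
  qed
  then show ?thesis
  proof cases
    case a
    show ?thesis by (rule alt_string_even) (use a assms in presburger)+
  next
    case b
    show ?thesis by (rule alt_string_odd) (use b assms in presburger)+
  next
    case c
    then have r: "r \<in> {3, 4}" using assms(2) by auto
    have "6 < n" "4 dvd n - 6" using c assms(1) by presburger+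
    then show ?thesis
      by (rule alt_string_of_base(2)[OF base6 _ _ even_in_of_check[OF checks(2)] orders(1,2) ne(1) r])
  next
    case d
    then have r: "r \<in> {3, 4}" using assms(2) by auto
    have "12 < n" "4 dvd n - 12" using d assms(1) by presburger+
    then show ?thesis
      by (rule alt_string_of_base(2)[OF base12 _ _ even_in_of_check[OF checks(5)] orders(5,6) ne(3) r])
  next
    case e
    then have r: "r \<in> {3, 4}" using assms(2) by auto
    show ?thesis using r e alt_string_12_3 alt_string_12_4 by blast
  next
    case f
    then have r: "r \<in> {3, 4}" using assms(2) by auto
    have "11 < n" "4 dvd n - 11" using f assms(1) by presburger+
    then show ?thesis
      by (rule alt_string_of_base(2)[OF base11 _ _ even_in_of_check[OF checks(4)] orders(3,4) ne(2) r])
  next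
    case g
    have "11 < n" "4 dvd n - 11" using g assms(1) by presburger+
    then show ?thesis using alt_string_of_base(1)[OF base11] g by blast
  next
    case h
    have "9 < n" "4 dvd n - 9" using h assms(1) by presburger+
    then show ?thesis using alt_string_of_base(1)[OF base9] h by blast
  next
    case i
    then have r: "r \<in> {3, 4}" using assms(2) by auto
    have n: "0 < n - 5" "4 dvd n - 5" "5 + (n - 5) = n" using i assms(1) by presburger+
    interpret gluing 5 2 "\<lambda>i. perm_of (L5 ! i)" 1 "n - 5"
      by (intro gluing.intro base5 gluing_axioms.intro) (use n in auto)
    have "alt_string n 4 glue" using glue_alt_string unfolding n(3) by simp
    moreover have "alt_string n 3 (reduce glue)"
      using glue_reduce[OF _ word_eqD[OF even_in_of_check[OF checks(1)] orders(7), unfolded word_power word1 word_Nil]]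
      unfolding n(3) by simp
    ultimately show ?thesis using r by blast
  qed
qed

theorem theorem1p1:
  fixes n r :: nat
  assumes "n \<ge> 12" and "3 \<le> r" and "r \<le> (n - 1) div 2"
  shows "\<exists>rho :: nat \<Rightarrow> (nat \<Rightarrow> nat). string_C_group (alt_group n) r rho"
  using alt_string_exists[OF assms] alt_string_imp_string_C_group by blast

end
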